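(* Let $f_\varepsilon$ be a solution of the Vlasov-Cahn-Hilliard equation (VCH) with parameters $\varepsilon,\alpha>0$. Define the Helmholtz free energy $$\mathcal F(t):=\int_{\mathbb{R}^{2d}}\big[2D\log f_\varepsilon+|\xi|^2\big]f_\varepsilon\,dx\,d\xi+\frac1{2\alpha^2}\int_{\mathbb{R}^{2d}}\omega^L_\alpha(y)\big[\varrho_\varepsilon\star\omega^S(t,x)-\varrho_\varepsilon\star\omega^S(t,x-y)\big]^2dx\,dy .$$ Then $\mathcal F$ is dissipated as $$\frac{d}{dt}\mathcal F(t)=-\frac{2D}{\varepsilon^2}\int_{\mathbb{R}^{2d}}\big[f_\varepsilon-\varrho_\varepsilon M(\xi)\big]\big[\log f_\varepsilon-\log(\varrho_\varepsilon M(\xi))\big]dx\,d\xi=-2D\int_{\mathbb{R}^{2d}}\mathcal D_\varepsilon\,dx\,d\xi,$$ where the dissipation term is defined as $$\mathcal D_\varepsilon(t,x,\xi):=\frac1{\varepsilon^2}\big[f_\varepsilon-\varrho_\varepsilon M(\xi)\big]\big[\log f_\varepsilon-\log(\varrho_\varepsilon M(\xi))\big]\ge0 .$$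
   Context: $d$ is the space dimension, $T>0$ a time horizon, $D>0$ and $\delta>0$ are constants, and $\star$ is convolution in $x\in\mathbb{R}^d$. The kernel $\omega^S\ge0$ is a function (that may be thought of as a centered Gaussian) with $\int\omega^S(y)\,dy=1$, $\int y\,\omega^S(y)\,dy=0$, $\int|y|^2\omega^S(y)\,dy<\infty$. The kernel $\omega^L$ is smooth, nonnegative, symmetric, compactly supported, with $\int\omega^L(y)\,dy=1$, $\int y\,\omega^L(y)\,dy=0$, $\int y_iy_j\,\omega^L(y)\,dy=\delta_{i,j}\,\delta$ ($\delta_{i,j}$ the Kronecker symbol), $\int|y|^3\omega^L(y)\,dy<\infty$; and $\omega^L_\alpha(x)=\alpha^{-d}\omega^L(x/\alpha)$. The Maxwellian is $M(\xi)=(2\pi D)^{-d/2}\exp(-|\xi|^2/(2D))$. The Vlasov-Cahn-Hilliard equation (VCH) for the particle density $f_\varepsilon(t,x,\xi)$, $t\in(0,T)$, $x,\xi\in\mathbb{R}^d$, with nonnegative initial data, is $$\varepsilon^2\partial_tf_\varepsilon+\varepsilon\,\xi\cdot\nabla_xf_\varepsilon+\varepsilon F_\varepsilon\cdot\nabla_\xi f_\varepsilon=\varrho_\varepsilon(t,x)M(\xi)-f_\varepsilon,\qquad \varrho_\varepsilon(t,x)=\int_{\mathbb{R}^d} f_\varepsilon(t,x,\xi)\,d\xi,$$ with $F_\varepsilon=-\nabla_x\Phi_\varepsilon$, $\Phi_\varepsilon=\Phi^S+\Phi^L$, $\Phi^S=\frac1{\alpha^2}\,\omega^S\star\omega^S\star\varrho_\varepsilon$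 (short-range repulsion), $\Phi^L=-\frac1{\alpha^2}\,\omega^L_\alpha\star\omega^S\star\omega^S\star\varrho_\varepsilon$ (long-range attraction).
   Formalization: The kernel ω^S is also assumed even (the identity fails otherwise), and "solution" means a nonnegative classical C² solution with f and its first derivatives O((1+|x|+|ξ|)^-(2d+4)) and bounded second derivatives, locally uniformly in t. *)

theory Defs
  imports "HOL-Analysis.Analysis"
begin

section \<open>Calculus notation\<close>

definition partial_deriv :: "'b::euclidean_space \<Rightarrow> ('b \<Rightarrow> real) \<Rightarrow> 'b \<Rightarrow> real" where
  "partial_deriv b g p = frechet_derivative g (at p) b"

definition grad :: "('b::euclidean_space \<Rightarrow> real) \<Rightarrow> 'b \<Rightarrow> 'b" where
  "grad g p = (\<Sum>b\<in>Basis. partial_deriv b g p *\<^sub>R b)"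

text \<open>Continuous differentiability of order \<open>k\<close>; intended for open sets \<open>S\<close> only, since the
  derivatives are taken in the whole space.\<close>

primrec Ck_on :: "nat \<Rightarrow> ('b::euclidean_space \<Rightarrow> real) \<Rightarrow> 'b set \<Rightarrow> bool" where
  "Ck_on 0 g S \<longleftrightarrow> continuous_on S g"
| "Ck_on (Suc k) g S \<longleftrightarrow>
     (\<forall>p\<in>S. g differentiable (at p)) \<and> (\<forall>b\<in>Basis. Ck_on k (partial_deriv b g) S)"

definition smooth :: "('b::euclidean_space \<Rightarrow> real) \<Rightarrow> bool" where
  "smooth g \<longleftrightarrow> (\<forall>k. Ck_on k g UNIV)"

definition conv :: "('a::euclidean_space \<Rightarrow> real) \<Rightarrow> ('a \<Rightarrow> real) \<Rightarrow> 'a \<Rightarrow> real" where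
  "conv g h x = (LINT y|lborel. g (x - y) * h y)"


section \<open>Kernels\<close>

text \<open>\<open>has_bochner_integral\<close> asserts absolute convergence together with the value.
  Evenness of the short-range kernel is not part of the first definition; where it is needed
  (convolution with \<open>\<omega>S\<close> being self-adjoint in \<open>L\<^sup>2\<close>) it is assumed separately.\<close>

definition short_range_kernel :: "('a::euclidean_space \<Rightarrow> real) \<Rightarrow> bool" where
  "short_range_kernel \<omega> \<longleftrightarrow>
     (\<forall>y. 0 \<le> \<omega> y) \<and>
     has_bochner_integral lborel \<omega> 1 \<and>
     has_bochner_integral lborel (\<lambda>y. \<omega> y *\<^sub>R y) 0 \<and>
     integrable lborel (\<lambda>y. (norm y)\<^sup>2 * \<omega> y)"

definition long_range_kernel :: "real \<Rightarrow> ('a::euclidean_space \<Rightarrow> real) \<Rightarrow> bool" where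
  "long_range_kernel \<delta> \<omega> \<longleftrightarrow>
     smooth \<omega> \<and>
     (\<forall>y. 0 \<le> \<omega> y) \<and>
     (\<forall>y. \<omega> (- y) = \<omega> y) \<and>
     compact (closure {y. \<omega> y \<noteq> 0}) \<and>
     has_bochner_integral lborel \<omega> 1 \<and>
     has_bochner_integral lborel (\<lambda>y. \<omega> y *\<^sub>R y) 0 \<and>
     (\<forall>i\<in>Basis. \<forall>j\<in>Basis.
        has_bochner_integral lborel (\<lambda>y. (y \<bullet> i) * (y \<bullet> j) * \<omega> y) (if i = j then \<delta> else 0)) \<and>
     integrable lborel (\<lambda>y. (norm y) ^ 3 * \<omega> y)"

definition rescale :: "real \<Rightarrow> ('a::euclidean_space \<Rightarrow> real) \<Rightarrow> 'a \<Rightarrow> real" where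
  "rescale \<alpha> \<omega> x = \<omega> (x /\<^sub>R \<alpha>) / \<alpha> ^ DIM('a)"

definition maxwellian :: "real \<Rightarrow> 'a::euclidean_space \<Rightarrow> real" where
  "maxwellian D \<xi> =
     (2 * pi * D) powr (- (real DIM('a) / 2)) * exp (- ((norm \<xi>)\<^sup>2 / (2 * D)))"


section \<open>The Vlasov-Cahn-Hilliard equation\<close>

definition rho :: "(real \<Rightarrow> 'a::euclidean_space \<Rightarrow> 'a \<Rightarrow> real) \<Rightarrow> real \<Rightarrow> 'a \<Rightarrow> real" where
  "rho f t x = (LINT \<xi>|lborel. f t x \<xi>)"

definition Phi_S :: "real \<Rightarrow> ('a::euclidean_space \<Rightarrow> real) \<Rightarrow> ('a \<Rightarrow> real) \<Rightarrow> 'a \<Rightarrow> real" where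
  "Phi_S \<alpha> \<omega>S r x = 1 / \<alpha>\<^sup>2 * conv \<omega>S (conv \<omega>S r) x"

definition Phi_L ::
  "real \<Rightarrow> ('a::euclidean_space \<Rightarrow> real) \<Rightarrow> ('a \<Rightarrow> real) \<Rightarrow> ('a \<Rightarrow> real) \<Rightarrow> 'a \<Rightarrow> real" where
  "Phi_L \<alpha> \<omega>S \<omega>L r x = - (1 / \<alpha>\<^sup>2) * conv (rescale \<alpha> \<omega>L) (conv \<omega>S (conv \<omega>S r)) x"

definition force ::
  "real \<Rightarrow> ('a::euclidean_space \<Rightarrow> real) \<Rightarrow> ('a \<Rightarrow> real) \<Rightarrow> ('a \<Rightarrow> real) \<Rightarrow> 'a \<Rightarrow> 'a" where
  "force \<alpha> \<omega>S \<omega>L r x = - grad (\<lambda>y. Phi_S \<alpha> \<omega>S r y + Phi_L \<alpha> \<omega>S \<omega>L r y) x"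

text \<open>A phase-space density on \<open>[0,T)\<close>, with \<open>f 0\<close> the nonnegative initial datum, that satisfies
  the equation pointwise on \<open>(0,T)\<close>.\<close>

definition VCH_solution ::
  "real \<Rightarrow> real \<Rightarrow> real \<Rightarrow> real \<Rightarrow> ('a::euclidean_space \<Rightarrow> real) \<Rightarrow> ('a \<Rightarrow> real) \<Rightarrow>
     (real \<Rightarrow> 'a \<Rightarrow> 'a \<Rightarrow> real) \<Rightarrow> bool" where
  "VCH_solution T D \<epsilon> \<alpha> \<omega>S \<omega>L f \<longleftrightarrow>
     (\<forall>t\<in>{0..<T}. \<forall>x \<xi>. 0 \<le> f t x \<xi>) \<and>
     (\<forall>x \<xi>. continuous_on {0..<T} (\<lambda>t. f t x \<xi>)) \<and>
     (\<forall>t\<in>{0<..<T}. \<forall>x \<xi>.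
        \<epsilon>\<^sup>2 * deriv (\<lambda>s. f s x \<xi>) t
        + \<epsilon> * (\<xi> \<bullet> grad (\<lambda>y. f t y \<xi>) x)
        + \<epsilon> * (force \<alpha> \<omega>S \<omega>L (rho f t) x \<bullet> grad (f t x) \<xi>)
        = rho f t x * maxwellian D \<xi> - f t x \<xi>)"

text \<open>
  Regularity under which the equation holds in the classical sense and the integrals below make
  sense: \<open>f\<close> is of class \<open>C\<^sup>2\<close> on \<open>(0,T)\<close> times phase space and, locally uniformly in time, its
  second derivatives are bounded while \<open>f\<close> and its first derivatives are
  \<open>O((1 + |x| + |\<xi>|) ^ - (2d + 4))\<close>. This is the order of decay for which
  \<open>|\<xi>|\<^sup>2 \<xi> \<bullet> \<nabla>\<^sub>x f\<close>, the worst term in the energy balance, is integrable over the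
  \<open>2d\<close>-dimensional phase space. No lower bound on \<open>f\<close> is imposed.\<close>

definition regular_density ::
  "real \<Rightarrow> (real \<Rightarrow> 'a::euclidean_space \<Rightarrow> 'a \<Rightarrow> real) \<Rightarrow> bool" where
  "regular_density T f \<longleftrightarrow>
     (let g = (\<lambda>(t, x, \<xi>). f t x \<xi>) in
      Ck_on 2 g ({0<..<T} \<times> UNIV) \<and>
      (\<forall>a b. 0 < a \<and> b < T \<longrightarrow>
        (\<exists>C. \<forall>t\<in>{a..b}. \<forall>x \<xi>.
           (1 + norm x + norm \<xi>) ^ (2 * DIM('a) + 4) * \<bar>g (t, x, \<xi>)\<bar> \<le> C \<and>
           (\<forall>i\<in>Basis.
              (1 + norm x + norm \<xi>) ^ (2 * DIM('a) + 4) * \<bar>partial_deriv i g (t, x, \<xi>)\<bar> \<le> C) \<and>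
           (\<forall>i\<in>Basis. \<forall>j\<in>Basis.
              \<bar>partial_deriv i (partial_deriv j g) (t, x, \<xi>)\<bar> \<le> C))))"


section \<open>Free energy and dissipation\<close>

text \<open>Since \<^term>\<open>ln (0::real) = 0\<close>, the entropy density is \<open>0\<close> wherever \<open>f\<close> vanishes.\<close>

definition kinetic_density ::
  "real \<Rightarrow> (real \<Rightarrow> 'a::euclidean_space \<Rightarrow> 'a \<Rightarrow> real) \<Rightarrow> real \<Rightarrow> 'a \<Rightarrow> 'a \<Rightarrow> real" where
  "kinetic_density D f t x \<xi> = (2 * D * ln (f t x \<xi>) + (norm \<xi>)\<^sup>2) * f t x \<xi>"

definition interaction_density ::
  "real \<Rightarrow> ('a::euclidean_space \<Rightarrow> real) \<Rightarrow> ('a \<Rightarrow> real) \<Rightarrow> (real \<Rightarrow> 'a \<Rightarrow> 'a \<Rightarrow> real) \<Rightarrow>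
     real \<Rightarrow> 'a \<Rightarrow> 'a \<Rightarrow> real" where
  "interaction_density \<alpha> \<omega>S \<omega>L f t x y =
     rescale \<alpha> \<omega>L y * (conv (rho f t) \<omega>S x - conv (rho f t) \<omega>S (x - y))\<^sup>2"

definition free_energy ::
  "real \<Rightarrow> real \<Rightarrow> ('a::euclidean_space \<Rightarrow> real) \<Rightarrow> ('a \<Rightarrow> real) \<Rightarrow>
     (real \<Rightarrow> 'a \<Rightarrow> 'a \<Rightarrow> real) \<Rightarrow> real \<Rightarrow> real" where
  "free_energy D \<alpha> \<omega>S \<omega>L f t =
     (LINT (x, \<xi>)|lborel. kinetic_density D f t x \<xi>)
     + 1 / (2 * \<alpha>\<^sup>2) * (LINT (x, y)|lborel. interaction_density \<alpha> \<omega>S \<omega>L f t x y)"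

text \<open>For a nonnegative \<open>C\<^sup>1\<close> solution, \<open>f = 0\<close> at a point forces \<open>\<rho> = 0\<close> there (the left-hand side
  of the equation vanishes at a minimum), and \<open>\<rho> = 0\<close> forces \<open>f = 0\<close> by continuity, so the logarithms at \<open>0\<close> are only ever
  multiplied by \<open>0\<close>.\<close>

definition dissipation ::
  "real \<Rightarrow> real \<Rightarrow> (real \<Rightarrow> 'a::euclidean_space \<Rightarrow> 'a \<Rightarrow> real) \<Rightarrow> real \<Rightarrow> 'a \<Rightarrow> 'a \<Rightarrow> real" where
  "dissipation D \<epsilon> f t x \<xi> =
     1 / \<epsilon>\<^sup>2 * (f t x \<xi> - rho f t x * maxwellian D \<xi>)
       * (ln (f t x \<xi>) - ln (rho f t x * maxwellian D \<xi>))"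

end

theory Submission
  imports Defs "HOL-Probability.Distributions"
begin

text \<open>
  Multiply the kinetic equation by \<open>\<mu> = 2 D (ln f + 1) + |\<xi>|\<^sup>2 + 2 \<Phi>\<close>, the first variation of the free
  energy. Since the force is \<open>- \<nabla>\<Phi>\<close>, the Hamiltonian \<open>|\<xi>|\<^sup>2 / 2 + \<Phi>\<close> is annihilated by the
  transport operator, so the transport part of \<open>\<mu> \<partial>\<^sub>t f\<close> is the transport operator applied to
  \<open>2 D f ln f + (|\<xi>|\<^sup>2 + 2 \<Phi>) f\<close> and integrates to zero. On the collision side, \<open>\<mu>\<close> differs from
  \<open>2 D (ln f - ln (\<rho> M))\<close> by a function of \<open>x\<close> alone, which is orthogonal to \<open>\<rho> M - f\<close>.

  No lower bound on \<open>f\<close> is available for controlling \<open>ln f\<close>. Instead, a nonnegative function with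
  bounded second derivatives satisfies \<open>|\<partial> f| \<le> K sqrt f\<close>. Hence \<open>\<partial> f ln f\<close> loses only one power of
  the weight compared with \<open>\<partial> f\<close>, and \<open>f ln f\<close> is differentiable also at the zeros of \<open>f\<close>. The
  equation then turns the bounds for \<open>\<partial> f ln f\<close> into the integrability of \<open>\<rho> M ln f\<close>.
\<close>

section \<open>Lebesgue integrals on Euclidean spaces\<close>

text \<open>The decay exponent is a budget that is spent completely. \<open>f\<close> and its first
  derivatives start at 2d + 4; the factor |\<xi>|^2 of the multiplier costs two powers (the
  logarithm would cost only one), and the velocity in front of the x-gradient a third. This leaves
  2d + 1, the smallest integer exponent that is integrable over R^(2d). Integration by parts takes
  the form of translation invariance: the integral of \<open>G (x + s b)\<close> is constant in
  \<open>s\<close>, and differentiating it under the integral asks of f ln f only one directional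
  derivative and a dominating bound. Both kernels being even, the interaction energy is a symmetric
  quadratic form, the integral of \<Phi> \<rho>. Its time derivative is twice the integral of \<Phi>
  against the rate of \<rho>, hence the coefficient 2 of \<Phi> in the multiplier. The bounds are
  uniform only locally in time, so each time is treated in a small open window \<open>S\<close>
  around it.\<close>

lemma lborel_integral_affine:
  fixes f :: "'a::euclidean_space \<Rightarrow> real"
  assumes [measurable]: "f \<in> borel_measurable borel" and c: "c \<noteq> 0"
  shows "integrable lborel (\<lambda>x. f (t + c *\<^sub>R x)) \<longleftrightarrow> integrable lborel f"
    and "(LINT x|lborel. f x) = \<bar>c\<bar> ^ DIM('a) * (LINT x|lborel. f (t + c *\<^sub>R x))"
proof -
  let ?N = "density (distr lborel borel (\<lambda>x::'a. t + c *\<^sub>R x)) (\<lambda>_. ennreal (\<bar>c\<bar> ^ DIM('a)))"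
  have N: "lborel = ?N" by (rule lborel_affine[OF c])
  have "integrable ?N f \<longleftrightarrow> integrable lborel (\<lambda>x. f (t + c *\<^sub>R x))"
    using c by (simp add: integrable_density integrable_distr_eq)
  then show "integrable lborel (\<lambda>x. f (t + c *\<^sub>R x)) \<longleftrightarrow> integrable lborel f"
    using N by metis
  have "integral\<^sup>L ?N f = \<bar>c\<bar> ^ DIM('a) * (LINT x|lborel. f (t + c *\<^sub>R x))"
    using c by (simp add: integral_density integral_distr)
  then show "(LINT x|lborel. f x) = \<bar>c\<bar> ^ DIM('a) * (LINT x|lborel. f (t + c *\<^sub>R x))"
    using N by metis
qed

lemma lborel_integral_shift:
  fixes f :: "'a::euclidean_space \<Rightarrow> real"
  assumes "f \<in> borel_measurable borel"
  shows "integrable lborel (\<lambda>x. f (x + c)) \<longleftrightarrow> integrable lborel f"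
    and "(LINT x|lborel. f (x + c)) = (LINT x|lborel. f x)"
  using lborel_integral_affine[OF assms, of 1 c] by (simp_all add: add.commute)

lemma lborel_integral_reflect:
  fixes f :: "'a::euclidean_space \<Rightarrow> real"
  assumes "f \<in> borel_measurable borel"
  shows "integrable lborel (\<lambda>x. f (c - x)) \<longleftrightarrow> integrable lborel f"
    and "(LINT x|lborel. f (c - x)) = (LINT x|lborel. f x)"
  using lborel_integral_affine[OF assms, of "-1" c] by simp_all

text \<open>Dyadic shells: on the shell of index \<open>n\<close> the integrand is at most 2^(-kn),
  the enclosing ball of radius 2^(n+1) has volume 2^((n+1)d) times that of the unit ball, and k
  \<ge> d + 1 leaves a geometric series of ratio 1/2.\<close>

lemma integrable_inverse_power_one_plus_norm:
  assumes "DIM('a) < k"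
  shows "integrable lborel (\<lambda>x::'a::euclidean_space. 1 / (1 + norm x) ^ k)"
proof (rule integrableI_bounded)
  let ?d = "DIM('a)"
  let ?V = "measure lborel (ball (0::'a) 1)"
  let ?u = "\<lambda>n x. (1 / 2 ^ (k * n)) * indicator (ball (0::'a) (2 ^ Suc n)) x :: real"
  have le: "ennreal (norm (1 / (1 + norm x) ^ k)) \<le> (\<Sum>n. ennreal (?u n x))" for x :: 'a
  proof -
    obtain m where "norm x < 2 ^ m" using real_arch_pow[of 2 "norm x"] by auto
    \<comment> \<open>\<open>n\<close> is the index of the dyadic shell of \<open>x\<close>. For n =
      0 the bound 2^n \<le> 1 + |x| comes from the summand 1, otherwise from the minimality of
      \<open>n\<close>.\<close>
    define n where "n = (LEAST m. norm x < 2 ^ Suc m)"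
    have ex: "norm x < 2 ^ Suc m" 
      by (rule order.strict_trans2[OF \<open>norm x < 2 ^ m\<close>]) simp
    have n1: "norm x < 2 ^ Suc n" unfolding n_def by (rule LeastI) (rule ex)
    have n2: "2 ^ n \<le> 1 + norm x"
    proof (cases n)
      case (Suc j)
      have "\<not> norm x < 2 ^ Suc j"
        using not_less_Least[of j "\<lambda>m. norm x < 2 ^ Suc m"] Suc n_def by simp
      then show ?thesis using Suc by simp
    qed simp
    have "1 / (1 + norm x) ^ k \<le> 1 / (2 ^ n) ^ k"
      by (rule divide_left_mono) (use n2 in \<open>auto intro!: power_mono mult_pos_pos zero_less_power add_pos_nonneg\<close>)
    also have "\<dots> = ?u n x" using n1 by (simp add: power_mult[symmetric] mult.commute)
    finally have "ennreal (norm (1 / (1 + norm x) ^ k)) \<le> ennreal (?u n x)"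
      by (intro ennreal_leI) simp
    also have "\<dots> = (\<Sum>i\<in>{n}. ennreal (?u i x))" by simp
    also have "\<dots> \<le> (\<Sum>n. ennreal (?u n x))" by (intro sum_le_suminf) auto
    finally show ?thesis .
  qed
  have I: "(\<integral>\<^sup>+x. ennreal (?u n x) \<partial>lborel) \<le> ennreal (2 ^ ?d * ?V * (1/2) ^ n)" for n
  proof -
    have "(\<integral>\<^sup>+x. ennreal (?u n x) \<partial>lborel) = ennreal (1 / 2 ^ (k * n)) * emeasure lborel (ball (0::'a) (2 ^ Suc n))"
      by (subst ennreal_mult) (auto simp: ennreal_indicator nn_integral_cmult_indicator simp del: power_Suc)
    also have "emeasure lborel (ball (0::'a) (2 ^ Suc n)) = ennreal (measure lborel (ball (0::'a) (2 ^ Suc n)))"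
      by (metis emeasure_eq_ennreal_measure emeasure_lborel_ball_finite infinity_ennreal_def less_irrefl)
    also have "measure lborel (ball (0::'a) (2 ^ Suc n)) = (2 ^ Suc n) ^ ?d * ?V"
      by (rule content_ball_conv_unit_ball) simp
    also have "ennreal (1 / 2 ^ (k * n)) * ennreal ((2 ^ Suc n) ^ ?d * ?V)
        = ennreal (1 / 2 ^ (k * n) * ((2 ^ Suc n) ^ ?d * ?V))"
      by (rule ennreal_mult[symmetric]) auto
    also have "\<dots> \<le> ennreal (2 ^ ?d * ?V * (1/2) ^ n)"
    proof (rule ennreal_leI)
      have "(2::real) ^ (n * ?d) * 2 ^ n \<le> 2 ^ (k * n)"
        using assms unfolding power_add[symmetric]
        by (intro power_increasing) (auto simp: algebra_simps simp flip: mult_Suc_right)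
      then have "(2::real) ^ (n * ?d) / 2 ^ (k * n) \<le> (1/2)^n"
        by (simp add: field_simps power_one_over)
      then have "2 ^ ?d * ?V * ((2::real) ^ (n * ?d) / 2 ^ (k * n)) \<le> 2 ^ ?d * ?V * (1/2)^n"
        by (intro mult_left_mono) auto
      then show "1 / 2 ^ (k * n) * ((2 ^ Suc n) ^ ?d * ?V) \<le> 2 ^ ?d * ?V * (1/2)^n"
        by (simp add: power_mult_distrib power_mult[symmetric] field_simps)
    qed
    finally show ?thesis .
  qed
  have "(\<integral>\<^sup>+x. ennreal (norm (1 / (1 + norm (x::'a)) ^ k)) \<partial>lborel) \<le> (\<integral>\<^sup>+x. (\<Sum>n. ennreal (?u n x)) \<partial>lborel)"
    by (intro nn_integral_mono le)
  also have "\<dots> = (\<Sum>n. \<integral>\<^sup>+x. ennreal (?u n x) \<partial>lborel)"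
    by (rule nn_integral_suminf) (auto simp del: power_Suc intro!: borel_measurable_divide borel_measurable_indicator)
  also have "\<dots> \<le> (\<Sum>n. ennreal (2 ^ ?d * ?V * (1/2) ^ n))"
    by (intro suminf_le I) auto
  also have "\<dots> = ennreal (\<Sum>n. 2 ^ ?d * ?V * (1/2) ^ n)"
    by (intro suminf_ennreal2 summable_mult summable_geometric) auto
  finally show "(\<integral>\<^sup>+x. ennreal (norm (1 / (1 + norm (x::'a)) ^ k)) \<partial>lborel) < \<infinity>"
    by (simp add: order.strict_trans1)
qed (use assms in measurable)

text \<open>Dominated convergence for the difference quotients. Differentiability and the Lipschitz
  bound refer to the base point \<open>p0\<close> only, and measurability of the derivative is a
  conclusion of the argument. A general normed parameter space lets the lemma serve time,
  translations and the space variable of convolutions alike.\<close>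

lemma has_derivative_lebesgue_integral:
  fixes g :: "'b::real_normed_vector \<Rightarrow> 'c \<Rightarrow> real"
  assumes U: "open U" "p0 \<in> U"
    and int: "\<And>p. p \<in> U \<Longrightarrow> integrable M (g p)"
    and der: "\<And>y. y \<in> space M \<Longrightarrow> ((\<lambda>p. g p y) has_derivative G y) (at p0)"
    and lip: "\<And>p y. p \<in> U \<Longrightarrow> y \<in> space M \<Longrightarrow> \<bar>g p y - g p0 y\<bar> \<le> W y * norm (p - p0)"
    and W: "integrable M W"
  shows "((\<lambda>p. LINT y|M. g p y) has_derivative (\<lambda>h. LINT y|M. G y h)) (at p0)"
proof -
  obtain r where r: "r > 0" "ball p0 r \<subseteq> U" using U openE by blast
  have quot: "(\<lambda>n. (g (p0 + s n *\<^sub>R h) y - g p0 y) / s n) \<longlonglongrightarrow> G y h"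
    if s: "s \<longlonglongrightarrow> 0" "\<And>n. s n > (0::real)" and y: "y \<in> space M" for s h y
  proof -
    have "((\<lambda>t. g (p0 + t *\<^sub>R h) y) has_derivative (\<lambda>t. G y (t *\<^sub>R h))) (at 0)"
      by (rule has_derivative_compose[of "\<lambda>t. p0 + t *\<^sub>R h" "\<lambda>t. t *\<^sub>R h" 0 UNIV "\<lambda>p. g p y" "G y", simplified])
        (auto intro!: derivative_eq_intros der y)
    moreover have "(\<lambda>t. G y (t *\<^sub>R h)) = (*) (G y h)"
      using linear_scale[OF has_derivative_linear[OF der[OF y]]] by (auto simp: fun_eq_iff)
    ultimately have "((\<lambda>t. g (p0 + t *\<^sub>R h) y) has_field_derivative G y h) (at 0)"
      by (simp add: has_field_derivative_def)
    then have "((\<lambda>t. (g (p0 + t *\<^sub>R h) y - g p0 y) / t) \<longlongrightarrow> G y h) (at 0)"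
      by (simp add: DERIV_def)
    then have "((\<lambda>t. (g (p0 + t *\<^sub>R h) y - g p0 y) / t) \<circ> s) \<longlonglongrightarrow> G y h"
      unfolding tendsto_at_iff_sequentially
      by (elim allE[where x=s] impE) (use s in \<open>auto simp: less_imp_neq[symmetric]\<close>)
    then show ?thesis by (simp add: o_def)
  qed
  \<comment> \<open>Step sizes that shrink to 0 and keep \<open>p0 + s0 h n *\<^sub>R h\<close>
    inside the ball; \<open>norm h + 1\<close> avoids a division by zero for h = 0. They exhibit
    \<open>G y h\<close> as a sequential limit of measurable quotients.\<close>
  define s0 where "s0 h n = r / ((real n + 1) * (norm h + 1))" for h :: 'b and n
  have s0: "s0 h \<longlonglongrightarrow> 0" "s0 h n > 0" "p0 + s0 h n *\<^sub>R h \<in> U" for h n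
  proof -
    show "s0 h \<longlonglongrightarrow> 0" unfolding s0_def
      using tendsto_mult_left[OF LIMSEQ_inverse_real_of_nat, of "r / (norm h + 1)"]
      by (simp add: field_simps)
    show "s0 h n > 0" using r by (simp add: s0_def add_nonneg_pos)
    have "norm (s0 h n *\<^sub>R h) < r"
    proof -
      have "norm (s0 h n *\<^sub>R h) = r * (norm h / ((real n + 1) * (norm h + 1)))"
        using r by (simp add: s0_def)
      also have "\<dots> < r * 1"
      proof (intro mult_strict_left_mono r)
        have "norm h < (real n + 1) * (norm h + 1)" 
          by (simp add: algebra_simps add_pos_nonneg mult_nonneg_nonneg)
        then show "norm h / ((real n + 1) * (norm h + 1)) < 1"
          by (simp add: divide_less_eq add_nonneg_pos)
      qed
      finally show ?thesis by simp
    qed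
    then show "p0 + s0 h n *\<^sub>R h \<in> U" by (intro subsetD[OF r(2)]) (simp add: dist_norm)
  qed
  have meas[measurable]: "(\<lambda>y. G y h) \<in> borel_measurable M" for h
  proof (rule borel_measurable_LIMSEQ_real[where u="\<lambda>n y. (g (p0 + s0 h n *\<^sub>R h) y - g p0 y) / s0 h n"])
    fix n
    show "(\<lambda>y. (g (p0 + s0 h n *\<^sub>R h) y - g p0 y) / s0 h n) \<in> borel_measurable M"
      using int[OF s0(3)[of h n]] int[OF U(2)] by measurable
  qed (rule quot[OF s0(1,2)])
  have bd: "\<bar>G y h\<bar> \<le> W y * norm h" if "y \<in> space M" for y and h :: 'b
  proof (rule LIMSEQ_le_const2)
    show "(\<lambda>n. \<bar>(g (p0 + s0 h n *\<^sub>R h) y - g p0 y) / s0 h n\<bar>) \<longlonglongrightarrow> \<bar>G y h\<bar>"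
      by (intro tendsto_rabs quot s0 that)
    show "\<exists>N. \<forall>n\<ge>N. \<bar>(g (p0 + s0 h n *\<^sub>R h) y - g p0 y) / s0 h n\<bar> \<le> W y * norm h"
    proof (intro exI allI impI)
      fix n
      have "\<bar>g (p0 + s0 h n *\<^sub>R h) y - g p0 y\<bar> \<le> W y * norm h * s0 h n"
        using lip[OF s0(3)[of h n] that] s0(2)[of h n] by (simp add: mult_ac)
      then show "\<bar>(g (p0 + s0 h n *\<^sub>R h) y - g p0 y) / s0 h n\<bar> \<le> W y * norm h"
        using s0(2)[of h n] by (simp add: abs_divide divide_le_eq)
    qed
  qed
  have intG: "integrable M (\<lambda>y. G y h)" for h
    by (rule Bochner_Integration.integrable_bound[OF integrable_mult_left[OF W, of "norm h"]])
      (auto intro!: AE_I2 order_trans[OF bd])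
  have lin: "G y (a *\<^sub>R h + h') = a * G y h + G y h'" if "y \<in> space M" for y a h h'
    using linear_scale[OF has_derivative_linear[OF der[OF that]]]
      linear_add[OF has_derivative_linear[OF der[OF that]]] by simp
  have bl: "bounded_linear (\<lambda>h. LINT y|M. G y h)"
  proof (rule bounded_linear_intro)
    show "(LINT y|M. G y (h + h')) = (LINT y|M. G y h) + (LINT y|M. G y h')" for h h'
      using lin[of _ 1] intG by (simp flip: Bochner_Integration.integral_add cong: Bochner_Integration.integral_cong)
    show "(LINT y|M. G y (a *\<^sub>R h)) = a *\<^sub>R (LINT y|M. G y h)" for a h
      using linear_scale[OF has_derivative_linear[OF der]] by (simp cong: Bochner_Integration.integral_cong)
    show "norm (LINT y|M. G y h) \<le> norm h * (LINT y|M. W y)" for h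
    proof -
      have "norm (LINT y|M. G y h) \<le> (LINT y|M. W y * norm h)"
        by (rule order_trans[OF integral_norm_bound integral_mono]) (use intG W bd in auto)
      then show ?thesis by (simp add: mult.commute)
    qed
  qed
  show "((\<lambda>p. LINT y|M. g p y) has_derivative (\<lambda>h. LINT y|M. G y h)) (at p0)"
    unfolding has_derivative_at_within
  proof (intro conjI bl)
    \<comment> \<open>The normalised remainder is dominated by \<open>2 * W\<close>: one
      \<open>W\<close> for the increment of \<open>g\<close>, one for the derivative. Dominated
      convergence speaks of sequences, so the limit at \<open>p0\<close> is tested along arbitrary
      ones, shifted by \<open>N\<close> so that they start inside \<open>U\<close>.\<close>
    let ?q = "\<lambda>p y. (g p y - g p0 y - G y (p - p0)) /\<^sub>R norm (p - p0)"
    have ev: "\<forall>\<^sub>F p in at p0. p \<in> U" unfolding eventually_at_topological using U by blast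
    have "((\<lambda>p. LINT y|M. ?q p y) \<longlongrightarrow> (LINT y|M. 0)) (at p0)"
      unfolding tendsto_at_iff_sequentially o_def
    proof (intro allI impI)
      fix X assume X: "\<forall>i. X i \<in> UNIV - {p0}" "X \<longlonglongrightarrow> p0"
      have "\<forall>\<^sub>F i in sequentially. X i \<in> U" using X(2) U topological_tendstoD by blast
      then obtain N where N: "\<And>i. i \<ge> N \<Longrightarrow> X i \<in> U" unfolding eventually_sequentially by blast
      have "(\<lambda>i. LINT y|M. ?q (X (i + N)) y) \<longlonglongrightarrow> (LINT y|M. 0)"
      proof (rule integral_dominated_convergence[where w="\<lambda>y. 2 * W y"])
        show "(\<lambda>y. ?q (X (i + N)) y) \<in> borel_measurable M" for i
          using int[OF N[of "i + N"]] int[OF U(2)] by measurable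
        show "integrable M (\<lambda>y. 2 * W y)" using W by simp
        show "AE y in M. (\<lambda>i. ?q (X (i + N)) y) \<longlonglongrightarrow> 0"
        proof (rule AE_I2)
          fix y assume y: "y \<in> space M"
          have "((\<lambda>p. ?q p y) \<longlongrightarrow> 0) (at p0)"
            using der[OF y] unfolding has_derivative_at_within by simp
          then have "((\<lambda>p. ?q p y) \<circ> (\<lambda>i. X i)) \<longlonglongrightarrow> 0"
            using X unfolding tendsto_at_iff_sequentially by blast
          then show "(\<lambda>i. ?q (X (i + N)) y) \<longlonglongrightarrow> 0"
            unfolding o_def by (rule LIMSEQ_ignore_initial_segment)
        qed
        show "AE y in M. norm (?q (X (i + N)) y) \<le> 2 * W y" for i
        proof (rule AE_I2)
          fix y assume y: "y \<in> space M"
          have p: "norm (X (i + N) - p0) > 0" using X by simp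
          have "\<bar>g (X (i+N)) y - g p0 y - G y (X (i+N) - p0)\<bar> \<le> 2 * W y * norm (X (i + N) - p0)"
            using lip[OF N[of "i + N"] y] bd[OF y, of "X (i+N) - p0"] by simp
          then show "norm (?q (X (i + N)) y) \<le> 2 * W y"
            using p by (simp add: field_simps)
        qed
      qed simp
      then have "(\<lambda>i. LINT y|M. ?q (X i) y) \<longlonglongrightarrow> (LINT y|M. 0)"
        by (rule LIMSEQ_offset)
      then show "(\<lambda>i. LINT y|M. ?q (X i) y) \<longlonglongrightarrow> (LINT y|M. 0)" .
    qed
    moreover have "\<forall>\<^sub>F p in at p0. (LINT y|M. ?q p y) =
        ((LINT y|M. g p y) - (LINT y|M. g p0 y) - (LINT y|M. G y (p - p0))) /\<^sub>R norm (p - p0)"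
      using ev by eventually_elim (use int U intG in simp)
    ultimately have "((\<lambda>p. ((LINT y|M. g p y) - (LINT y|M. g p0 y) - (LINT y|M. G y (p - p0))) /\<^sub>R norm (p - p0))
        \<longlongrightarrow> (LINT y|M. 0)) (at p0)"
      by (rule Lim_transform_eventually)
    then show "((\<lambda>p. ((LINT y|M. g p y) - (LINT y|M. g p0 y) - (LINT y|M. G y (p - p0))) /\<^sub>R norm (p - p0)) \<longlongrightarrow> 0) (at p0)"
      by simp
  qed
qed

text \<open>By translation invariance the integral of \<open>G (x + s b)\<close> is constant in
  \<open>s\<close>, and its derivative at 0, taken under the integral sign, is the integral of
  \<open>G'\<close>. This is how the transport terms are integrated by parts.\<close>

lemma integral_directional_derivative_eq_0:
  fixes G G' :: "'a::euclidean_space \<Rightarrow> real"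
  assumes der: "\<And>x. ((\<lambda>s. G (x + s *\<^sub>R b)) has_real_derivative G' x) (at 0)"
    and bd: "\<And>x. \<bar>G' x\<bar> \<le> C / (1 + norm x) ^ (DIM('a) + 1)"
    and int: "integrable lborel G"
    and b: "norm b = 1"
  shows "(LINT x|lborel. G' x) = 0"
proof -
  let ?k = "DIM('a) + 1"
  have [measurable]: "G \<in> borel_measurable borel" using int by measurable
  have C: "C \<ge> 0" using bd[of 0] by simp
  have der': "((\<lambda>s. G (x + s *\<^sub>R b)) has_real_derivative G' (x + s *\<^sub>R b)) (at s)" for x s
    using der[of "x + s *\<^sub>R b"] DERIV_shift[of "\<lambda>u. G (x + u *\<^sub>R b)" "G' (x + s *\<^sub>R b)" 0 s]
    by (simp add: scaleR_add_left add_ac)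
  have lip: "\<bar>G (x + s *\<^sub>R b) - G (x + 0 *\<^sub>R b)\<bar> \<le> (C * 2 ^ ?k * (1 / (1 + norm x) ^ ?k)) * norm (s - 0)"
    if s: "s \<in> ball 0 1" for s x
  proof -
    have "norm (G (x + s *\<^sub>R b) - G (x + 0 *\<^sub>R b)) \<le> (C * 2 ^ ?k * (1 / (1 + norm x) ^ ?k)) * norm (s - 0)"
    proof (rule field_differentiable_bound[of "ball 0 1" _ "\<lambda>s. G' (x + s *\<^sub>R b)"])
      fix u :: real assume u: "u \<in> ball 0 1"
      show "((\<lambda>s. G (x + s *\<^sub>R b)) has_field_derivative G' (x + u *\<^sub>R b)) (at u within ball 0 1)"
        using der' by (rule has_field_derivative_at_within)
      \<comment> \<open>A shift of length below 1 lowers 1 + |x| at most by a factor 2, which is the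
        origin of the factor 2^k in the dominating function.\<close>
      have "norm x \<le> norm (x + u *\<^sub>R b) + norm (u *\<^sub>R b)"
        using norm_triangle_ineq4[of "x + u *\<^sub>R b" "u *\<^sub>R b"] by simp
      moreover have "norm (u *\<^sub>R b) < 1" using u b by simp
      moreover have "0 \<le> norm (x + u *\<^sub>R b)" by simp
      ultimately have "1 + norm x \<le> 2 * (1 + norm (x + u *\<^sub>R b))" by (smt (verit))
      then have "(1 + norm x) ^ ?k \<le> (2 * (1 + norm (x + u *\<^sub>R b))) ^ ?k"
        by (intro power_mono) auto
      then have "(1 + norm x) ^ ?k \<le> 2 ^ ?k * (1 + norm (x + u *\<^sub>R b)) ^ ?k"
        by (simp only: power_mult_distrib)
      moreover have "0 < (1 + norm (x + u *\<^sub>R b)) ^ ?k" "0 < (1 + norm x) ^ ?k"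
        by (simp_all only: zero_less_power add_pos_nonneg zero_less_one norm_ge_zero)
      ultimately have "1 / (1 + norm (x + u *\<^sub>R b)) ^ ?k \<le> 2 ^ ?k * (1 / (1 + norm x) ^ ?k)"
        by (simp only: field_simps) (simp add: mult_ac)
      then have "C * (1 / (1 + norm (x + u *\<^sub>R b)) ^ ?k) \<le> C * (2 ^ ?k * (1 / (1 + norm x) ^ ?k))"
        using C by (rule mult_left_mono)
      with bd[of "x + u *\<^sub>R b"] show "norm (G' (x + u *\<^sub>R b)) \<le> C * 2 ^ ?k * (1 / (1 + norm x) ^ ?k)"
        by (simp add: mult.assoc)
    qed (use s in auto)
    then show ?thesis by simp
  qed
  have "((\<lambda>s. LINT x|lborel. G (x + s *\<^sub>R b)) has_derivative (\<lambda>h. LINT x|lborel. G' x * h)) (at 0)"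
  proof (rule has_derivative_lebesgue_integral)
    show "open (ball (0::real) 1)" "(0::real) \<in> ball 0 1" by auto
    show "integrable lborel (\<lambda>x. G (x + s *\<^sub>R b))" for s
      using int by (subst lborel_integral_shift) auto
    show "((\<lambda>p. G (y + p *\<^sub>R b)) has_derivative (*) (G' y)) (at 0)" for y
      using der unfolding has_field_derivative_def .
    show "integrable lborel (\<lambda>x::'a. C * 2 ^ ?k * (1 / (1 + norm x) ^ ?k))"
      by (intro integrable_mult_right integrable_inverse_power_one_plus_norm) auto
  qed (use lip in auto)
  moreover have "(\<lambda>s. LINT x|lborel. G (x + s *\<^sub>R b)) = (\<lambda>s. LINT x|lborel. G x)"
    by (auto simp: fun_eq_iff lborel_integral_shift)
  ultimately have "((\<lambda>s::real. LINT x|lborel. G x) has_derivative (\<lambda>h. LINT x|lborel. G' x * h)) (at 0)"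
    by simp
  from has_derivative_unique[OF this has_derivative_const]
  show ?thesis by (metis (no_types, lifting) Bochner_Integration.integral_cong mult.right_neutral)
qed

section \<open>The Maxwellian and logarithmic estimates\<close>

text \<open>Factorising into one-dimensional normal densities of variance \<open>D\<close> reduces
  the total mass to a product of known Gaussian integrals; \<open>normal_density\<close> takes the
  standard deviation, hence \<open>sqrt D\<close>.\<close>

lemma maxwellian_eq_prod:
  fixes x :: "'a::euclidean_space"
  assumes "0 < D"
  shows "maxwellian D x = (\<Prod>b\<in>Basis. normal_density 0 (sqrt D) (x \<bullet> b))"
proof -
  have "(2 * pi * D) powr (- (real DIM('a) / 2)) = (((2 * pi * D) powr (1/2)) powr real DIM('a)) powr (-1)"
    unfolding powr_powr by simp
  also have "(2 * pi * D) powr (1/2) = sqrt (2 * pi * D)" using assms by (subst powr_half_sqrt) auto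
  also have "sqrt (2 * pi * D) powr real DIM('a) = sqrt (2 * pi * D) ^ DIM('a)"
    using assms by (subst powr_realpow) auto
  also have "\<dots> powr (-1) = (1 / sqrt (2 * pi * D)) ^ DIM('a)"
    using assms by (subst powr_minus) (simp add: power_one_over inverse_eq_divide)
  finally have 1: "(2 * pi * D) powr (- (real DIM('a) / 2)) = (1 / sqrt (2 * pi * D)) ^ DIM('a)" .
  have "(norm x)\<^sup>2 = (\<Sum>b\<in>Basis. (x \<bullet> b)\<^sup>2)"
    unfolding power2_norm_eq_inner by (subst euclidean_inner) (simp add: power2_eq_square)
  then have "exp (- ((norm x)\<^sup>2 / (2 * D))) = (\<Prod>b\<in>Basis. exp (- (x \<bullet> b)\<^sup>2 / (2 * D)))"
    by (simp add: exp_sum[symmetric] sum_divide_distrib sum_negf)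
  then show ?thesis using assms 1
    unfolding maxwellian_def normal_density_def prod.distrib by simp
qed

lemma maxwellian_pos: "0 < D \<Longrightarrow> 0 < maxwellian D x"
  by (simp add: maxwellian_def)

lemma borel_measurable_maxwellian[measurable]: "maxwellian D \<in> borel_measurable borel"
  unfolding maxwellian_def by measurable

lemma
  assumes D: "0 < D"
  shows integrable_maxwellian: "integrable lborel (maxwellian D :: 'a::euclidean_space \<Rightarrow> real)"
    and integral_maxwellian: "(LINT x|lborel. maxwellian D (x :: 'a)) = 1"
proof -
  have "(\<integral>\<^sup>+x. ennreal (maxwellian D (x :: 'a)) \<partial>lborel)
      = (\<integral>\<^sup>+x. (\<Prod>b\<in>(Basis :: 'a set). ennreal (normal_density 0 (sqrt D) (x \<bullet> b))) \<partial>lborel)"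
    using D by (simp add: maxwellian_eq_prod prod_ennreal)
  also have "\<dots> = (\<Prod>b\<in>(Basis :: 'a set). \<integral>\<^sup>+x. ennreal (normal_density 0 (sqrt D) x) \<partial>lborel)"
    by (rule nn_integral_lborel_prod) auto
  also have "(\<integral>\<^sup>+x. ennreal (normal_density 0 (sqrt D) x) \<partial>lborel) = 1"
    using D by (simp add: nn_integral_eq_integral)
  finally have *: "(\<integral>\<^sup>+x. ennreal (maxwellian D (x :: 'a)) \<partial>lborel) = 1" by simp
  show "integrable lborel (maxwellian D :: 'a \<Rightarrow> real)"
    using * by (intro integrableI_nonneg AE_I2 less_imp_le maxwellian_pos[OF D]) auto
  show "(LINT x|lborel. maxwellian D (x :: 'a)) = 1"
    by (subst integral_eq_nn_integral) (auto simp: * maxwellian_pos[OF D] less_imp_le)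
qed

text \<open>With y = z^4 the logarithm is 4 ln z, and -ln z \<le> 1/z consumes just one of the two
  factors z in \<open>sqrt y\<close>. The fourth root that remains still tends to 0 with
  \<open>y\<close>, which is what the decay and differentiability lemmas exploit.\<close>

lemma sqrt_mult_abs_ln_le:
  fixes y :: real
  assumes "0 \<le> y" "y \<le> 1"
  shows "sqrt y * \<bar>ln y\<bar> \<le> 4 * sqrt (sqrt y)"
proof (cases "y = 0")
  case False
  define z where "z = sqrt (sqrt y)"
  have z: "z > 0" "z \<le> 1" "sqrt y = z\<^sup>2" "y = z ^ 4"
  proof -
    show "z > 0" "z \<le> 1" "sqrt y = z\<^sup>2" using False assms by (auto simp: z_def)
    then have "z ^ 4 = (sqrt y)\<^sup>2" by (simp only: power_mult[symmetric]) simp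
    then show "y = z ^ 4" using assms by simp
  qed
  have "ln y = 4 * ln z" using z by (simp add: ln_realpow)
  moreover have "ln z \<le> 0" using z by simp
  moreover have "- ln z \<le> 1 / z"
    using ln_le_minus_one[of "1 / z"] z by (simp add: ln_div)
  ultimately have "\<bar>ln y\<bar> \<le> 4 / z" by simp
  then have "z\<^sup>2 * \<bar>ln y\<bar> \<le> z\<^sup>2 * (4 / z)" by (intro mult_left_mono) auto
  then show ?thesis using z by (simp add: z_def[symmetric] power2_eq_square)
qed simp

text \<open>Where \<open>y \<ge> w ^ (-4 (N - 1))\<close> the logarithm is \<open>O(w)\<close>; below this threshold the
  bound \<open>p = O(sqrt y)\<close> already gives the decay.\<close>

lemma abs_mult_ln_decay:
  fixes p y w C C0 K :: real
  assumes w: "1 \<le> w" and y: "0 \<le> y" "y \<le> C0" and C: "0 \<le> C" and K: "0 \<le> K" and N: "1 \<le> N"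
    and p: "\<bar>p\<bar> \<le> C / w ^ N" "\<bar>p\<bar> \<le> K * sqrt y"
  shows "\<bar>p * ln y\<bar> \<le> (C * C0 + 4 * K + 4 * real (N - 1) * C) / w ^ (N - 1)"
proof -
  let ?W = "w ^ (N - 1)"
  have W: "?W \<ge> 1" "w ^ N = w * ?W" using w N one_le_power[of w "N - 1"] by (simp_all flip: power_Suc)
  then have W0: "?W > 0" by linarith
  have nn: "0 \<le> C * C0" "0 \<le> 4 * K" "0 \<le> 4 * real (N - 1) * C"
    using C K y by (simp_all add: mult_nonneg_nonneg)
  have mon: "a / ?W \<le> (C * C0 + 4 * K + 4 * real (N - 1) * C) / ?W"
    if "a \<le> C * C0 \<or> a \<le> 4 * K \<or> a \<le> 4 * real (N - 1) * C" for a
  proof (rule divide_right_mono)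
    show "a \<le> C * C0 + 4 * K + 4 * real (N - 1) * C" using that nn by linarith
  qed (use W in simp)
  have pC: "\<bar>p\<bar> \<le> C / (w * ?W)" using p(1) W by simp
  show ?thesis
  proof (cases "y = 0")
    case True then show ?thesis using mon[of 0] nn by simp
  next
    case False
    \<comment> \<open>Above 1 the logarithm is bounded by \<open>C0\<close>. The exponent 4 of the
      threshold undoes the fourth root left by \<open>sqrt_mult_abs_ln_le\<close>: below it,
      \<open>sqrt (sqrt y)\<close> is at most \<open>1 / w ^ (N - 1)\<close>. The constant in the
      claim has one summand for each case.\<close>
    consider "1 < y" | "y \<le> 1" "y < 1 / ?W ^ 4" | "y \<le> 1" "1 / ?W ^ 4 \<le> y" by linarith
    then show ?thesis
    proof cases
      case 1
      have "\<bar>ln y\<bar> \<le> C0" using ln_le_minus_one[of y] 1 y by simp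
      moreover have "\<bar>p\<bar> \<le> C / ?W"
      proof -
        have "C / (w * ?W) \<le> C / (1 * ?W)" using C w W by (intro divide_left_mono mult_right_mono mult_pos_pos) auto
        then show ?thesis using pC by simp
      qed
      ultimately have "\<bar>p\<bar> * \<bar>ln y\<bar> \<le> C / ?W * C0" using C W by (intro mult_mono) auto
      then show ?thesis using mon[of "C * C0"] by (simp add: abs_mult)
    next
      case 2
      have "\<bar>p * ln y\<bar> \<le> K * sqrt y * \<bar>ln y\<bar>" unfolding abs_mult using p by (intro mult_right_mono) auto
      also have "\<dots> \<le> K * (4 * sqrt (sqrt y))"
        using sqrt_mult_abs_ln_le[OF y(1) 2(1)] K by (simp add: mult.assoc mult_left_mono)
      also have "sqrt (sqrt y) \<le> 1 / ?W"
      proof -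
        have "sqrt (sqrt y) \<le> sqrt (sqrt (1 / ?W ^ 4))" using 2 by simp
        also have "1 / ?W ^ 4 = ((1 / ?W)\<^sup>2)\<^sup>2" by (simp add: power_one_over)
        also have "sqrt (sqrt \<dots>) = 1 / ?W" using W by (simp only: real_sqrt_abs) simp
        finally show ?thesis .
      qed
      finally have "\<bar>p * ln y\<bar> \<le> (4 * K) / ?W" using K by (simp add: mult_left_mono mult.commute)
      then show ?thesis using mon[of "4 * K"] by simp
    next
      case 3
      have "ln (1 / ?W ^ 4) \<le> ln y"
        by (rule ln_mono) (use 3 W0 w y in \<open>simp_all add: zero_less_divide_iff\<close>)
      moreover have "ln (1 / ?W ^ 4) = - (4 * real (N - 1) * ln w)"
      proof -
        have "ln (1 / ?W ^ 4) = - ln (?W ^ 4)"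
          using w by (auto simp: ln_div)
        also have "\<dots> = - (real 4 * ln ?W)" using W0 by (subst ln_realpow) auto
        also have "ln ?W = real (N - 1) * ln w" using w by (subst ln_realpow) auto
        finally show ?thesis by simp
      qed
      moreover have "ln w \<le> w" using ln_le_minus_one[of w] w by simp
      moreover have "ln y \<le> 0" using 3 False y by simp
      moreover have "4 * real (N - 1) * ln w \<le> 4 * real (N - 1) * w"
        using \<open>ln w \<le> w\<close> by (intro mult_left_mono) auto
      ultimately have "\<bar>ln y\<bar> \<le> 4 * real (N - 1) * w" by linarith
      then have "\<bar>p\<bar> * \<bar>ln y\<bar> \<le> C / (w * ?W) * (4 * real (N - 1) * w)"
        using pC by (intro mult_mono) auto
      also have "\<dots> = (4 * real (N - 1) * C) / ?W" using w by simp
      finally show ?thesis using mon[of "4 * real (N - 1) * C"] by (simp add: abs_mult)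
    qed
  qed
qed

section \<open>Taylor estimates for nonnegative functions of one variable\<close>

lemma taylor2_bound:
  fixes h h' h'' :: "real \<Rightarrow> real"
  assumes h: "\<And>s. \<bar>s\<bar> \<le> r \<Longrightarrow> (h has_real_derivative h' s) (at s)"
    and h': "\<And>s. \<bar>s\<bar> \<le> r \<Longrightarrow> (h' has_real_derivative h'' s) (at s)"
    and C: "\<And>s. \<bar>s\<bar> \<le> r \<Longrightarrow> \<bar>h'' s\<bar> \<le> C"
    and s: "\<bar>s\<bar> \<le> r"
  shows "\<bar>h s - h 0 - h' 0 * s\<bar> \<le> C * s\<^sup>2"
proof -
  let ?S = "cball 0 \<bar>s\<bar> :: real set"
  \<comment> \<open>Two mean value estimates in a row; the second uses the worst derivative on the
    whole interval, which gives the constant C instead of C / 2.\<close>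
  have "\<bar>h' u - h' 0\<bar> \<le> C * \<bar>s\<bar>" if "u \<in> ?S" for u
  proof -
    have "norm (h' u - h' 0) \<le> C * norm (u - 0)"
    proof (rule field_differentiable_bound[of ?S h' h''])
      fix x assume "x \<in> ?S"
      then have "\<bar>x\<bar> \<le> r" using s by simp
      then show "(h' has_field_derivative h'' x) (at x within ?S)" "norm (h'' x) \<le> C"
        using has_field_derivative_at_within[OF h'] C by auto
    qed (use that in auto)
    also have "\<dots> \<le> C * \<bar>s\<bar>"
      using that order_trans[OF abs_ge_zero C[of s]] s by (intro mult_left_mono) auto
    finally show ?thesis by simp
  qed note bd = this
  have "norm ((h s - h' 0 * s) - (h 0 - h' 0 * 0)) \<le> (C * \<bar>s\<bar>) * norm (s - 0)"
  proof (rule field_differentiable_bound[of ?S "\<lambda>s. h s - h' 0 * s" "\<lambda>u. h' u - h' 0"])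
    fix x assume x: "x \<in> ?S"
    then have "\<bar>x\<bar> \<le> r" using s by simp
    from DERIV_diff[OF h[OF this] DERIV_cmult_Id[of "h' 0"]]
    show "((\<lambda>s. h s - h' 0 * s) has_field_derivative h' x - h' 0) (at x within ?S)"
      by (rule has_field_derivative_at_within)
    show "norm (h' x - h' 0) \<le> C * \<bar>s\<bar>" using bd[OF x] by simp
  qed auto
  then show ?thesis by (simp add: power2_eq_square mult.assoc)
qed

text \<open>Nonnegativity of the second-order Taylor polynomial forces its linear coefficient to be
  controlled by the square root of its constant one.\<close>

lemma abs_deriv_le_sqrt:
  fixes h h' h'' :: "real \<Rightarrow> real"
  assumes r: "0 < r"
    and h: "\<And>s. \<bar>s\<bar> \<le> r \<Longrightarrow> (h has_real_derivative h' s) (at s)"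
    and h': "\<And>s. \<bar>s\<bar> \<le> r \<Longrightarrow> (h' has_real_derivative h'' s) (at s)"
    and C: "\<And>s. \<bar>s\<bar> \<le> r \<Longrightarrow> \<bar>h'' s\<bar> \<le> C"
    and nn: "\<And>s. \<bar>s\<bar> \<le> r \<Longrightarrow> 0 \<le> h s"
    and C0: "h 0 \<le> C0"
  shows "\<bar>h' 0\<bar> \<le> (sqrt (C0 + 1) / r + C * r / sqrt (C0 + 1)) * sqrt (h 0)"
proof -
  have h0: "0 \<le> h 0" using nn[of 0] r by simp
  have key: "\<bar>h' 0\<bar> * \<delta> \<le> h 0 + C * \<delta>\<^sup>2" if "0 \<le> \<delta>" "\<delta> \<le> r" for \<delta>
  proof -
    \<comment> \<open>A step of length \<delta> in the direction in which the linear part decreases.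
      Since \<open>h\<close> is still nonnegative there, the descent |h' 0| \<delta> is at most
      \<open>h 0\<close> plus the quadratic error.\<close>
    let ?s = "- sgn (h' 0) * \<delta>"
    have s: "\<bar>?s\<bar> \<le> r" using that r by (auto simp: abs_mult sgn_real_def)
    have s2: "C * ?s\<^sup>2 \<le> C * \<delta>\<^sup>2"
      using C[of 0] r by (intro mult_left_mono) (auto simp: sgn_real_def)
    have "h' 0 * ?s = - (\<bar>h' 0\<bar> * \<delta>)" by (simp add: sgn_real_def)
    moreover have "\<bar>h ?s - h 0 - h' 0 * ?s\<bar> \<le> C * ?s\<^sup>2" by (rule taylor2_bound[OF h h' C s])
    ultimately show ?thesis using nn[OF s] s2 by linarith
  qed
  show ?thesis
  proof (cases "h 0 = 0")
    case True
    have Cnn: "0 \<le> C" using C[of 0] r by simp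
    have "h' 0 = 0"
    proof (rule ccontr)
      assume ne: "h' 0 \<noteq> 0"
      \<comment> \<open>With \<open>h 0 = 0\<close> the estimate \<open>key\<close> reads |h' 0|
        \<le> C \<delta> for all small \<delta>; this choice pushes the right-hand side down to |h'
        0| / 2. The summand 1 guards against C = 0.\<close>
      define \<delta> where "\<delta> = min r (\<bar>h' 0\<bar> / (2 * (C + 1)))"
      have \<delta>: "0 < \<delta>" "\<delta> \<le> r" using ne r Cnn by (auto simp: \<delta>_def)
      have "\<bar>h' 0\<bar> \<le> C * \<delta>" using key[of \<delta>] \<delta> True by (simp add: power2_eq_square)
      also have "\<dots> \<le> (C + 1) * (\<bar>h' 0\<bar> / (2 * (C + 1)))"
        using Cnn \<delta> by (intro mult_mono) (auto simp: \<delta>_def)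
      also have "\<dots> = \<bar>h' 0\<bar> / 2" using Cnn by (simp add: field_simps)
      finally show False using ne by simp
    qed
    then show ?thesis using True by simp
  next
    case False
    let ?a = "sqrt (C0 + 1)" and ?q = "sqrt (h 0)"
    have a: "0 < ?a" and q: "0 < ?q" "?q \<le> ?a" using False h0 C0 by auto
    \<comment> \<open>Balancing h 0 / \<delta> against C \<delta> asks for \<delta> proportional to
      \<open>sqrt (h 0)\<close>; since that root is at most \<open>sqrt (C0 + 1)\<close>, the chosen
      factor keeps \<delta> within \<open>r\<close>.\<close>
    define \<delta> where "\<delta> = r * ?q / ?a"
    have \<delta>: "0 < \<delta>" "\<delta> \<le> r" using a q r by (auto simp: \<delta>_def divide_le_eq)
    have "\<bar>h' 0\<bar> \<le> h 0 / \<delta> + C * \<delta>"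
      using key[of \<delta>] \<delta> by (simp add: field_simps power2_eq_square)
    also have "h 0 / \<delta> = ?q * (?a / r)"
      using q h0 a r by (simp add: \<delta>_def field_simps)
    finally show ?thesis by (simp add: \<delta>_def field_simps)
  qed
qed

text \<open>At a zero \<open>h\<close> vanishes to second order, so \<open>h ln h\<close> is still differentiable there, with
  derivative \<open>0\<close>; the formula covers this case since \<open>ln 0 = 0\<close> and \<open>h' 0 = 0\<close>.\<close>

lemma has_real_derivative_mult_ln:
  fixes h h' h'' :: "real \<Rightarrow> real"
  assumes r: "0 < r"
    and h: "\<And>s. \<bar>s\<bar> \<le> r \<Longrightarrow> (h has_real_derivative h' s) (at s)"
    and h': "\<And>s. \<bar>s\<bar> \<le> r \<Longrightarrow> (h' has_real_derivative h'' s) (at s)"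
    and C: "\<And>s. \<bar>s\<bar> \<le> r \<Longrightarrow> \<bar>h'' s\<bar> \<le> C"
    and nn: "\<And>s. \<bar>s\<bar> \<le> r \<Longrightarrow> 0 \<le> h s"
  shows "((\<lambda>s. h s * ln (h s)) has_real_derivative (ln (h 0) + 1) * h' 0) (at 0)"
proof (cases "h 0 = 0")
  case False
  then have "h 0 > 0" using nn[of 0] r by simp
  then show ?thesis using h[of 0] r
    by (auto intro!: derivative_eq_intros simp: field_simps)
next
  case True
  have h'0: "h' 0 = 0" using abs_deriv_le_sqrt[OF r h h' C nn, of "h 0"] True by simp
  have cont: "(h \<longlongrightarrow> 0) (at 0)" using DERIV_isCont[OF h[of 0]] r True by (simp add: isCont_def)
  \<comment> \<open>Write \<open>h\<close> as \<open>sqrt h * sqrt h\<close>. As \<open>h\<close> is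
    O(s^2), one factor pays for the division by \<open>s\<close>, while the other absorbs the
    logarithm and leaves a fourth root tending to 0.\<close>
  have "((\<lambda>s. h s * ln (h s) / s) \<longlongrightarrow> 0) (at 0)"
  proof (rule Lim_null_comparison)
    show "((\<lambda>s. sqrt C * (4 * sqrt (sqrt (h s)))) \<longlongrightarrow> 0) (at 0)"
      by (rule tendsto_eq_intros cont refl | simp)+
    have "\<forall>\<^sub>F s in at 0. h s < 1" using cont by (rule order_tendstoD) simp
    moreover have "\<forall>\<^sub>F s in at 0. \<bar>s\<bar> \<le> r \<and> s \<noteq> (0::real)"
      unfolding eventually_at using r by (intro exI[of _ r]) auto
    ultimately show "\<forall>\<^sub>F s in at 0. norm (h s * ln (h s) / s) \<le> sqrt C * (4 * sqrt (sqrt (h s)))"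
    proof eventually_elim
      case (elim s)
      have "h s \<le> C * s\<^sup>2" using taylor2_bound[of r h h' h'' C s, OF h h' C] elim True h'0 by simp
      then have "sqrt (h s) \<le> sqrt C * \<bar>s\<bar>" using real_sqrt_le_mono by (fastforce simp: real_sqrt_mult)
      moreover have "sqrt (h s) * \<bar>ln (h s)\<bar> \<le> 4 * sqrt (sqrt (h s))"
        using elim nn by (intro sqrt_mult_abs_ln_le) auto
      ultimately have "sqrt (h s) * (sqrt (h s) * \<bar>ln (h s)\<bar>) \<le> (sqrt C * \<bar>s\<bar>) * (4 * sqrt (sqrt (h s)))"
        using nn[of s] elim order_trans[OF real_sqrt_ge_zero \<open>sqrt (h s) \<le> sqrt C * \<bar>s\<bar>\<close>]
        by (elim mult_mono) simp_all
      moreover have "sqrt (h s) * (sqrt (h s) * \<bar>ln (h s)\<bar>) = h s * \<bar>ln (h s)\<bar>"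
        using nn[of s] elim by (simp flip: mult.assoc)
      ultimately have "h s * \<bar>ln (h s)\<bar> \<le> sqrt C * (4 * sqrt (sqrt (h s))) * \<bar>s\<bar>"
        by (simp add: mult_ac)
      then show ?case using elim nn[of s] by (simp add: abs_mult divide_le_eq)
    qed
  qed
  then show ?thesis unfolding DERIV_def using True h'0 by simp
qed

section \<open>Convolution operators\<close>

lemmas lborel_integral_fst = lborel_pair.integral_fst[unfolded lborel_prod]
lemmas lborel_integral_snd = lborel_pair.integral_snd[unfolded lborel_prod]
lemmas lborel_integrable_fst = lborel_pair.integrable_fst[unfolded lborel_prod]

lemma borel_measurable_compose_continuous:
  assumes "f \<in> borel_measurable borel" "continuous_on UNIV g"
  shows "(\<lambda>x. f (g x)) \<in> borel_measurable borel"
  by (rule measurable_compose[OF borel_measurable_continuous_onI[OF assms(2)] assms(1)])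

lemma integrable_lborel_pairI:
  fixes f :: "'a::euclidean_space \<Rightarrow> 'b::euclidean_space \<Rightarrow> real"
  assumes "case_prod f \<in> borel_measurable (lborel \<Otimes>\<^sub>M lborel)"
    and "integrable lborel (\<lambda>x. LINT y|lborel. \<bar>f x y\<bar>)"
    and "\<And>x. integrable lborel (f x)"
  shows "integrable lborel (case_prod f)"
proof -
  have "integrable (lborel \<Otimes>\<^sub>M lborel) (case_prod f)"
    by (rule lborel_pair.Fubini_integrable[OF assms(1)]) (use assms(2,3) in simp_all)
  then show ?thesis unfolding lborel_prod .
qed

lemma integrable_lborel_swap:
  fixes f :: "'a::euclidean_space \<Rightarrow> 'b::euclidean_space \<Rightarrow> real"
  assumes "integrable lborel (\<lambda>(x, y). f x y)"
  shows "integrable lborel (\<lambda>(y, x). f x y)"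
  using lborel_pair.integrable_product_swap[of "\<lambda>(x, y). f x y", unfolded lborel_prod, OF assms] by simp

lemma integrable_lborel_mult:
  fixes f :: "'a::euclidean_space \<Rightarrow> real" and g :: "'b::euclidean_space \<Rightarrow> real"
  assumes f: "integrable lborel f" and g: "integrable lborel g"
  shows "integrable lborel (\<lambda>(x, y). f x * g y)"
proof (rule integrable_lborel_pairI)
  have [measurable]: "f \<in> borel_measurable borel" "g \<in> borel_measurable borel" using f g by auto
  show "(\<lambda>(x, y). f x * g y) \<in> borel_measurable (lborel \<Otimes>\<^sub>M lborel)" by measurable
qed (use f g in \<open>auto simp: abs_mult\<close>)

text \<open>The class in which the Fubini exchanges for convolutions take place: it is stable under
  convolution with an integrable, possibly unbounded kernel, and the product of two members is
  integrable.\<close>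

definition L1_Linf :: "('a::euclidean_space \<Rightarrow> real) \<Rightarrow> bool" where
  "L1_Linf r \<longleftrightarrow> integrable lborel r \<and> (\<exists>B. \<forall>x. \<bar>r x\<bar> \<le> B)"

lemma L1_LinfI: "integrable lborel r \<Longrightarrow> (\<And>x. \<bar>r x\<bar> \<le> B) \<Longrightarrow> L1_Linf r"
  by (auto simp: L1_Linf_def)

lemma L1_Linf_measurable: "L1_Linf r \<Longrightarrow> r \<in> borel_measurable borel"
  by (auto simp: L1_Linf_def)

lemma integrable_mult_bounded:
  fixes f g :: "'a::euclidean_space \<Rightarrow> real"
  assumes f: "integrable lborel f" and [measurable]: "g \<in> borel_measurable borel" and B: "\<And>x. \<bar>g x\<bar> \<le> B"
  shows "integrable lborel (\<lambda>x. f x * g x)"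
proof (rule Bochner_Integration.integrable_bound[OF integrable_mult_right[OF f, of B]])
  have [measurable]: "f \<in> borel_measurable borel" using f by auto
  show "(\<lambda>x. f x * g x) \<in> borel_measurable lborel" by measurable
  have "\<bar>f x\<bar> * \<bar>g x\<bar> \<le> \<bar>B\<bar> * \<bar>f x\<bar>" for x
    using mult_left_mono[OF order_trans[OF B abs_ge_self], of "\<bar>f x\<bar>" x] by (simp add: mult.commute)
  then show "AE x in lborel. norm (f x * g x) \<le> norm (B * f x)" by (auto simp: abs_mult)
qed

lemma integrable_L1_Linf_mult:
  assumes f: "L1_Linf f" and g: "L1_Linf g"
  shows "integrable lborel (\<lambda>x. f x * g x)"
proof -
  obtain C where C: "\<And>x. \<bar>g x\<bar> \<le> C" using g by (auto simp: L1_Linf_def)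
  show ?thesis
    using f by (intro integrable_mult_bounded[OF _ L1_Linf_measurable[OF g] C]) (auto simp: L1_Linf_def)
qed

lemma L1_Linf_diff:
  assumes f: "L1_Linf f" and g: "L1_Linf g"
  shows "L1_Linf (\<lambda>x. f x - g x)"
proof -
  obtain B where B: "\<And>x. \<bar>f x\<bar> \<le> B" using f by (auto simp: L1_Linf_def)
  obtain C where C: "\<And>x. \<bar>g x\<bar> \<le> C" using g by (auto simp: L1_Linf_def)
  show ?thesis
    by (rule L1_LinfI[of _ "B + C"])
      (use f g B C in \<open>auto simp: L1_Linf_def intro!: order_trans[OF abs_triangle_ineq4] add_mono\<close>)
qed

section \<open>Convolution with an integrable kernel\<close>

context
  fixes a :: "'a::euclidean_space \<Rightarrow> real"
  assumes a: "integrable lborel a"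
begin

lemma kernel_measurable[measurable]: "a \<in> borel_measurable borel" using a by auto

lemma conv_commute:
  assumes [measurable]: "r \<in> borel_measurable borel"
  shows "conv a r = conv r a"
proof
  fix x
  show "conv a r x = conv r a x"
    using lborel_integral_reflect(2)[of "\<lambda>y. r y * a (x - y)" x] by (simp add: conv_def mult.commute)
qed

lemma integrable_conv_integrand:
  assumes [measurable]: "r \<in> borel_measurable borel" and B: "\<And>x. \<bar>r x\<bar> \<le> B"
  shows "integrable lborel (\<lambda>y. r (x - y) * a y)"
  using integrable_mult_bounded[OF a, of "\<lambda>y. r (x - y)" B] B by (simp add: mult.commute)

lemma abs_conv_le:
  assumes [measurable]: "r \<in> borel_measurable borel" and B: "\<And>x. \<bar>r x\<bar> \<le> B"
  shows "\<bar>conv r a x\<bar> \<le> B * (LINT y|lborel. \<bar>a y\<bar>)"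
proof -
  have "norm (conv r a x) \<le> (LINT y|lborel. norm (r (x - y) * a y))"
    unfolding conv_def by (rule integral_norm_bound)
  also have "\<dots> \<le> (LINT y|lborel. B * \<bar>a y\<bar>)"
    using a integrable_conv_integrand[OF assms] B
    by (intro integral_mono integrable_norm) (auto simp: abs_mult mult_right_mono)
  finally show ?thesis by simp
qed

lemma integrable_conv_pair:
  assumes r: "integrable lborel r"
  shows "integrable lborel (\<lambda>(x, y). r (x - y) * a y)"
proof (rule integrable_lborel_swap[of "\<lambda>y x. r (x - y) * a y"], rule integrable_lborel_pairI)
  have [measurable]: "r \<in> borel_measurable borel" using r by auto
  show "(\<lambda>(y, x). r (x - y) * a y) \<in> borel_measurable (lborel \<Otimes>\<^sub>M lborel)" by measurable
  have sh: "integrable lborel (\<lambda>x. r (x - y))" "(LINT x|lborel. \<bar>r (x - y)\<bar>) = (LINT x|lborel. \<bar>r x\<bar>)" for y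
    using lborel_integral_shift(1)[of r "-y"] lborel_integral_shift(2)[of "\<lambda>x. \<bar>r x\<bar>" "-y"] r by auto
  show "integrable lborel (\<lambda>x. r (x - y) * a y)" for y using sh by simp
  show "integrable lborel (\<lambda>y. LINT x|lborel. \<bar>r (x - y) * a y\<bar>)"
    using a by (simp add: abs_mult sh)
qed

lemma L1_Linf_conv:
  assumes r: "L1_Linf r"
  shows "L1_Linf (conv r a)"
proof -
  obtain B where B: "\<And>x. \<bar>r x\<bar> \<le> B" using r by (auto simp: L1_Linf_def)
  have "integrable lborel (conv r a)"
    unfolding conv_def using lborel_integrable_fst[OF integrable_conv_pair] r by (simp add: L1_Linf_def)
  then show ?thesis using abs_conv_le[OF L1_Linf_measurable[OF r] B] by (rule L1_LinfI)
qed

text \<open>Fubini puts the kernel outside an integral of \<open>r (x - y) * s x\<close>; a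
  translation moves the shift to \<open>s\<close> with the opposite sign, and evenness of
  \<open>a\<close> absorbs the sign.\<close>

lemma integral_conv_mult_even:
  assumes r: "L1_Linf r" and s: "L1_Linf s" and even: "\<And>y. a (- y) = a y"
  shows "(LINT x|lborel. conv r a x * s x) = (LINT x|lborel. r x * conv s a x)"
proof -
  note [measurable] = L1_Linf_measurable[OF r] L1_Linf_measurable[OF s]
  have joint: "integrable lborel (\<lambda>(x, y). r (x - y) * a y * s x)" if r: "L1_Linf r" and s: "L1_Linf s" for r s
  proof -
    note [measurable] = L1_Linf_measurable[OF r] L1_Linf_measurable[OF s]
    obtain B where B: "\<And>x. \<bar>s x\<bar> \<le> B" using s by (auto simp: L1_Linf_def)
    have "integrable lborel (\<lambda>p. (case p of (x, y) \<Rightarrow> r (x - y) * a y) * s (fst p))"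
      by (rule integrable_mult_bounded[of _ _ B]) (use r B in \<open>auto simp: L1_Linf_def intro!: integrable_conv_pair
        borel_measurable_compose_continuous[where g=fst] continuous_intros\<close>)
    then show ?thesis by (simp add: case_prod_unfold)
  qed
  have sw: "(LINT x|lborel. conv r a x * s x) = (LINT y|lborel. a y * (LINT x|lborel. r (x - y) * s x))"
    if r: "L1_Linf r" and s: "L1_Linf s" for r s
  proof -
    have "(LINT x|lborel. conv r a x * s x) = (LINT x|lborel. LINT y|lborel. r (x - y) * a y * s x)"
      unfolding conv_def by simp
    also have "\<dots> = (LINT y|lborel. LINT x|lborel. r (x - y) * a y * s x)"
      using lborel_integral_fst[OF joint[OF r s]] lborel_integral_snd[OF joint[OF r s]] by simp
    also have "\<dots> = (LINT y|lborel. a y * (LINT x|lborel. r (x - y) * s x))"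
      by (simp flip: integral_mult_right_zero add: mult_ac)
    finally show ?thesis .
  qed
  have "(LINT x|lborel. r (x - y) * s x) = (LINT x|lborel. s (x - (- y)) * r x)" for y
    using lborel_integral_shift(2)[of "\<lambda>x. r (x - y) * s x" y] by (simp add: mult.commute)
  then have "(LINT x|lborel. conv r a x * s x) = (LINT y|lborel. a (- y) * (LINT x|lborel. s (x - (- y)) * r x))"
    unfolding sw[OF r s] even by simp
  also have "\<dots> = (LINT y|lborel. a y * (LINT x|lborel. s (x - y) * r x))"
    using lborel_integral_reflect(2)[of "\<lambda>y. a y * (LINT x|lborel. s (x - y) * r x)" 0] by simp
  also have "\<dots> = (LINT x|lborel. conv s a x * r x)" by (rule sw[OF s r, symmetric])
  finally show ?thesis by (simp add: mult.commute)
qed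

text \<open>Both sides are the double integral of r(x - y - z) a(z) b(y), in the two orders of
  integration; boundedness of \<open>r\<close> makes it absolutely convergent. This lets the
  long-range kernel slip between the two copies of the short-range one.\<close>

lemma conv_conv_commute:
  assumes b: "integrable lborel b" and r: "L1_Linf r"
  shows "conv (conv r a) b = conv (conv r b) a"
proof
  fix x
  note [measurable] = L1_Linf_measurable[OF r]
  obtain B where B: "\<And>x. \<bar>r x\<bar> \<le> B" using r by (auto simp: L1_Linf_def)
  have [measurable]: "b \<in> borel_measurable borel" using b by auto
  have "integrable lborel (\<lambda>p. (case p of (y, z) \<Rightarrow> b y * a z) * r (x - fst p - snd p))"
    by (rule integrable_mult_bounded[of _ _ B]) (use B in \<open>auto intro!: integrable_lborel_mult[OF b a]
      borel_measurable_compose_continuous[where g="\<lambda>p. x - fst p - snd p"] continuous_intros\<close>)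
  then have J: "integrable lborel (\<lambda>(y, z). r (x - y - z) * a z * b y)"
    by (simp add: case_prod_unfold mult_ac)
  have "conv (conv r a) b x = (LINT y|lborel. LINT z|lborel. r (x - y - z) * a z * b y)"
    unfolding conv_def by simp
  also have "\<dots> = (LINT z|lborel. LINT y|lborel. r (x - y - z) * a z * b y)"
    using lborel_integral_fst[OF J] lborel_integral_snd[OF J] by simp
  also have "\<dots> = (LINT z|lborel. LINT y|lborel. r (x - z - y) * b y * a z)"
    by (simp add: mult_ac diff_diff_add add.commute)
  also have "\<dots> = conv (conv r b) a x" unfolding conv_def by simp
  finally show "conv (conv r a) b x = conv (conv r b) a x" .
qed

lemma conv_diff:
  assumes r: "L1_Linf r" and s: "L1_Linf s"
  shows "conv (\<lambda>x. r x - s x) a x = conv r a x - conv s a x"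
proof -
  obtain B where B: "\<And>x. \<bar>r x\<bar> \<le> B" using r by (auto simp: L1_Linf_def)
  obtain C where C: "\<And>x. \<bar>s x\<bar> \<le> C" using s by (auto simp: L1_Linf_def)
  show ?thesis unfolding conv_def left_diff_distrib
    by (intro Bochner_Integration.integral_diff integrable_conv_integrand[OF _ B] integrable_conv_integrand[OF _ C]
      L1_Linf_measurable r s)
qed

text \<open>Expanding the square gives two diagonal terms, each equal to the integral of u^2 because
  \<open>a\<close> has mass 1 and translations preserve integrals, and a cross term that is a
  convolution tested with \<open>u\<close>.\<close>

lemma
  assumes u: "L1_Linf u" and one: "(LINT y|lborel. a y) = 1"
  shows integrable_nonlocal_energy: "integrable lborel (\<lambda>(x, y). a y * (u x - u (x - y))\<^sup>2)"
    and integral_nonlocal_energy: "(LINT (x, y)|lborel. a y * (u x - u (x - y))\<^sup>2)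
      = 2 * (LINT x|lborel. (u x - conv u a x) * u x)"
proof -
  note [measurable] = L1_Linf_measurable[OF u]
  obtain B where B: "\<And>x. \<bar>u x\<bar> \<le> B" using u by (auto simp: L1_Linf_def)
  have uu: "integrable lborel (\<lambda>x. u x * u x)" using integrable_L1_Linf_mult[OF u u] .
  have 1: "integrable lborel (\<lambda>(x, y). (u x * u x) * a y)"
    by (rule integrable_lborel_mult[OF uu a])
  have 2: "integrable lborel (\<lambda>(x, y). (u (x - y) * u (x - y)) * a y)"
    using integrable_conv_pair[OF uu] .
  have "integrable lborel (\<lambda>p. (case p of (x, y) \<Rightarrow> u (x - y) * a y) * u (fst p))"
    by (rule integrable_mult_bounded[of _ _ B]) (use u B in \<open>auto simp: L1_Linf_def intro!: integrable_conv_pair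
        borel_measurable_compose_continuous[where g=fst] continuous_intros\<close>)
  then have 3: "integrable lborel (\<lambda>(x, y). u (x - y) * a y * u x)"
    by (simp add: case_prod_unfold)
  have eq: "(\<lambda>(x, y). a y * (u x - u (x - y))\<^sup>2) = (\<lambda>p. (case p of (x, y) \<Rightarrow> (u x * u x) * a y)
     + (case p of (x, y) \<Rightarrow> (u (x - y) * u (x - y)) * a y) - 2 * (case p of (x, y) \<Rightarrow> u (x - y) * a y * u x))"
    by (auto simp: fun_eq_iff power2_eq_square algebra_simps)
  show "integrable lborel (\<lambda>(x, y). a y * (u x - u (x - y))\<^sup>2)"
    unfolding eq using 1 2 3 by (intro Bochner_Integration.integrable_diff Bochner_Integration.integrable_add integrable_mult_right)
  have i1: "(LINT (x, y)|lborel. (u x * u x) * a y) = (LINT x|lborel. u x * u x)"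
    using lborel_integral_fst[OF 1] one by simp
  have i2: "(LINT (x, y)|lborel. (u (x - y) * u (x - y)) * a y) = (LINT x|lborel. u x * u x)"
  proof -
    have "(LINT x|lborel. u (x - y) * u (x - y)) = (LINT x|lborel. u x * u x)" for y
      using lborel_integral_shift(2)[of "\<lambda>x. u x * u x" "-y"] by simp
    then show ?thesis using lborel_integral_snd[OF 2] one by simp
  qed
  have i3: "(LINT (x, y)|lborel. u (x - y) * a y * u x) = (LINT x|lborel. conv u a x * u x)"
    using lborel_integral_fst[OF 3] by (simp add: conv_def)
  have "(LINT (x, y)|lborel. a y * (u x - u (x - y))\<^sup>2)
      = (LINT x|lborel. u x * u x) + (LINT x|lborel. u x * u x) - 2 * (LINT x|lborel. conv u a x * u x)"
    unfolding eq using 1 2 3 i1 i2 i3 by simp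
  also have "\<dots> = 2 * (LINT x|lborel. (u x - conv u a x) * u x)"
    using uu integrable_L1_Linf_mult[OF L1_Linf_conv[OF u] u] by (simp add: left_diff_distrib)
  finally show "(LINT (x, y)|lborel. a y * (u x - u (x - y))\<^sup>2) = 2 * (LINT x|lborel. (u x - conv u a x) * u x)" .
qed

end

text \<open>The regularity that passes from \<rho> through the convolutions to the potential:
  differentiability gives a meaning to the force, the Lipschitz constant bounds it, and boundedness
  makes convolutions with integrable kernels converge.\<close>

definition lipschitz_bounded :: "real \<Rightarrow> real \<Rightarrow> ('a::euclidean_space \<Rightarrow> real) \<Rightarrow> bool" where
  "lipschitz_bounded B L r \<longleftrightarrow> (\<forall>x. \<bar>r x\<bar> \<le> B) \<and> (\<forall>x y. \<bar>r x - r y\<bar> \<le> L * norm (x - y)) \<and> (\<forall>x. r differentiable at x)"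

lemma lipschitz_bounded_measurable:
  assumes "lipschitz_bounded B L r"
  shows "r \<in> borel_measurable borel"
proof (rule borel_measurable_continuous_onI, rule differentiable_imp_continuous_on)
  show "r differentiable_on UNIV"
    using assms unfolding lipschitz_bounded_def differentiable_on_def by blast
qed

text \<open>The derivative falls on \<open>r\<close>, so that integrability of the kernel suffices;
  both constants are multiplied by its L^1 norm.\<close>

lemma lipschitz_bounded_conv:
  assumes r: "lipschitz_bounded B L r" and a: "integrable lborel a"
  shows "lipschitz_bounded (B * (LINT y|lborel. \<bar>a y\<bar>)) (L * (LINT y|lborel. \<bar>a y\<bar>)) (conv r a)"
proof -
  note [measurable] = lipschitz_bounded_measurable[OF r]
  have B: "\<bar>r x\<bar> \<le> B" and L: "\<bar>r x - r y\<bar> \<le> L * norm (x - y)" and D: "r differentiable at x" for x y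
    using r by (auto simp: lipschitz_bounded_def)
  note int = integrable_conv_integrand[OF a lipschitz_bounded_measurable[OF r] B]
  have lip: "\<bar>r (x - z) * a z - r (y - z) * a z\<bar> \<le> (L * \<bar>a z\<bar>) * norm (x - y)" for x y z
  proof -
    have "\<bar>r (x - z) * a z - r (y - z) * a z\<bar> = \<bar>r (x - z) - r (y - z)\<bar> * \<bar>a z\<bar>"
      by (simp only: left_diff_distrib[symmetric] abs_mult)
    also have "\<dots> \<le> L * norm (x - y) * \<bar>a z\<bar>"
      using mult_right_mono[OF L[of "x - z" "y - z"], of "\<bar>a z\<bar>"] by simp
    finally show ?thesis by (simp add: mult_ac)
  qed
  have "conv r a differentiable at x" for x
  proof -
    have "((\<lambda>p. LINT z|lborel. r (p - z) * a z) has_derivative (\<lambda>h. LINT z|lborel. frechet_derivative r (at (x - z)) h * a z)) (at x)"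
    proof (rule has_derivative_lebesgue_integral[OF open_UNIV, where W="\<lambda>z. L * \<bar>a z\<bar>"])
      show "((\<lambda>p. r (p - z) * a z) has_derivative (\<lambda>h. frechet_derivative r (at (x - z)) h * a z)) (at x)" for z
      proof -
        have "((\<lambda>p. r (p - z)) has_derivative frechet_derivative r (at (x - z))) (at x)"
          by (rule has_derivative_compose[where f="\<lambda>p. p - z" and f'="\<lambda>h. h" and g=r])
            (auto intro!: derivative_eq_intros D simp flip: frechet_derivative_works)
        then show ?thesis by (intro has_derivative_mult_left)
      qed
    qed (use int lip a in auto)
    then show ?thesis unfolding conv_def[abs_def] differentiable_def by blast
  qed
  moreover have "\<bar>conv r a x - conv r a y\<bar> \<le> L * (LINT y|lborel. \<bar>a y\<bar>) * norm (x - y)" for x y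
  proof -
    have "conv r a x - conv r a y = (LINT z|lborel. r (x - z) * a z - r (y - z) * a z)"
      unfolding conv_def using int by simp
    also have "norm \<dots> \<le> (LINT z|lborel. norm (r (x - z) * a z - r (y - z) * a z))"
      by (rule integral_norm_bound)
    also have "\<dots> \<le> (LINT z|lborel. (L * \<bar>a z\<bar>) * norm (x - y))"
      by (rule integral_mono) (use lip int a in auto)
    finally show ?thesis by simp
  qed
  ultimately show ?thesis using abs_conv_le[OF a lipschitz_bounded_measurable[OF r] B]
    by (auto simp: lipschitz_bounded_def)
qed

lemma lipschitz_bounded_partial_deriv:
  fixes r :: "'a::euclidean_space \<Rightarrow> real"
  assumes r: "lipschitz_bounded B L r" and b: "b \<in> Basis"
  shows "((\<lambda>s. r (x + s *\<^sub>R b)) has_real_derivative partial_deriv b r x) (at 0)"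
    and "\<bar>partial_deriv b r x\<bar> \<le> L"
    and "partial_deriv b r \<in> borel_measurable borel"
proof -
  note [measurable] = lipschitz_bounded_measurable[OF r]
  have L: "\<bar>r x - r y\<bar> \<le> L * norm (x - y)" and D: "r differentiable at x" for x y
    using r by (auto simp: lipschitz_bounded_def)
  have der: "((\<lambda>s. r (x + s *\<^sub>R b)) has_real_derivative partial_deriv b r x) (at 0)" for x
  proof -
    have F: "(r has_derivative frechet_derivative r (at x)) (at x)" using D by (simp flip: frechet_derivative_works)
    then have "((\<lambda>s. r (x + s *\<^sub>R b)) has_derivative (\<lambda>s. frechet_derivative r (at x) (s *\<^sub>R b))) (at 0)"
      by (intro has_derivative_compose[where f="\<lambda>s. x + s *\<^sub>R b" and f'="\<lambda>s. s *\<^sub>R b" and g=r])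
        (auto intro!: derivative_eq_intros)
    moreover have "(\<lambda>s. frechet_derivative r (at x) (s *\<^sub>R b)) = (*) (partial_deriv b r x)"
      using linear_scale[OF has_derivative_linear[OF F]] by (auto simp: fun_eq_iff partial_deriv_def)
    ultimately show ?thesis by (simp add: has_field_derivative_def)
  qed
  then show "((\<lambda>s. r (x + s *\<^sub>R b)) has_real_derivative partial_deriv b r x) (at 0)" .
  \<comment> \<open>A derivative that is not known to be continuous is still a pointwise limit of
    difference quotients along the steps 1/(n+1). Measurability and the bound by \<open>L\<close>
    both pass to this limit.\<close>
  have lim: "(\<lambda>n. (r (x + inverse (real (Suc n)) *\<^sub>R b) - r x) / inverse (real (Suc n))) \<longlonglongrightarrow> partial_deriv b r x" for x
  proof -
    have "((\<lambda>s. (r (x + s *\<^sub>R b) - r x) / s) \<longlongrightarrow> partial_deriv b r x) (at 0)"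
      using der[of x] by (simp add: DERIV_def)
    then have "((\<lambda>s. (r (x + s *\<^sub>R b) - r x) / s) \<circ> (\<lambda>n. inverse (real (Suc n)))) \<longlonglongrightarrow> partial_deriv b r x"
      unfolding tendsto_at_iff_sequentially
      by (elim allE impE) (use LIMSEQ_inverse_real_of_nat in auto)
    then show ?thesis by (simp add: o_def)
  qed
  show "partial_deriv b r \<in> borel_measurable borel"
    by (rule borel_measurable_LIMSEQ_real[where u="\<lambda>n x. (r (x + inverse (real (Suc n)) *\<^sub>R b) - r x) / inverse (real (Suc n))"])
      (use lim in auto)
  show "\<bar>partial_deriv b r x\<bar> \<le> L"
  proof (rule LIMSEQ_le_const2[OF tendsto_rabs[OF lim[of x]]], intro exI allI impI)
    fix n
    have "\<bar>r (x + inverse (real (Suc n)) *\<^sub>R b) - r x\<bar> \<le> L * inverse (real (Suc n))"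
      using L[of "x + inverse (real (Suc n)) *\<^sub>R b" x] b by simp
    then show "\<bar>(r (x + inverse (real (Suc n)) *\<^sub>R b) - r x) / inverse (real (Suc n))\<bar> \<le> L"
      by (simp only: abs_divide abs_of_pos[of "inverse (real (Suc n))"] pos_divide_le_eq
        inverse_positive_iff_positive of_nat_0_less_iff zero_less_Suc)
  qed
qed

section \<open>The interaction energy\<close>

lemma
  fixes \<omega> :: "'a::euclidean_space \<Rightarrow> real"
  assumes \<alpha>: "0 < \<alpha>" and \<omega>: "has_bochner_integral lborel \<omega> 1"
  shows integrable_rescale: "integrable lborel (rescale \<alpha> \<omega>)"
    and integral_rescale: "(LINT x|lborel. rescale \<alpha> \<omega> x) = 1"
proof -
  have [measurable]: "\<omega> \<in> borel_measurable borel" using \<omega> by (auto simp: has_bochner_integral_iff)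
  have i: "integrable lborel \<omega>" "integral\<^sup>L lborel \<omega> = 1" using \<omega> by (auto simp: has_bochner_integral_iff)
  have "integrable lborel (\<lambda>x. \<omega> (x /\<^sub>R \<alpha>))"
    using lborel_integral_affine(1)[of \<omega> "inverse \<alpha>" 0] i \<alpha> by simp
  then show "integrable lborel (rescale \<alpha> \<omega>)" unfolding rescale_def[abs_def] by simp
  have "1 = inverse \<alpha> ^ DIM('a) * (LINT x|lborel. \<omega> (x /\<^sub>R \<alpha>))"
    using lborel_integral_affine(2)[of \<omega> "inverse \<alpha>" 0] i \<alpha> by simp
  then show "(LINT x|lborel. rescale \<alpha> \<omega> x) = 1"
    using \<alpha> by (simp add: rescale_def power_inverse divide_inverse mult.commute)
qed

locale interaction =
  fixes \<omega> a :: "'a::euclidean_space \<Rightarrow> real" and c :: real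
  assumes \<omega>: "integrable lborel \<omega>" and \<omega>_even: "\<And>y. \<omega> (- y) = \<omega> y"
    and a: "integrable lborel a" and a_even: "\<And>y. a (- y) = a y"
    and a_mass: "(LINT y|lborel. a y) = 1"
begin

text \<open>With \<open>a\<close> the rescaled long-range kernel and \<open>c\<close> = 1/\<alpha>^2
  this is the sum of \<open>Phi_S\<close> and \<open>Phi_L\<close>. The density stands first in
  every convolution, so that the kernels act from the right as commuting operators.\<close>

definition potential :: "('a \<Rightarrow> real) \<Rightarrow> 'a \<Rightarrow> real" where
  "potential r x = c * (conv (conv r \<omega>) \<omega> x - conv (conv (conv r \<omega>) \<omega>) a x)"

lemma L1_Linf_potential:
  assumes r: "L1_Linf r"
  shows "L1_Linf (potential r)"
proof -
  have "L1_Linf (\<lambda>x. conv (conv r \<omega>) \<omega> x - conv (conv (conv r \<omega>) \<omega>) a x)"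
    by (intro L1_Linf_diff L1_Linf_conv \<omega> a r)
  then obtain B where B: "integrable lborel (\<lambda>x. conv (conv r \<omega>) \<omega> x - conv (conv (conv r \<omega>) \<omega>) a x)"
    "\<And>x. \<bar>conv (conv r \<omega>) \<omega> x - conv (conv (conv r \<omega>) \<omega>) a x\<bar> \<le> B" by (auto simp: L1_Linf_def)
  show ?thesis unfolding potential_def[abs_def]
    by (rule L1_LinfI[OF integrable_mult_right[OF B(1)], of _ "\<bar>c\<bar> * B"]) (simp add: abs_mult B(2) mult_left_mono)
qed

text \<open>One of the two copies of \<omega> is commuted past \<open>a\<close> and then moved onto
  \<open>s\<close> by evenness. Both densities now enter only after convolution with \<omega>, as
  they do in the free energy.\<close>

lemma integral_potential_mult:
  assumes r: "L1_Linf r" and s: "L1_Linf s"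
  shows "(LINT x|lborel. potential r x * s x) = c * ((LINT x|lborel. conv r \<omega> x * conv s \<omega> x)
    - (LINT x|lborel. conv (conv r \<omega>) a x * conv s \<omega> x))"
proof -
  note i = L1_Linf_conv[OF \<omega>] L1_Linf_conv[OF a]
  have 1: "(LINT x|lborel. conv (conv r \<omega>) \<omega> x * s x) = (LINT x|lborel. conv r \<omega> x * conv s \<omega> x)"
    by (intro integral_conv_mult_even \<omega> \<omega>_even i r s)
  have "conv (conv (conv r \<omega>) \<omega>) a = conv (conv (conv r \<omega>) a) \<omega>"
    by (intro conv_conv_commute \<omega> a i r)
  then have 2: "(LINT x|lborel. conv (conv (conv r \<omega>) \<omega>) a x * s x) = (LINT x|lborel. conv (conv r \<omega>) a x * conv s \<omega> x)"
    by (simp add: integral_conv_mult_even[OF \<omega> _ s \<omega>_even] i r)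
  have "(LINT x|lborel. potential r x * s x) = (LINT x|lborel. c * (conv (conv r \<omega>) \<omega> x * s x - conv (conv (conv r \<omega>) \<omega>) a x * s x))"
    by (simp add: potential_def left_diff_distrib mult.assoc)
  also have "\<dots> = c * ((LINT x|lborel. conv (conv r \<omega>) \<omega> x * s x) - (LINT x|lborel. conv (conv (conv r \<omega>) \<omega>) a x * s x))"
    by (subst integral_mult_right_zero, subst Bochner_Integration.integral_diff) (auto intro!: integrable_L1_Linf_mult i r s)
  finally show ?thesis unfolding 1 2 .
qed

text \<open>In the form given by \<open>integral_potential_mult\<close> only the term with
  \<open>a\<close> is not visibly symmetric; evenness of \<open>a\<close> moves that convolution to
  the other factor.\<close>

lemma integral_potential_commute:
  assumes r: "L1_Linf r" and s: "L1_Linf s"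
  shows "(LINT x|lborel. potential r x * s x) = (LINT x|lborel. potential s x * r x)"
proof -
  note i = L1_Linf_conv[OF \<omega>] L1_Linf_conv[OF a]
  have "(LINT x|lborel. conv (conv r \<omega>) a x * conv s \<omega> x) = (LINT x|lborel. conv r \<omega> x * conv (conv s \<omega>) a x)"
    by (intro integral_conv_mult_even a a_even i r s)
  then show ?thesis unfolding integral_potential_mult[OF r s] integral_potential_mult[OF s r]
    by (simp add: mult.commute)
qed

text \<open>The factor 2 of \<open>integral_nonlocal_energy\<close> cancels the 1/2 of the energy,
  which becomes potential times density without a prefactor; symmetry then yields a factor 2 on
  differentiation in time.\<close>

lemma
  assumes r: "L1_Linf r"
  shows integrable_interaction: "integrable lborel (\<lambda>(x, y). a y * (conv r \<omega> x - conv r \<omega> (x - y))\<^sup>2)"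
    and integral_interaction: "c / 2 * (LINT (x, y)|lborel. a y * (conv r \<omega> x - conv r \<omega> (x - y))\<^sup>2)
      = (LINT x|lborel. potential r x * r x)"
proof -
  have u: "L1_Linf (conv r \<omega>)" by (rule L1_Linf_conv[OF \<omega> r])
  show "integrable lborel (\<lambda>(x, y). a y * (conv r \<omega> x - conv r \<omega> (x - y))\<^sup>2)"
    by (rule integrable_nonlocal_energy[OF a u a_mass])
  show "c / 2 * (LINT (x, y)|lborel. a y * (conv r \<omega> x - conv r \<omega> (x - y))\<^sup>2)
      = (LINT x|lborel. potential r x * r x)"
    unfolding integral_nonlocal_energy[OF a u a_mass] integral_potential_mult[OF r r]
    using integrable_L1_Linf_mult[OF u u] integrable_L1_Linf_mult[OF L1_Linf_conv[OF a u] u]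
    by (simp add: left_diff_distrib)
qed

lemma potential_diff:
  assumes r: "L1_Linf r" and s: "L1_Linf s"
  shows "potential (\<lambda>x. r x - s x) x = potential r x - potential s x"
proof -
  note i = L1_Linf_conv[OF \<omega>] L1_Linf_conv[OF a]
  have 1: "conv (\<lambda>x. r x - s x) \<omega> = (\<lambda>x. conv r \<omega> x - conv s \<omega> x)"
    by (rule ext, rule conv_diff[OF \<omega> r s])
  have 2: "conv (conv (\<lambda>x. r x - s x) \<omega>) \<omega> = (\<lambda>x. conv (conv r \<omega>) \<omega> x - conv (conv s \<omega>) \<omega> x)"
    unfolding 1 by (rule ext, intro conv_diff \<omega> i r s)
  have 3: "conv (conv (conv (\<lambda>x. r x - s x) \<omega>) \<omega>) a x = conv (conv (conv r \<omega>) \<omega>) a x - conv (conv (conv s \<omega>) \<omega>) a x"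
    unfolding 2 by (intro conv_diff \<omega> i r s a)
  show ?thesis unfolding potential_def 3 unfolding 2 by (simp add: algebra_simps)
qed

text \<open>An upper bound for the operator norm of \<open>potential\<close> in the sup norm, with
  one L^1 norm per convolution.\<close>

definition potential_norm :: real where
  "potential_norm = \<bar>c\<bar> * ((LINT y|lborel. \<bar>\<omega> y\<bar>) * (LINT y|lborel. \<bar>\<omega> y\<bar>) * (1 + (LINT y|lborel. \<bar>a y\<bar>)))"

lemma abs_potential_le:
  assumes r: "L1_Linf r" and B: "\<And>x. \<bar>r x\<bar> \<le> B"
  shows "\<bar>potential r x\<bar> \<le> potential_norm * B"
proof -
  let ?w = "LINT y|lborel. \<bar>\<omega> y\<bar>" and ?a = "LINT y|lborel. \<bar>a y\<bar>"
  note i = L1_Linf_conv[OF \<omega>] L1_Linf_conv[OF a]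
  have 2: "\<bar>conv (conv r \<omega>) \<omega> x\<bar> \<le> B * ?w * ?w" for x
    by (intro abs_conv_le \<omega> L1_Linf_measurable i r B)
  have 3: "\<bar>conv (conv (conv r \<omega>) \<omega>) a x\<bar> \<le> B * ?w * ?w * ?a"
    by (intro abs_conv_le[OF a] L1_Linf_measurable i r 2)
  have "\<bar>conv (conv r \<omega>) \<omega> x - conv (conv (conv r \<omega>) \<omega>) a x\<bar> \<le> B * ?w * ?w * (1 + ?a)"
    using 2[of x] 3 by (simp add: distrib_left)
  then have "\<bar>potential r x\<bar> \<le> \<bar>c\<bar> * (B * ?w * ?w * (1 + ?a))"
    unfolding potential_def abs_mult by (intro mult_left_mono) auto
  then show ?thesis by (simp add: potential_norm_def mult_ac)
qed

lemma lipschitz_bounded_potential: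
  assumes r: "lipschitz_bounded B L r"
  shows "\<exists>B' L'. lipschitz_bounded B' L' (potential r)"
proof -
  obtain B1 L1 where 1: "lipschitz_bounded B1 L1 (conv (conv r \<omega>) \<omega>)"
    using lipschitz_bounded_conv[OF lipschitz_bounded_conv[OF r \<omega>] \<omega>] by blast
  obtain B2 L2 where 2: "lipschitz_bounded B2 L2 (conv (conv (conv r \<omega>) \<omega>) a)"
    using lipschitz_bounded_conv[OF 1 a] by blast
  let ?u = "conv (conv r \<omega>) \<omega>" and ?v = "conv (conv (conv r \<omega>) \<omega>) a"
  have *: "\<bar>?u x\<bar> \<le> B1" "\<bar>?v x\<bar> \<le> B2" "\<bar>?u x - ?u y\<bar> \<le> L1 * norm (x - y)"
    "\<bar>?v x - ?v y\<bar> \<le> L2 * norm (x - y)" "?u differentiable at x" "?v differentiable at x" for x y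
    using 1 2 unfolding lipschitz_bounded_def by blast+
  have "lipschitz_bounded (\<bar>c\<bar> * (B1 + B2)) (\<bar>c\<bar> * (L1 + L2)) (potential r)"
    unfolding lipschitz_bounded_def
  proof (intro conjI allI)
    show "\<bar>potential r x\<bar> \<le> \<bar>c\<bar> * (B1 + B2)" for x
      unfolding potential_def abs_mult
      by (intro mult_left_mono order_trans[OF abs_triangle_ineq4] add_mono *) auto
    show "\<bar>potential r x - potential r y\<bar> \<le> \<bar>c\<bar> * (L1 + L2) * norm (x - y)" for x y
    proof -
      have "potential r x - potential r y = c * ((?u x - ?u y) - (?v x - ?v y))"
        by (simp add: potential_def algebra_simps)
      moreover have "\<bar>(?u x - ?u y) - (?v x - ?v y)\<bar> \<le> (L1 + L2) * norm (x - y)"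
        using *(3,4)[of x y] by (simp add: distrib_right)
      ultimately show ?thesis by (simp add: abs_mult mult_left_mono mult.assoc)
    qed
    show "potential r differentiable at x" for x
      unfolding potential_def[abs_def]
      by (intro differentiable_mult differentiable_diff differentiable_const *)
  qed
  then show ?thesis by blast
qed

text \<open>By symmetry the increment of the quadratic form is the integral of
  \<open>r s - r t\<close> times the sum of the two potentials. Only the density is differentiated
  in time; for the potential continuity at \<open>t\<close> is enough, and this follows from
  linearity and \<open>abs_potential_le\<close>.\<close>

lemma has_real_derivative_interaction_energy:
  fixes r :: "real \<Rightarrow> 'a \<Rightarrow> real"
  assumes U: "open U" "t \<in> U"
    and r: "\<And>s. s \<in> U \<Longrightarrow> L1_Linf (r s)"
    and r': "\<And>x. ((\<lambda>s. r s x) has_real_derivative r' x) (at t)"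
    and lip: "\<And>s x. s \<in> U \<Longrightarrow> \<bar>r s x - r t x\<bar> \<le> W x * \<bar>s - t\<bar>"
    and W: "integrable lborel W" "\<And>x. W x \<le> B"
    and bd: "\<And>s x. s \<in> U \<Longrightarrow> \<bar>r s x\<bar> \<le> B"
  shows "((\<lambda>s. LINT x|lborel. potential (r s) x * r s x) has_real_derivative
      2 * (LINT x|lborel. potential (r t) x * r' x)) (at t)"
proof -
  let ?P = "\<lambda>s. potential (r s)"
  let ?g = "\<lambda>s x. (r s x - r t x) * (?P s x + ?P t x)"
  have expand: "(LINT x|lborel. ?P s x * r s x) = (LINT x|lborel. ?P t x * r t x) + (LINT x|lborel. ?g s x)"
    if s: "s \<in> U" for s
  proof -
    note rs = r[OF s] and rt = r[OF U(2)]
    note i = integrable_L1_Linf_mult[OF L1_Linf_potential[OF rs] rs] integrable_L1_Linf_mult[OF L1_Linf_potential[OF rt] rt]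
      integrable_L1_Linf_mult[OF L1_Linf_potential[OF rs] rt] integrable_L1_Linf_mult[OF L1_Linf_potential[OF rt] rs]
    have "(LINT x|lborel. ?g s x) = (LINT x|lborel. ?P s x * r s x - ?P s x * r t x + ?P t x * r s x - ?P t x * r t x)"
      by (simp add: algebra_simps)
    also have "\<dots> = (LINT x|lborel. ?P s x * r s x) - (LINT x|lborel. ?P s x * r t x)
        + (LINT x|lborel. ?P t x * r s x) - (LINT x|lborel. ?P t x * r t x)"
      using i by simp
    finally show ?thesis using integral_potential_commute[OF rs rt] by simp
  qed
  have Pdiff: "\<bar>?P s x - ?P t x\<bar> \<le> potential_norm * B * \<bar>s - t\<bar>" if s: "s \<in> U" for s x
  proof -
    have "\<bar>potential (\<lambda>x. r s x - r t x) x\<bar> \<le> potential_norm * (B * \<bar>s - t\<bar>)"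
      by (rule abs_potential_le[OF L1_Linf_diff[OF r[OF s] r[OF U(2)]]])
        (use lip[OF s] W(2) in \<open>meson abs_ge_zero mult_right_mono order_trans\<close>)
    then show ?thesis using potential_diff[OF r[OF s] r[OF U(2)]] by (simp add: mult.assoc)
  qed
  have Pbd: "\<bar>?P s x\<bar> \<le> potential_norm * B" if s: "s \<in> U" for s x
    by (rule abs_potential_le[OF r[OF s] bd[OF s]])
  have "((\<lambda>s. LINT x|lborel. ?g s x) has_derivative (\<lambda>h. LINT x|lborel. (r' x * (2 * ?P t x)) * h)) (at t)"
  proof (rule has_derivative_lebesgue_integral[OF U, where W="\<lambda>x. W x * (2 * (potential_norm * B))"])
    show "integrable lborel (?g s)" if "s \<in> U" for s
    proof -
      note rs = r[OF that] and rt = r[OF U(2)]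
      show ?thesis unfolding distrib_left
        by (intro Bochner_Integration.integrable_add integrable_L1_Linf_mult L1_Linf_diff L1_Linf_potential rs rt)
    qed
    show "integrable lborel (\<lambda>x. W x * (2 * (potential_norm * B)))" using W by simp
    show "\<bar>?g s x - ?g t x\<bar> \<le> W x * (2 * (potential_norm * B)) * norm (s - t)" if s: "s \<in> U" for s x
    proof -
      have "\<bar>r s x - r t x\<bar> * \<bar>?P s x + ?P t x\<bar> \<le> (W x * \<bar>s - t\<bar>) * (2 * (potential_norm * B))"
        using Pbd[OF s, of x] Pbd[OF U(2), of x] lip[OF s, of x]
        by (intro mult_mono) auto
      then show ?thesis by (simp add: abs_mult mult_ac)
    qed
    show "((\<lambda>s. ?g s x) has_derivative (*) (r' x * (2 * ?P t x))) (at t)" for x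
    proof -
      have lim0: "((\<lambda>s. potential_norm * B * \<bar>s - t\<bar>) \<longlongrightarrow> 0) (at t)"
        by (rule tendsto_eq_intros refl | simp)+
      have ev: "\<forall>\<^sub>F s in at t. norm (?P s x - ?P t x) \<le> potential_norm * B * \<bar>s - t\<bar>"
        unfolding eventually_at_topological using U Pdiff by auto
      have "((\<lambda>s. ?P s x - ?P t x) \<longlongrightarrow> 0) (at t)"
        by (rule Lim_null_comparison[OF ev lim0])
      then have "((\<lambda>s. ?P s x) \<longlongrightarrow> ?P t x) (at t)" by (simp add: LIM_zero_iff)
      then have "((\<lambda>s. (r s x - r t x) / (s - t) * (?P s x + ?P t x)) \<longlongrightarrow> r' x * (?P t x + ?P t x)) (at t)"
        using r'[of x] by (intro tendsto_mult tendsto_add tendsto_const) (simp_all add: has_field_derivative_iff)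
      then have "((\<lambda>s. ?g s x) has_field_derivative (r' x * (2 * ?P t x))) (at t)"
        by (simp add: has_field_derivative_iff)
      then show ?thesis by (simp add: has_field_derivative_def)
    qed
  qed
  moreover have "(\<lambda>h. LINT x|lborel. (r' x * (2 * ?P t x)) * h) = (*) (2 * (LINT x|lborel. ?P t x * r' x))"
    by (simp add: fun_eq_iff mult_ac flip: integral_mult_right_zero)
  ultimately have "((\<lambda>s. LINT x|lborel. ?g s x) has_real_derivative 2 * (LINT x|lborel. ?P t x * r' x)) (at t)"
    by (simp add: has_field_derivative_def)
  then have "((\<lambda>s. (LINT x|lborel. ?P t x * r t x) + (LINT x|lborel. ?g s x)) has_real_derivative
      2 * (LINT x|lborel. ?P t x * r' x)) (at t)"
    using DERIV_add[OF DERIV_const] by force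
  then show ?thesis
    by (rule has_field_derivative_transform_within_open[OF _ U]) (simp add: expand)
qed

end

section \<open>Polynomial decay in phase space\<close>

definition weight :: "'a::euclidean_space \<Rightarrow> 'a \<Rightarrow> real" where
  "weight x \<xi> = 1 + norm x + norm \<xi>"

lemma weight_ge: "1 \<le> weight x \<xi>" "norm x \<le> weight x \<xi>" "norm \<xi> \<le> weight x \<xi>" "0 < weight x \<xi>"
  by (auto simp: weight_def add_pos_nonneg)

lemma weight_simps[simp]: "0 < weight x \<xi>" "0 \<le> weight x \<xi>" "weight x \<xi> \<noteq> 0"
  using weight_ge(4)[of x \<xi>] by auto

text \<open>One constant serves all times in \<open>S\<close>, so that decay of a time derivative
  also dominates the difference quotients in time.\<close>

definition decays :: "real set \<Rightarrow> nat \<Rightarrow> (real \<Rightarrow> 'a::euclidean_space \<Rightarrow> 'a \<Rightarrow> real) \<Rightarrow> bool" where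
  "decays S k h \<longleftrightarrow> (\<exists>A\<ge>0. \<forall>s\<in>S. \<forall>x \<xi>. \<bar>h s x \<xi>\<bar> \<le> A / weight x \<xi> ^ k)"

lemma decaysI:
  fixes h :: "real \<Rightarrow> 'a::euclidean_space \<Rightarrow> 'a \<Rightarrow> real"
  assumes "\<And>s x \<xi>. s \<in> S \<Longrightarrow> \<bar>h s x \<xi>\<bar> \<le> A / weight x \<xi> ^ k"
  shows "decays S k h"
  unfolding decays_def
proof (intro exI conjI ballI allI)
  fix s x \<xi> assume "s \<in> S"
  then show "\<bar>h s x \<xi>\<bar> \<le> \<bar>A\<bar> / weight x \<xi> ^ k"
    by (intro order_trans[OF assms] divide_right_mono) auto
qed simp

lemma decays_add:
  assumes "decays S k g" "decays S k h"
  shows "decays S k (\<lambda>s x \<xi>. g s x \<xi> + h s x \<xi>)"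
proof -
  obtain A B where A: "\<And>s x \<xi>. s \<in> S \<Longrightarrow> \<bar>g s x \<xi>\<bar> \<le> A / weight x \<xi> ^ k"
    and B: "\<And>s x \<xi>. s \<in> S \<Longrightarrow> \<bar>h s x \<xi>\<bar> \<le> B / weight x \<xi> ^ k"
    using assms unfolding decays_def by metis
  show ?thesis
    by (rule decaysI[of _ _ "A + B"])
      (use A B in \<open>auto simp: add_divide_distrib intro!: order_trans[OF abs_triangle_ineq] add_mono\<close>)
qed

lemma decays_mult:
  assumes h: "decays S (k + j) h"
    and m: "\<And>s x \<xi>. s \<in> S \<Longrightarrow> \<bar>m s x \<xi>\<bar> \<le> M * weight x \<xi> ^ j"
  shows "decays S k (\<lambda>s x \<xi>. m s x \<xi> * h s x \<xi>)"
proof -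
  obtain A where A: "A \<ge> 0" "\<And>s x \<xi>. s \<in> S \<Longrightarrow> \<bar>h s x \<xi>\<bar> \<le> A / weight x \<xi> ^ (k + j)"
    using h by (auto simp: decays_def)
  show ?thesis
  proof (rule decaysI)
    fix s x \<xi> assume s: "s \<in> S"
    have "\<bar>m s x \<xi> * h s x \<xi>\<bar> \<le> (M * weight x \<xi> ^ j) * (A / weight x \<xi> ^ (k + j))"
      unfolding abs_mult using m[OF s, of x \<xi>] A(2)[OF s, of x \<xi>] by (intro mult_mono) auto
    also have "\<dots> = M * A / weight x \<xi> ^ k"
      using weight_ge(4)[of x \<xi>] by (simp add: power_add)
    finally show "\<bar>m s x \<xi> * h s x \<xi>\<bar> \<le> M * A / weight x \<xi> ^ k" .
  qed
qed

lemma decays_cmult: "decays S k h \<Longrightarrow> decays S k (\<lambda>s x \<xi>. c * h s x \<xi>)"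
  by (rule decays_mult[where j=0 and M="\<bar>c\<bar>"]) auto

lemma decays_mono:
  assumes "decays S k h" "j \<le> k"
  shows "decays S j h"
proof -
  have "decays S j (\<lambda>s x \<xi>. 1 * h s x \<xi>)"
    by (rule decays_mult[where j="k - j" and M=1]) (use assms weight_ge in \<open>auto intro!: one_le_power\<close>)
  then show ?thesis by simp
qed

text \<open>The weight dominates both 1 + |x| and 1 + |\<xi>|, so its power can be distributed over
  the two variables at will: enough in one to integrate it out, the rest kept as decay in the
  other.\<close>

lemma decays_sections:
  fixes h :: "real \<Rightarrow> 'a::euclidean_space \<Rightarrow> 'a \<Rightarrow> real"
  assumes "decays S (p + q) h"
  obtains A where "A \<ge> 0" "\<And>s x \<xi>. s \<in> S \<Longrightarrow> \<bar>h s x \<xi>\<bar> \<le> A * (1 / (1 + norm x) ^ p) * (1 / (1 + norm \<xi>) ^ q)"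
proof -
  obtain A where A: "A \<ge> 0" "\<And>s x \<xi>. s \<in> S \<Longrightarrow> \<bar>h s x \<xi>\<bar> \<le> A / weight x \<xi> ^ (p + q)"
    using assms by (auto simp: decays_def)
  show ?thesis
  proof (rule that[OF A(1)])
    fix s and x \<xi> :: 'a assume s: "s \<in> S"
    have pos: "0 < 1 + norm x" "0 < 1 + norm \<xi>" by (simp_all add: add_pos_nonneg)
    have "(1 + norm x) ^ p * (1 + norm \<xi>) ^ q \<le> weight x \<xi> ^ p * weight x \<xi> ^ q"
      using pos by (intro mult_mono power_mono) (auto simp: weight_def)
    then have "A / weight x \<xi> ^ (p + q) \<le> A / ((1 + norm x) ^ p * (1 + norm \<xi>) ^ q)"
      unfolding power_add using A(1) pos weight_ge(4)[of x \<xi>] by (intro divide_left_mono) auto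
    then show "\<bar>h s x \<xi>\<bar> \<le> A * (1 / (1 + norm x) ^ p) * (1 / (1 + norm \<xi>) ^ q)"
      using A(2)[OF s, of x \<xi>] by simp
  qed
qed

section \<open>Integrability on phase space and on its sections\<close>

lemma borel_measurable_fst_snd[measurable]:
  "fst \<in> borel_measurable (borel :: ('a::euclidean_space \<times> 'a) measure)"
  "snd \<in> borel_measurable (borel :: ('a::euclidean_space \<times> 'a) measure)"
  by (auto intro!: borel_measurable_continuous_onI continuous_intros)

text \<open>The weight is at least 1 + |(x, \<xi>)|, and the pair lives in dimension 2d.\<close>

lemma integrable_weight:
  assumes "2 * DIM('a) < k"
  shows "integrable lborel (\<lambda>(x, \<xi>). 1 / weight (x::'a::euclidean_space) \<xi> ^ k)"
proof (rule Bochner_Integration.integrable_bound)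
  show "integrable lborel (\<lambda>p::'a \<times> 'a. 1 / (1 + norm p) ^ k)"
    by (rule integrable_inverse_power_one_plus_norm) (use assms in simp)
  have [measurable]: "(\<lambda>p::'a\<times>'a. weight (fst p) (snd p)) \<in> borel_measurable borel"
    unfolding weight_def by measurable
  show "(\<lambda>(x, \<xi>). 1 / weight (x::'a) \<xi> ^ k) \<in> borel_measurable lborel"
    unfolding case_prod_unfold by measurable
  have "1 / weight x \<xi> ^ k \<le> 1 / (1 + norm (x, \<xi>)) ^ k" for x \<xi> :: 'a
    using norm_Pair_le[of x \<xi>] weight_ge(4)[of x \<xi>]
    by (intro divide_left_mono power_mono) (auto simp: weight_def add_pos_nonneg intro!: mult_pos_pos)
  then show "AE p in lborel. norm (case p of (x, \<xi>) \<Rightarrow> 1 / weight (x::'a) \<xi> ^ k) \<le> norm (1 / (1 + norm p) ^ k)"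
    by (intro AE_I2) (simp split: prod.splits)
qed

lemma decays_integrable:
  fixes h :: "real \<Rightarrow> 'a::euclidean_space \<Rightarrow> 'a \<Rightarrow> real"
  assumes h: "decays S k h" and k: "2 * DIM('a) < k" and s: "s \<in> S"
    and m: "(\<lambda>p. h s (fst p) (snd p)) \<in> borel_measurable borel"
  shows "integrable lborel (\<lambda>(x, \<xi>). h s x \<xi>)"
proof -
  obtain A where A: "A \<ge> 0" "\<And>s x \<xi>. s \<in> S \<Longrightarrow> \<bar>h s x \<xi>\<bar> \<le> A / weight x \<xi> ^ k"
    using h by (auto simp: decays_def)
  show ?thesis
  proof (rule Bochner_Integration.integrable_bound)
    show "integrable lborel (\<lambda>p. A * (case p of (x, \<xi>) \<Rightarrow> 1 / weight (x::'a) \<xi> ^ k))"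
      by (intro integrable_mult_right integrable_weight k)
    show "(\<lambda>(x, \<xi>). h s x \<xi>) \<in> borel_measurable lborel" unfolding case_prod_unfold using m by simp
    show "AE p in lborel. norm (case p of (x, \<xi>) \<Rightarrow> h s x \<xi>) \<le> norm (A * (case p of (x, \<xi>) \<Rightarrow> 1 / weight (x::'a) \<xi> ^ k))"
      using A(2)[OF s] A(1) by (intro AE_I2) (simp add: abs_mult split: prod.splits)
  qed
qed

lemma measurable_section:
  fixes h :: "'a::euclidean_space \<Rightarrow> 'a \<Rightarrow> real"
  assumes "(\<lambda>p. h (fst p) (snd p)) \<in> borel_measurable borel"
  shows "h x \<in> borel_measurable borel" "(\<lambda>x. h x \<xi>) \<in> borel_measurable borel"
  using borel_measurable_compose_continuous[OF assms, of "\<lambda>\<xi>. (x, \<xi>)"]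
    borel_measurable_compose_continuous[OF assms, of "\<lambda>x. (x, \<xi>)"]
  by (simp_all add: continuous_on_Pair continuous_on_const continuous_on_id)

lemma integrable_section:
  fixes h :: "real \<Rightarrow> 'a::euclidean_space \<Rightarrow> 'a \<Rightarrow> real"
  assumes h: "decays S k h" and k: "DIM('a) < k" and s: "s \<in> S"
    and m: "(\<lambda>p. h s (fst p) (snd p)) \<in> borel_measurable borel"
  shows "integrable lborel (h s x)" "integrable lborel (\<lambda>x. h s x \<xi>)"
proof -
  obtain A where A: "A \<ge> 0" "\<And>s x \<xi>. s \<in> S \<Longrightarrow> \<bar>h s x \<xi>\<bar> \<le> A * (1 / (1 + norm x) ^ 0) * (1 / (1 + norm \<xi>) ^ k)"
    using decays_sections[of S 0 k h] h by auto
  have i: "integrable lborel (\<lambda>y::'a. A * (1 / (1 + norm y) ^ k))"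
    by (intro integrable_mult_right integrable_inverse_power_one_plus_norm k)
  show "integrable lborel (h s x)"
    by (rule Bochner_Integration.integrable_bound[OF i])
      (use measurable_section[of "h s", OF m] order_trans[OF A(2)[OF s] abs_ge_self] in auto)
  obtain B where B: "B \<ge> 0" "\<And>s x \<xi>. s \<in> S \<Longrightarrow> \<bar>h s x \<xi>\<bar> \<le> B * (1 / (1 + norm x) ^ k) * (1 / (1 + norm \<xi>) ^ 0)"
    using decays_sections[of S k 0 h] h by auto
  have i: "integrable lborel (\<lambda>y::'a. B * (1 / (1 + norm y) ^ k))"
    by (intro integrable_mult_right integrable_inverse_power_one_plus_norm k)
  show "integrable lborel (\<lambda>x. h s x \<xi>)"
    by (rule Bochner_Integration.integrable_bound[OF i])
      (use measurable_section[of "h s", OF m] order_trans[OF B(2)[OF s] abs_ge_self] in auto)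
qed

lemma abs_inner_Basis_le_weight: "b \<in> Basis \<Longrightarrow> \<bar>\<xi> \<bullet> b\<bar> \<le> 1 * weight x \<xi> ^ 1"
  using Basis_le_norm[of b \<xi>] weight_ge(3)[of \<xi> x] by simp

lemma norm_power2_le_weight: "\<bar>(norm \<xi>)\<^sup>2\<bar> \<le> 1 * weight x \<xi> ^ 2"
  using weight_ge(3)[of \<xi> x] by (simp add: power_mono)

section \<open>Densities with finite free energy\<close>

lemma divide_one_plus_norm_power_le:
  assumes "0 \<le> A"
  shows "A / (1 + norm x) ^ n \<le> A"
proof -
  have "1 \<le> (1 + norm x) ^ n" by (rule one_le_power) simp
  then have "A / (1 + norm x) ^ n \<le> A / 1" by (intro divide_left_mono[OF _ assms] mult_pos_pos) linarith+
  then show ?thesis by simp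
qed

text \<open>\<open>ft\<close>, \<open>fx b\<close>, \<open>fv b\<close> are the partial derivatives of \<open>f\<close>. The clauses \<open>der_ln\<close>, \<open>dec_ln\<close> and
  \<open>zero\<close> are the consequences of nonnegativity and bounded second derivatives.\<close>

locale transport =
  fixes f ft :: "real \<Rightarrow> 'a::euclidean_space \<Rightarrow> 'a \<Rightarrow> real"
    and fx fv :: "'a \<Rightarrow> real \<Rightarrow> 'a \<Rightarrow> 'a \<Rightarrow> real"
    and S :: "real set"
  assumes S: "open S" "convex S"
    and nonneg: "\<And>s x \<xi>. s \<in> S \<Longrightarrow> 0 \<le> f s x \<xi>"
    and cont: "\<And>s. s \<in> S \<Longrightarrow> continuous_on UNIV (\<lambda>p. f s (fst p) (snd p))"
      "\<And>s. s \<in> S \<Longrightarrow> continuous_on UNIV (\<lambda>p. ft s (fst p) (snd p))"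
      "\<And>s b. s \<in> S \<Longrightarrow> b \<in> Basis \<Longrightarrow> continuous_on UNIV (\<lambda>p. fx b s (fst p) (snd p))"
      "\<And>s b. s \<in> S \<Longrightarrow> b \<in> Basis \<Longrightarrow> continuous_on UNIV (\<lambda>p. fv b s (fst p) (snd p))"
    and diff_x: "\<And>s x \<xi>. s \<in> S \<Longrightarrow> (\<lambda>x. f s x \<xi>) differentiable at x"
    and der: "\<And>s x \<xi>. s \<in> S \<Longrightarrow> ((\<lambda>s. f s x \<xi>) has_real_derivative ft s x \<xi>) (at s)"
      "\<And>s x \<xi> b. s \<in> S \<Longrightarrow> b \<in> Basis \<Longrightarrow> ((\<lambda>u. f s (x + u *\<^sub>R b) \<xi>) has_real_derivative fx b s x \<xi>) (at 0)"
      "\<And>s x \<xi> b. s \<in> S \<Longrightarrow> b \<in> Basis \<Longrightarrow> ((\<lambda>u. f s x (\<xi> + u *\<^sub>R b)) has_real_derivative fv b s x \<xi>) (at 0)"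
    and der_ln: "\<And>s x \<xi>. s \<in> S \<Longrightarrow> ((\<lambda>s. f s x \<xi> * ln (f s x \<xi>)) has_real_derivative
        (ln (f s x \<xi>) + 1) * ft s x \<xi>) (at s)"
      "\<And>s x \<xi> b. s \<in> S \<Longrightarrow> b \<in> Basis \<Longrightarrow> ((\<lambda>u. f s (x + u *\<^sub>R b) \<xi> * ln (f s (x + u *\<^sub>R b) \<xi>)) has_real_derivative
        (ln (f s x \<xi>) + 1) * fx b s x \<xi>) (at 0)"
      "\<And>s x \<xi> b. s \<in> S \<Longrightarrow> b \<in> Basis \<Longrightarrow> ((\<lambda>u. f s x (\<xi> + u *\<^sub>R b) * ln (f s x (\<xi> + u *\<^sub>R b))) has_real_derivative
        (ln (f s x \<xi>) + 1) * fv b s x \<xi>) (at 0)"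
    and dec: "decays S (2 * DIM('a) + 4) f" "decays S (2 * DIM('a) + 4) ft"
      "\<And>b. b \<in> Basis \<Longrightarrow> decays S (2 * DIM('a) + 4) (fx b)"
      "\<And>b. b \<in> Basis \<Longrightarrow> decays S (2 * DIM('a) + 4) (fv b)"
    and dec_ln: "decays S (2 * DIM('a) + 3) (\<lambda>s x \<xi>. f s x \<xi> * ln (f s x \<xi>))"
      "decays S (2 * DIM('a) + 3) (\<lambda>s x \<xi>. ft s x \<xi> * ln (f s x \<xi>))"
      "\<And>b. b \<in> Basis \<Longrightarrow> decays S (2 * DIM('a) + 3) (\<lambda>s x \<xi>. fx b s x \<xi> * ln (f s x \<xi>))"
      "\<And>b. b \<in> Basis \<Longrightarrow> decays S (2 * DIM('a) + 3) (\<lambda>s x \<xi>. fv b s x \<xi> * ln (f s x \<xi>))"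
    and zero: "\<And>s x \<xi>. s \<in> S \<Longrightarrow> f s x \<xi> = 0 \<Longrightarrow> ft s x \<xi> = 0"
      "\<And>s x \<xi> b. s \<in> S \<Longrightarrow> b \<in> Basis \<Longrightarrow> f s x \<xi> = 0 \<Longrightarrow> fx b s x \<xi> = 0"
      "\<And>s x \<xi> b. s \<in> S \<Longrightarrow> b \<in> Basis \<Longrightarrow> f s x \<xi> = 0 \<Longrightarrow> fv b s x \<xi> = 0"
begin

lemma measurable_density:
  assumes "s \<in> S"
  shows "(\<lambda>p. f s (fst p) (snd p)) \<in> borel_measurable borel"
    "(\<lambda>p. ft s (fst p) (snd p)) \<in> borel_measurable borel"
    "b \<in> Basis \<Longrightarrow> (\<lambda>p. fx b s (fst p) (snd p)) \<in> borel_measurable borel"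
    "b \<in> Basis \<Longrightarrow> (\<lambda>p. fv b s (fst p) (snd p)) \<in> borel_measurable borel"
  using assms cont by (auto intro!: borel_measurable_continuous_onI)

lemma integrable_density:
  assumes "s \<in> S"
  shows "integrable lborel (f s x)" "integrable lborel (ft s x)"
  using assms by (auto intro!: integrable_section[OF dec(1)] integrable_section[OF dec(2)] measurable_density)

text \<open>The exponent is split as 2d + 4 = (d + 3) + (d + 1): d + 1 is the least power that can
  be integrated in \<xi>, and d + 3 remains for \<rho>, its time increments and its entropy.\<close>

lemma rho_bounds:
  obtains A where "A \<ge> 0"
    "\<And>s x. s \<in> S \<Longrightarrow> \<bar>rho f s x\<bar> \<le> A / (1 + norm x) ^ (DIM('a) + 3)"
    "\<And>s t x. s \<in> S \<Longrightarrow> t \<in> S \<Longrightarrow> \<bar>rho f s x - rho f t x\<bar> \<le> A / (1 + norm x) ^ (DIM('a) + 3) * \<bar>s - t\<bar>"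
    "\<And>t x. t \<in> S \<Longrightarrow> ((\<lambda>s. rho f s x) has_real_derivative (LINT \<xi>|lborel. ft t x \<xi>)) (at t)"
proof -
  let ?n = "DIM('a) + 3" and ?m = "DIM('a) + 1"
  have eq: "?n + ?m = 2 * DIM('a) + 4" by simp
  obtain A1 where A1: "A1 \<ge> 0" "\<And>s x \<xi>. s \<in> S \<Longrightarrow> \<bar>f s x \<xi>\<bar> \<le> A1 * (1 / (1 + norm x) ^ ?n) * (1 / (1 + norm \<xi>) ^ ?m)"
    using decays_sections[of S ?n ?m f] dec(1) unfolding eq by metis
  obtain A2 where A2: "A2 \<ge> 0" "\<And>s x \<xi>. s \<in> S \<Longrightarrow> \<bar>ft s x \<xi>\<bar> \<le> A2 * (1 / (1 + norm x) ^ ?n) * (1 / (1 + norm \<xi>) ^ ?m)"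
    using decays_sections[of S ?n ?m ft] dec(2) unfolding eq by metis
  define J where "J = (LINT \<xi>::'a|lborel. 1 / (1 + norm \<xi>) ^ ?m)"
  have J: "J \<ge> 0" unfolding J_def by (intro Bochner_Integration.integral_nonneg) auto
  have Ji: "integrable lborel (\<lambda>\<xi>::'a. c * (1 / (1 + norm \<xi>) ^ ?m))" for c
    by (intro integrable_mult_right integrable_inverse_power_one_plus_norm) simp
  have lip: "\<bar>f s x \<xi> - f t x \<xi>\<bar> \<le> A2 * (1 / (1 + norm x) ^ ?n) * (1 / (1 + norm \<xi>) ^ ?m) * norm (s - t)"
    if "s \<in> S" "t \<in> S" for s t x \<xi>
  proof -
    have "norm (f s x \<xi> - f t x \<xi>) \<le> A2 * (1 / (1 + norm x) ^ ?n) * (1 / (1 + norm \<xi>) ^ ?m) * norm (s - t)"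
      by (rule field_differentiable_bound[OF S(2), of "\<lambda>s. f s x \<xi>" "\<lambda>s. ft s x \<xi>"])
        (use that A2(2) in \<open>auto intro!: has_field_derivative_at_within[OF der(1)]\<close>)
    then show ?thesis by simp
  qed
  have d: "((\<lambda>s. rho f s x) has_real_derivative (LINT \<xi>|lborel. ft t x \<xi>)) (at t)" if t: "t \<in> S" for t x
  proof -
    have "((\<lambda>s. LINT \<xi>|lborel. f s x \<xi>) has_derivative (\<lambda>h. LINT \<xi>|lborel. ft t x \<xi> * h)) (at t)"
    proof (rule has_derivative_lebesgue_integral[OF S(1) t])
      show "integrable lborel (\<lambda>\<xi>::'a. A2 * (1 / (1 + norm x) ^ ?n) * (1 / (1 + norm \<xi>) ^ ?m))"
        by (rule Ji)
      show "\<bar>f s x \<xi> - f t x \<xi>\<bar> \<le> A2 * (1 / (1 + norm x) ^ ?n) * (1 / (1 + norm \<xi>) ^ ?m) * norm (s - t)"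
        if "s \<in> S" for s \<xi> by (rule lip[OF that t])
    qed (use t integrable_density der(1) in \<open>auto simp: has_field_derivative_def\<close>)
    moreover have "(\<lambda>h. LINT \<xi>|lborel. ft t x \<xi> * h) = (*) (LINT \<xi>|lborel. ft t x \<xi>)"
      by (simp add: fun_eq_iff)
    ultimately show ?thesis by (simp add: has_field_derivative_def rho_def)
  qed
  have b1: "\<bar>rho f s x\<bar> \<le> (A1 * J) / (1 + norm x) ^ ?n" if s: "s \<in> S" for s x
  proof -
    have "norm (rho f s x) \<le> (LINT \<xi>|lborel. norm (f s x \<xi>))" unfolding rho_def by (rule integral_norm_bound)
    also have "\<dots> \<le> (LINT \<xi>::'a|lborel. A1 * (1 / (1 + norm x) ^ ?n) * (1 / (1 + norm \<xi>) ^ ?m))"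
    proof (rule Bochner_Integration.integral_mono)
      show "integrable lborel (\<lambda>\<xi>. norm (f s x \<xi>))" by (intro integrable_norm integrable_density s)
      show "norm (f s x \<xi>) \<le> A1 * (1 / (1 + norm x) ^ ?n) * (1 / (1 + norm \<xi>) ^ ?m)" for \<xi>
        unfolding real_norm_def by (rule A1(2)[OF s])
    qed (rule Ji)
    also have "\<dots> = A1 * (1 / (1 + norm x) ^ ?n) * J" unfolding J_def by (rule integral_mult_right_zero)
    finally show ?thesis by simp
  qed
  have b2: "\<bar>rho f s x - rho f t x\<bar> \<le> (A2 * J) / (1 + norm x) ^ ?n * \<bar>s - t\<bar>" if s: "s \<in> S" "t \<in> S" for s t x
  proof -
    have "rho f s x - rho f t x = (LINT \<xi>|lborel. f s x \<xi> - f t x \<xi>)"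
      unfolding rho_def using integrable_density s by simp
    also have "norm \<dots> \<le> (LINT \<xi>|lborel. norm (f s x \<xi> - f t x \<xi>))" by (rule integral_norm_bound)
    also have "\<dots> \<le> (LINT \<xi>::'a|lborel. (A2 * (1 / (1 + norm x) ^ ?n) * norm (s - t)) * (1 / (1 + norm \<xi>) ^ ?m))"
    proof (rule Bochner_Integration.integral_mono)
      show "integrable lborel (\<lambda>\<xi>. norm (f s x \<xi> - f t x \<xi>))"
        by (intro integrable_norm Bochner_Integration.integrable_diff integrable_density s)
      show "norm (f s x \<xi> - f t x \<xi>) \<le> (A2 * (1 / (1 + norm x) ^ ?n) * norm (s - t)) * (1 / (1 + norm \<xi>) ^ ?m)" for \<xi>
        using lip[OF s, of x \<xi>] by (simp only: real_norm_def mult_ac)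
    qed (rule Ji)
    also have "\<dots> = (A2 * (1 / (1 + norm x) ^ ?n) * norm (s - t)) * J" unfolding J_def by (rule integral_mult_right_zero)
    finally show ?thesis by (simp add: mult_ac)
  qed
  have mono: "A / (1 + norm x) ^ ?n \<le> (A1 * J + A2 * J) / (1 + norm x) ^ ?n"
    if "A = A1 * J \<or> A = A2 * J" for A and x :: 'a
    by (intro divide_right_mono) (use that A1(1) A2(1) J in auto)
  show ?thesis
  proof (rule that[of "A1 * J + A2 * J"])
    show "0 \<le> A1 * J + A2 * J" using A1(1) A2(1) J by simp
    show "\<bar>rho f s x\<bar> \<le> (A1 * J + A2 * J) / (1 + norm x) ^ ?n" if "s \<in> S" for s x
      using b1[OF that, of x] mono[of "A1 * J" x] by simp
    show "\<bar>rho f s x - rho f t x\<bar> \<le> (A1 * J + A2 * J) / (1 + norm x) ^ ?n * \<bar>s - t\<bar>"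
      if "s \<in> S" "t \<in> S" for s t x
      using b2[OF that, of x] mult_right_mono[OF mono[of "A2 * J" x], of "\<bar>s - t\<bar>"] by simp
  qed (rule d)
qed

lemma borel_measurable_rho:
  assumes "s \<in> S"
  shows "rho f s \<in> borel_measurable borel"
proof -
  have "integrable lborel (\<lambda>(x, \<xi>). f s x \<xi>)"
    by (rule decays_integrable[OF dec(1) _ assms measurable_density(1)[OF assms]]) simp
  from lborel_integrable_fst[OF this] show ?thesis
    unfolding rho_def[abs_def] using borel_measurable_integrable by simp
qed

lemma rho_nonneg: "s \<in> S \<Longrightarrow> 0 \<le> rho f s x"
  unfolding rho_def by (intro Bochner_Integration.integral_nonneg) (auto simp: nonneg)

lemma L1_Linf_rho:
  assumes "s \<in> S"
  shows "L1_Linf (rho f s)"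
proof -
  obtain A where A: "A \<ge> 0" "\<And>s x. s \<in> S \<Longrightarrow> \<bar>rho f s x\<bar> \<le> A / (1 + norm x) ^ (DIM('a) + 3)"
    by (rule rho_bounds) (rule that)
  show ?thesis
  proof (rule L1_LinfI[of _ A])
    have "integrable lborel (\<lambda>x::'a. A * (1 / (1 + norm x) ^ (DIM('a) + 3)))"
      by (intro integrable_mult_right integrable_inverse_power_one_plus_norm) simp
    then show "integrable lborel (rho f s)"
      by (rule Bochner_Integration.integrable_bound)
       (use A borel_measurable_rho[OF assms] order_trans[OF A(2)[OF assms] abs_ge_self] in auto)
    show "\<bar>rho f s x\<bar> \<le> A" for x
      using A(2)[OF assms, of x] divide_one_plus_norm_power_le[OF A(1)] by (rule order_trans)
  qed
qed

text \<open>Summing the bounds of the partial derivatives bounds the x-gradient of \<open>f\<close>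
  by an integrable function of \<xi> alone, which dominates the differentiation under the integral.
  Total differentiability comes from \<open>diff_x\<close>; derivatives along the axes would not
  imply it.\<close>

lemma lipschitz_bounded_rho:
  assumes s: "s \<in> S"
  shows "\<exists>B L. lipschitz_bounded B L (rho f s)"
proof -
  let ?m = "DIM('a) + 1"
  have "\<exists>A. A \<ge> 0 \<and> (\<forall>x \<xi>. \<bar>fx b s x \<xi>\<bar> \<le> A * (1 / (1 + norm \<xi>) ^ ?m))" if b: "b \<in> Basis" for b
  proof -
    have "decays S (0 + ?m) (fx b)" by (rule decays_mono[OF dec(3)[OF b]]) simp
    then show ?thesis using s by (elim decays_sections) auto
  qed
  then obtain A where A: "\<And>b. b \<in> Basis \<Longrightarrow> A b \<ge> 0"
    "\<And>b x \<xi>. b \<in> Basis \<Longrightarrow> \<bar>fx b s x \<xi>\<bar> \<le> A b * (1 / (1 + norm \<xi>) ^ ?m)"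
    by metis
  define L where "L = (\<Sum>b\<in>Basis. A b)"
  have fr: "((\<lambda>x. f s x \<xi>) has_derivative frechet_derivative (\<lambda>x. f s x \<xi>) (at x)) (at x)" for x \<xi>
    using diff_x[OF s] by (simp flip: frechet_derivative_works)
  have frb: "frechet_derivative (\<lambda>x. f s x \<xi>) (at x) b = fx b s x \<xi>" if b: "b \<in> Basis" for b x \<xi>
  proof -
    have "((\<lambda>u. f s (x + u *\<^sub>R b) \<xi>) has_derivative (\<lambda>u. frechet_derivative (\<lambda>x. f s x \<xi>) (at x) (u *\<^sub>R b))) (at 0)"
      by (rule has_derivative_compose[where f="\<lambda>u. x + u *\<^sub>R b" and f'="\<lambda>u. u *\<^sub>R b" and g="\<lambda>x. f s x \<xi>"])
        (use fr in \<open>auto intro!: derivative_eq_intros\<close>)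
    moreover have "((\<lambda>u. f s (x + u *\<^sub>R b) \<xi>) has_derivative (*) (fx b s x \<xi>)) (at 0)"
      using der(2)[OF s b] by (simp add: has_field_derivative_def)
    ultimately have "(\<lambda>u. frechet_derivative (\<lambda>x. f s x \<xi>) (at x) (u *\<^sub>R b)) = (*) (fx b s x \<xi>)"
      by (rule has_derivative_unique)
    from fun_cong[OF this, of 1] show ?thesis by simp
  qed
  have lip: "\<bar>f s x \<xi> - f s y \<xi>\<bar> \<le> L * (1 / (1 + norm \<xi>) ^ ?m) * norm (x - y)" for x y \<xi>
  proof -
    have "norm (f s x \<xi> - f s y \<xi>) \<le> L * (1 / (1 + norm \<xi>) ^ ?m) * norm (x - y)"
    proof (rule differentiable_bound[of UNIV])
      fix z
      show "((\<lambda>x. f s x \<xi>) has_derivative frechet_derivative (\<lambda>x. f s x \<xi>) (at z)) (at z within UNIV)"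
        using fr by simp
      show "onorm (frechet_derivative (\<lambda>x. f s x \<xi>) (at z)) \<le> L * (1 / (1 + norm \<xi>) ^ ?m)"
      proof (rule onorm_le)
        fix h
        have lin: "linear (frechet_derivative (\<lambda>x. f s x \<xi>) (at z))" using fr has_derivative_linear by blast
        have "frechet_derivative (\<lambda>x. f s x \<xi>) (at z) h = frechet_derivative (\<lambda>x. f s x \<xi>) (at z) (\<Sum>b\<in>Basis. (h \<bullet> b) *\<^sub>R b)"
          by (simp add: euclidean_representation)
        also have "\<dots> = (\<Sum>b\<in>Basis. (h \<bullet> b) * fx b s z \<xi>)"
          by (simp add: linear_sum[OF lin] linear_scale[OF lin] frb)
        also have "norm \<dots> \<le> (\<Sum>b\<in>Basis. norm h * (A b * (1 / (1 + norm \<xi>) ^ ?m)))"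
        proof (rule sum_norm_le)
          fix b :: 'a assume b: "b \<in> Basis"
          show "norm ((h \<bullet> b) * fx b s z \<xi>) \<le> norm h * (A b * (1 / (1 + norm \<xi>) ^ ?m))"
            unfolding real_norm_def abs_mult using b by (intro mult_mono A(2) Basis_le_norm) auto
        qed
        also have "\<dots> = L * (1 / (1 + norm \<xi>) ^ ?m) * norm h"
          unfolding L_def sum_distrib_right by (rule sum.cong) (simp_all add: mult_ac)
        finally show "norm (frechet_derivative (\<lambda>x. f s x \<xi>) (at z) h) \<le> L * (1 / (1 + norm \<xi>) ^ ?m) * norm h" .
      qed
    qed auto
    then show ?thesis by simp
  qed
  define J where "J = (LINT \<xi>::'a|lborel. 1 / (1 + norm \<xi>) ^ ?m)"
  have Ji: "integrable lborel (\<lambda>\<xi>::'a. c * (1 / (1 + norm \<xi>) ^ ?m))" for c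
    by (intro integrable_mult_right integrable_inverse_power_one_plus_norm) simp
  have "rho f s differentiable at x" for x
  proof -
    have "((\<lambda>x. LINT \<xi>|lborel. f s x \<xi>) has_derivative (\<lambda>h. LINT \<xi>|lborel. frechet_derivative (\<lambda>x. f s x \<xi>) (at x) h)) (at x)"
    proof (rule has_derivative_lebesgue_integral[OF open_UNIV])
      show "integrable lborel (\<lambda>\<xi>::'a. L * (1 / (1 + norm \<xi>) ^ ?m))" by (rule Ji)
      show "\<bar>f s y \<xi> - f s x \<xi>\<bar> \<le> L * (1 / (1 + norm \<xi>) ^ ?m) * norm (y - x)" for y \<xi> by (rule lip)
    qed (use fr integrable_density[OF s] in auto)
    then show ?thesis unfolding rho_def[abs_def] differentiable_def by blast
  qed
  moreover have "\<bar>rho f s x - rho f s y\<bar> \<le> L * J * norm (x - y)" for x y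
  proof -
    have "rho f s x - rho f s y = (LINT \<xi>|lborel. f s x \<xi> - f s y \<xi>)"
      unfolding rho_def using integrable_density s by simp
    also have "norm \<dots> \<le> (LINT \<xi>|lborel. norm (f s x \<xi> - f s y \<xi>))" by (rule integral_norm_bound)
    also have "\<dots> \<le> (LINT \<xi>::'a|lborel. (L * norm (x - y)) * (1 / (1 + norm \<xi>) ^ ?m))"
    proof (rule Bochner_Integration.integral_mono)
      show "integrable lborel (\<lambda>\<xi>. norm (f s x \<xi> - f s y \<xi>))"
        by (intro integrable_norm Bochner_Integration.integrable_diff integrable_density s)
      show "norm (f s x \<xi> - f s y \<xi>) \<le> (L * norm (x - y)) * (1 / (1 + norm \<xi>) ^ ?m)" for \<xi>
        using lip[of x \<xi> y] by (simp only: real_norm_def mult_ac)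
    qed (rule Ji)
    also have "\<dots> = (L * norm (x - y)) * J" unfolding J_def by (rule integral_mult_right_zero)
    finally show ?thesis by (simp add: mult_ac)
  qed
  moreover obtain B where "\<And>x. \<bar>rho f s x\<bar> \<le> B" using L1_Linf_rho[OF s] by (auto simp: L1_Linf_def)
  ultimately show ?thesis unfolding lipschitz_bounded_def by blast
qed

text \<open>A nonnegative function with integral zero vanishes almost everywhere; by continuity the
  set where it does not vanish is open, and an open null set is empty.\<close>

lemma rho_eq_0:
  assumes s: "s \<in> S" and r: "rho f s x = 0"
  shows "f s x \<xi> = 0"
proof -
  have "AE \<xi> in lborel. f s x \<xi> = 0"
    using r integrable_density(1)[OF s] unfolding rho_def
    by (subst (asm) integral_nonneg_eq_0_iff_AE) (auto simp: nonneg[OF s])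
  then have ae: "AE \<xi> in lborel. \<xi> \<notin> {\<xi>. f s x \<xi> \<noteq> 0}" by simp
  have c: "continuous_on UNIV (f s x)"
  proof -
    have "continuous_on UNIV (\<lambda>\<xi>. (x, \<xi>))" by (intro continuous_intros)
    from continuous_on_compose2[OF cont(1)[OF s] this] show ?thesis by simp
  qed
  have op: "open {\<xi>. f s x \<xi> \<noteq> 0}"
    by (rule open_Collect_neq[OF c continuous_on_const])
  have "{\<xi>. f s x \<xi> \<noteq> 0} \<in> null_sets lborel"
    by (rule AE_iff_null_sets[THEN iffD2, OF _ ae]) (simp only: sets_lborel borel_open[OF op])
  then have "negligible {\<xi>. f s x \<xi> \<noteq> 0}"
    unfolding negligible_iff_null_sets by (rule null_sets_completionI)
  then have "{\<xi>. f s x \<xi> \<noteq> 0} = {}" using open_not_negligible[OF op] by metis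
  then show ?thesis by auto
qed

text \<open>This is \<open>abs_mult_ln_decay\<close> with \<open>p\<close> and \<open>y\<close> both
  equal to \<rho>, where the square-root hypothesis is mere boundedness. One power is lost, and the
  remaining d + 2 still exceeds d.\<close>

lemma integrable_rho_ln_rho:
  assumes s: "s \<in> S"
  shows "integrable lborel (\<lambda>x. rho f s x * ln (rho f s x))"
proof -
  have [measurable]: "rho f s \<in> borel_measurable borel" by (rule borel_measurable_rho[OF s])
  obtain A where A: "A \<ge> 0" "\<And>s x. s \<in> S \<Longrightarrow> \<bar>rho f s x\<bar> \<le> A / (1 + norm x) ^ (DIM('a) + 3)"
    by (rule rho_bounds) (rule that)
  define B where "B = A * A + 4 * sqrt A + 4 * real (DIM('a) + 2) * A"
  have le: "\<bar>rho f s x * ln (rho f s x)\<bar> \<le> B * (1 / (1 + norm x) ^ (DIM('a) + 2))" for x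
  proof -
    have rA: "rho f s x \<le> A"
      using A(2)[OF s, of x] divide_one_plus_norm_power_le[OF A(1), of x "DIM('a) + 3"] by linarith
    have "rho f s x = sqrt (rho f s x) * sqrt (rho f s x)" using rho_nonneg[OF s] by simp
    also have "\<dots> \<le> sqrt A * sqrt (rho f s x)"
      using rA rho_nonneg[OF s] by (intro mult_right_mono real_sqrt_le_mono) auto
    finally have "\<bar>rho f s x\<bar> \<le> sqrt A * sqrt (rho f s x)" using rho_nonneg[OF s] by simp
    from abs_mult_ln_decay[OF _ rho_nonneg[OF s] rA A(1) _ _ A(2)[OF s] this]
    show ?thesis using A(1) by (simp add: B_def)
  qed
  show ?thesis
  proof (rule Bochner_Integration.integrable_bound)
    show "integrable lborel (\<lambda>x::'a. B * (1 / (1 + norm x) ^ (DIM('a) + 2)))"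
      by (intro integrable_mult_right integrable_inverse_power_one_plus_norm) simp
  qed (use order_trans[OF le abs_ge_self] in auto)
qed

lemma
  assumes t: "t \<in> S"
  shows integrable_kinetic_density: "integrable lborel (\<lambda>(x, \<xi>). kinetic_density D f t x \<xi>)"
    and integrable_kinetic_rate: "integrable lborel (\<lambda>(x, \<xi>). (2 * D * (ln (f t x \<xi>) + 1) + (norm \<xi>)\<^sup>2) * ft t x \<xi>)"
    and has_real_derivative_kinetic_energy:
      "((\<lambda>s. LINT (x, \<xi>)|lborel. kinetic_density D f s x \<xi>) has_real_derivative
        (LINT (x, \<xi>)|lborel. (2 * D * (ln (f t x \<xi>) + 1) + (norm \<xi>)\<^sup>2) * ft t x \<xi>)) (at t)"
proof -
  \<comment> \<open>|\<xi>|^2 costs two of the 2d + 4 powers and the logarithm one, so 2d + 2 serves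
    all terms. The bound for \<open>?K\<close> is uniform in time and hence also gives the Lipschitz
    bound needed to differentiate under the integral.\<close>
  let ?N = "2 * DIM('a) + 2"
  let ?K = "\<lambda>s x \<xi>. (2 * D * (ln (f s x \<xi>) + 1) + (norm \<xi>)\<^sup>2) * ft s x \<xi>"
  have "?N + 2 = 2 * DIM('a) + 4" by simp
  with dec(1,2) have dec': "decays S (?N + 2) f" "decays S (?N + 2) ft" by (simp_all only:)
  have k: "decays S ?N (kinetic_density D f)"
  proof -
    have "decays S ?N (\<lambda>s x \<xi>. (2 * D) * (f s x \<xi> * ln (f s x \<xi>)) + (norm \<xi>)\<^sup>2 * f s x \<xi>)"
      by (rule decays_add[OF decays_cmult[OF decays_mono[OF dec_ln(1)]] decays_mult[OF dec'(1) norm_power2_le_weight]])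
        simp
    then show ?thesis by (simp add: kinetic_density_def[abs_def] algebra_simps)
  qed
  have K: "decays S ?N ?K"
  proof -
    have "decays S ?N (\<lambda>s x \<xi>. ((2 * D) * (ft s x \<xi> * ln (f s x \<xi>)) + (2 * D) * ft s x \<xi>) + (norm \<xi>)\<^sup>2 * ft s x \<xi>)"
      by (rule decays_add[OF decays_add[OF decays_cmult[OF decays_mono[OF dec_ln(2)]] decays_cmult[OF decays_mono[OF dec(2)]]]
            decays_mult[OF dec'(2) norm_power2_le_weight]]) simp_all
    then show ?thesis by (simp add: algebra_simps)
  qed
  have mk: "(\<lambda>p. kinetic_density D f s (fst p) (snd p)) \<in> borel_measurable borel"
    "(\<lambda>p. ?K s (fst p) (snd p)) \<in> borel_measurable borel" if s: "s \<in> S" for s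
    using measurable_density(1,2)[OF s] unfolding kinetic_density_def by measurable
  have ik: "integrable lborel (\<lambda>(x, \<xi>). kinetic_density D f s x \<xi>)"
    "integrable lborel (\<lambda>(x, \<xi>). ?K s x \<xi>)" if s: "s \<in> S" for s
    using decays_integrable[OF k _ s mk(1)[OF s]] decays_integrable[OF K _ s mk(2)[OF s]] by auto
  show "integrable lborel (\<lambda>(x, \<xi>). kinetic_density D f t x \<xi>)" "integrable lborel (\<lambda>(x, \<xi>). ?K t x \<xi>)"
    using ik t by auto
  obtain A where A: "A \<ge> 0" "\<And>s x \<xi>. s \<in> S \<Longrightarrow> \<bar>?K s x \<xi>\<bar> \<le> A / weight x \<xi> ^ ?N"
    using K by (auto simp: decays_def)
  have der: "((\<lambda>s. kinetic_density D f s x \<xi>) has_real_derivative ?K s x \<xi>) (at s)" if "s \<in> S" for s x \<xi>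
  proof -
    have "((\<lambda>s. (2 * D) * (f s x \<xi> * ln (f s x \<xi>)) + (norm \<xi>)\<^sup>2 * f s x \<xi>) has_real_derivative
        (2 * D) * ((ln (f s x \<xi>) + 1) * ft s x \<xi>) + (norm \<xi>)\<^sup>2 * ft s x \<xi>) (at s)"
      by (intro DERIV_add DERIV_cmult der_ln(1) der(1) that)
    then show ?thesis by (simp add: kinetic_density_def algebra_simps)
  qed
  have lip: "\<bar>kinetic_density D f s x \<xi> - kinetic_density D f t x \<xi>\<bar> \<le> A * (1 / weight x \<xi> ^ ?N) * norm (s - t)"
    if "s \<in> S" for s x \<xi>
  proof -
    have "norm (kinetic_density D f s x \<xi> - kinetic_density D f t x \<xi>) \<le> A * (1 / weight x \<xi> ^ ?N) * norm (s - t)"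
      by (rule field_differentiable_bound[OF S(2), of _ "\<lambda>s. ?K s x \<xi>"])
        (use that t A(2) in \<open>auto intro!: has_field_derivative_at_within[OF der]\<close>)
    then show ?thesis by simp
  qed
  have "((\<lambda>s. LINT p|lborel. (case p of (x, \<xi>) \<Rightarrow> kinetic_density D f s x \<xi>)) has_derivative
      (\<lambda>h. LINT p|lborel. (case p of (x, \<xi>) \<Rightarrow> ?K t x \<xi>) * h)) (at t)"
  proof (rule has_derivative_lebesgue_integral[OF S(1) t, where W="\<lambda>p. A * (case p of (x, \<xi>) \<Rightarrow> 1 / weight (x::'a) \<xi> ^ ?N)"])
    show "integrable lborel (\<lambda>p. A * (case p of (x, \<xi>) \<Rightarrow> 1 / weight (x::'a) \<xi> ^ ?N))"
      by (intro integrable_mult_right integrable_weight) simp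
  qed (use ik lip der[OF t] in \<open>auto simp: has_field_derivative_def\<close>)
  moreover have "(\<lambda>h. LINT p|lborel. (case p of (x, \<xi>) \<Rightarrow> ?K t x \<xi>) * h) = (*) (LINT (x, \<xi>)|lborel. ?K t x \<xi>)"
    by (simp add: fun_eq_iff)
  ultimately show "((\<lambda>s. LINT (x, \<xi>)|lborel. kinetic_density D f s x \<xi>) has_real_derivative
        (LINT (x, \<xi>)|lborel. ?K t x \<xi>)) (at t)"
    by (simp add: has_field_derivative_def)
qed

end

section \<open>The entropy balance\<close>

context transport
begin

text \<open>\<Phi> carries no time index: the balance is evaluated at a single time, and \<Phi> is
  the potential of the density at that time.\<close>

definition multiplier :: "real \<Rightarrow> ('a \<Rightarrow> real) \<Rightarrow> real \<Rightarrow> 'a \<Rightarrow> 'a \<Rightarrow> real" where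
  "multiplier D \<Phi> s x \<xi> = 2 * D * (ln (f s x \<xi>) + 1) + (norm \<xi>)\<^sup>2 + 2 * \<Phi> x"

text \<open>The logarithmic part of the multiplier meets \<open>h\<close> through the second decay
  hypothesis and costs one power; the polynomial part is bounded by the squared weight and costs
  two.\<close>

lemma decays_multiplier:
  assumes \<Phi>: "lipschitz_bounded B L \<Phi>"
    and h: "decays S (2 * DIM('a) + 4) h" "decays S (2 * DIM('a) + 3) (\<lambda>s x \<xi>. h s x \<xi> * ln (f s x \<xi>))"
  shows "decays S (2 * DIM('a) + 2) (\<lambda>s x \<xi>. multiplier D \<Phi> s x \<xi> * h s x \<xi>)"
proof -
  let ?N = "2 * DIM('a) + 2"
  have "?N + 2 = 2 * DIM('a) + 4" by simp
  with h(1) have h': "decays S (?N + 2) h" by (simp only:)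
  have B: "\<bar>\<Phi> x\<bar> \<le> B" for x using \<Phi> by (auto simp: lipschitz_bounded_def)
  have "\<bar>2 * D + (norm \<xi>)\<^sup>2 + 2 * \<Phi> x\<bar> \<le> (2 * \<bar>D\<bar> + 1 + 2 * B) * weight x \<xi> ^ 2" for x \<xi>
  proof -
    have w: "1 \<le> weight x \<xi> ^ 2" by (rule one_le_power) (rule weight_ge)
    have "\<bar>2 * D + (norm \<xi>)\<^sup>2 + 2 * \<Phi> x\<bar> \<le> (2 * \<bar>D\<bar> + 2 * B) + (norm \<xi>)\<^sup>2"
      using B[of x] by (simp add: abs_if split: if_splits) (smt (verit) zero_le_power2)+
    also have "\<dots> \<le> (2 * \<bar>D\<bar> + 2 * B) * weight x \<xi> ^ 2 + 1 * weight x \<xi> ^ 2"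
    proof (rule add_mono)
      have "0 \<le> 2 * \<bar>D\<bar> + 2 * B" using B[of x] by linarith
      from mult_left_mono[OF w this] show "2 * \<bar>D\<bar> + 2 * B \<le> (2 * \<bar>D\<bar> + 2 * B) * weight x \<xi> ^ 2" by simp
      show "(norm \<xi>)\<^sup>2 \<le> 1 * weight x \<xi> ^ 2" using norm_power2_le_weight[of \<xi> x] by simp
    qed
    finally show ?thesis by (simp add: algebra_simps)
  qed
  then have "decays S ?N (\<lambda>s x \<xi>. (2 * D + (norm \<xi>)\<^sup>2 + 2 * \<Phi> x) * h s x \<xi>)"
    by (rule decays_mult[OF h'])
  then have "decays S ?N (\<lambda>s x \<xi>. (2 * D) * (h s x \<xi> * ln (f s x \<xi>)) + (2 * D + (norm \<xi>)\<^sup>2 + 2 * \<Phi> x) * h s x \<xi>)"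
    by (intro decays_add decays_cmult decays_mono[OF h(2)]) simp
  moreover have "(\<lambda>s x \<xi>. multiplier D \<Phi> s x \<xi> * h s x \<xi>)
    = (\<lambda>s x \<xi>. (2 * D) * (h s x \<xi> * ln (f s x \<xi>)) + (2 * D + (norm \<xi>)\<^sup>2 + 2 * \<Phi> x) * h s x \<xi>)"
    by (simp add: fun_eq_iff multiplier_def algebra_simps)
  ultimately show ?thesis by simp
qed

lemma measurable_multiplier:
  assumes \<Phi>: "lipschitz_bounded B L \<Phi>" and s: "s \<in> S"
  shows "(\<lambda>p. multiplier D \<Phi> s (fst p) (snd p)) \<in> borel_measurable borel"
proof -
  note [measurable] = lipschitz_bounded_measurable[OF \<Phi>] measurable_density(1)[OF s]
  show ?thesis unfolding multiplier_def by measurable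
qed

text \<open>The second summand is the derivative falling on \<Phi>, in \<open>flux_v\<close> the one
  falling on |\<xi>|^2. The transport operator makes these two cancel.\<close>

definition flux_x :: "real \<Rightarrow> ('a \<Rightarrow> real) \<Rightarrow> 'a \<Rightarrow> real \<Rightarrow> 'a \<Rightarrow> 'a \<Rightarrow> real" where
  "flux_x D \<Phi> b s x \<xi> = multiplier D \<Phi> s x \<xi> * fx b s x \<xi> + 2 * partial_deriv b \<Phi> x * f s x \<xi>"

definition flux_v :: "real \<Rightarrow> ('a \<Rightarrow> real) \<Rightarrow> 'a \<Rightarrow> real \<Rightarrow> 'a \<Rightarrow> 'a \<Rightarrow> real" where
  "flux_v D \<Phi> b s x \<xi> = multiplier D \<Phi> s x \<xi> * fv b s x \<xi> + 2 * (\<xi> \<bullet> b) * f s x \<xi>"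

lemma decays_flux:
  assumes \<Phi>: "lipschitz_bounded B L \<Phi>" and b: "b \<in> Basis"
  shows "decays S (2 * DIM('a) + 2) (flux_x D \<Phi> b)" "decays S (2 * DIM('a) + 2) (flux_v D \<Phi> b)"
proof -
  let ?N = "2 * DIM('a) + 2"
  have "decays S ?N (\<lambda>s x \<xi>. (2 * partial_deriv b \<Phi> x) * f s x \<xi>)"
  proof (rule decays_mult[where j=0 and M="2 * L"])
    show "decays S (?N + 0) f" by (rule decays_mono[OF dec(1)]) simp
    show "\<bar>2 * partial_deriv b \<Phi> x\<bar> \<le> 2 * L * weight x \<xi> ^ 0" for x \<xi>
      using lipschitz_bounded_partial_deriv(2)[OF \<Phi> b] by (simp add: abs_mult)
  qed
  from decays_add[OF decays_multiplier[OF \<Phi> dec(3)[OF b] dec_ln(3)[OF b]] this]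
  show "decays S ?N (flux_x D \<Phi> b)" unfolding flux_x_def[abs_def] .
  have "decays S ?N (\<lambda>s x \<xi>. (2 * (\<xi> \<bullet> b)) * f s x \<xi>)"
  proof (rule decays_mult[where j=1 and M=2])
    show "decays S (?N + 1) f" by (rule decays_mono[OF dec(1)]) simp
    show "\<bar>2 * (\<xi> \<bullet> b)\<bar> \<le> 2 * weight x \<xi> ^ 1" for x \<xi>
      using abs_inner_Basis_le_weight[OF b, of \<xi> x] by simp
  qed
  from decays_add[OF decays_multiplier[OF \<Phi> dec(4)[OF b] dec_ln(4)[OF b]] this]
  show "decays S ?N (flux_v D \<Phi> b)" unfolding flux_v_def[abs_def] .
qed

lemma measurable_flux:
  assumes \<Phi>: "lipschitz_bounded B L \<Phi>" and b: "b \<in> Basis" and s: "s \<in> S"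
  shows "(\<lambda>p. flux_x D \<Phi> b s (fst p) (snd p)) \<in> borel_measurable borel"
    "(\<lambda>p. flux_v D \<Phi> b s (fst p) (snd p)) \<in> borel_measurable borel"
proof -
  note [measurable] = measurable_multiplier[OF \<Phi> s] measurable_density(1)[OF s] measurable_density(3,4)[OF s b]
    lipschitz_bounded_partial_deriv(3)[OF \<Phi> b]
  show "(\<lambda>p. flux_x D \<Phi> b s (fst p) (snd p)) \<in> borel_measurable borel" unfolding flux_x_def by measurable
  show "(\<lambda>p. flux_v D \<Phi> b s (fst p) (snd p)) \<in> borel_measurable borel" unfolding flux_v_def by measurable
qed

text \<open>The fluxes are the partial derivatives of \<open>2 D f ln f + (|\<xi>|\<^sup>2 + 2 \<Phi>) f\<close>. The flux in \<open>x\<close>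
  is multiplied by a function of \<open>\<xi>\<close> only, and vice versa.\<close>

lemma
  assumes \<Phi>: "lipschitz_bounded B L \<Phi>" and b: "b \<in> Basis" and s: "s \<in> S"
  shows integral_flux_x: "(LINT x|lborel. flux_x D \<Phi> b s x \<xi>) = 0"
    and integral_flux_v: "(LINT \<xi>|lborel. flux_v D \<Phi> b s x \<xi>) = 0"
proof -
  let ?G = "\<lambda>s x \<xi>. 2 * D * (f s x \<xi> * ln (f s x \<xi>)) + ((norm \<xi>)\<^sup>2 + 2 * \<Phi> x) * f s x \<xi>"
  note [measurable] = lipschitz_bounded_measurable[OF \<Phi>] measurable_density(1)[OF s]
  have dG: "decays S (2 * DIM('a) + 2) ?G"
  proof -
    have "decays S (2 * DIM('a) + 2) (\<lambda>s x \<xi>. multiplier D \<Phi> s x \<xi> * f s x \<xi> + (- 2 * D) * f s x \<xi>)"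
      by (intro decays_add decays_multiplier[OF \<Phi> dec(1) dec_ln(1)] decays_cmult decays_mono[OF dec(1)]) simp
    then show ?thesis by (simp add: multiplier_def algebra_simps)
  qed
  have mG: "(\<lambda>p. ?G s (fst p) (snd p)) \<in> borel_measurable borel" by measurable
  have "decays S ((DIM('a) + 1) + 0) (flux_x D \<Phi> b)" by (rule decays_mono[OF decays_flux(1)[OF \<Phi> b]]) simp
  then obtain A where A: "\<And>s x \<xi>. s \<in> S \<Longrightarrow> \<bar>flux_x D \<Phi> b s x \<xi>\<bar> \<le> A * (1 / (1 + norm x) ^ (DIM('a) + 1)) * (1 / (1 + norm \<xi>) ^ 0)"
    by (rule decays_sections) (rule that)
  show "(LINT x|lborel. flux_x D \<Phi> b s x \<xi>) = 0"
  proof (rule integral_directional_derivative_eq_0[where G="\<lambda>x. ?G s x \<xi>" and b=b])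
    show "\<bar>flux_x D \<Phi> b s x \<xi>\<bar> \<le> A / (1 + norm x) ^ (DIM('a) + 1)" for x
      using A[OF s, of x \<xi>] by simp
    show "integrable lborel (\<lambda>x. ?G s x \<xi>)"
      by (rule integrable_section(2)[OF dG _ s mG]) simp
    show "((\<lambda>u. ?G s (x + u *\<^sub>R b) \<xi>) has_real_derivative flux_x D \<Phi> b s x \<xi>) (at 0)" for x
      by (rule derivative_eq_intros der_ln(2)[OF s b] der(2)[OF s b] lipschitz_bounded_partial_deriv(1)[OF \<Phi> b] refl)+
        (simp add: flux_x_def multiplier_def algebra_simps)
  qed (use b in simp)
  have "decays S (0 + (DIM('a) + 1)) (flux_v D \<Phi> b)" by (rule decays_mono[OF decays_flux(2)[OF \<Phi> b]]) simp
  then obtain A where A: "\<And>s x \<xi>. s \<in> S \<Longrightarrow> \<bar>flux_v D \<Phi> b s x \<xi>\<bar> \<le> A * (1 / (1 + norm x) ^ 0) * (1 / (1 + norm \<xi>) ^ (DIM('a) + 1))"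
    by (rule decays_sections) (rule that)
  show "(LINT \<xi>|lborel. flux_v D \<Phi> b s x \<xi>) = 0"
  proof (rule integral_directional_derivative_eq_0[where G="\<lambda>\<xi>. ?G s x \<xi>" and b=b])
    show "\<bar>flux_v D \<Phi> b s x \<xi>\<bar> \<le> A / (1 + norm \<xi>) ^ (DIM('a) + 1)" for \<xi>
      using A[OF s, of x \<xi>] by simp
    show "integrable lborel (\<lambda>\<xi>. ?G s x \<xi>)"
      by (rule integrable_section(1)[OF dG _ s mG]) simp
    have n: "((\<lambda>u. (norm (\<xi> + u *\<^sub>R b))\<^sup>2) has_real_derivative 2 * (\<xi> \<bullet> b)) (at 0)" for \<xi>
    proof -
      have "(\<lambda>u. (norm (\<xi> + u *\<^sub>R b))\<^sup>2) = (\<lambda>u. (norm \<xi>)\<^sup>2 + 2 * u * (\<xi> \<bullet> b) + u\<^sup>2 * (norm b)\<^sup>2)"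
        unfolding power2_norm_eq_inner by (simp add: fun_eq_iff inner_add_left inner_add_right inner_commute power2_eq_square)
      then show ?thesis by (auto intro!: derivative_eq_intros)
    qed
    show "((\<lambda>u. ?G s x (\<xi> + u *\<^sub>R b)) has_real_derivative flux_v D \<Phi> b s x \<xi>) (at 0)" for \<xi>
      by (rule derivative_eq_intros der_ln(3)[OF s b] der(3)[OF s b] n refl)+
        (simp add: flux_v_def multiplier_def algebra_simps)
  qed (use b in simp)
qed

text \<open>Fubini with the variable of the flux innermost: the prefactor does not depend on it and
  comes out of an integral that is 0. The factor \<xi> takes the last available power, down to 2d +
  1.\<close>

lemma
  assumes \<Phi>: "lipschitz_bounded B L \<Phi>" and b: "b \<in> Basis" and s: "s \<in> S"
  shows integrable_transport_x: "integrable lborel (\<lambda>(x, \<xi>). (\<xi> \<bullet> b) * flux_x D \<Phi> b s x \<xi>)"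
    and integral_transport_x: "(LINT (x, \<xi>)|lborel. (\<xi> \<bullet> b) * flux_x D \<Phi> b s x \<xi>) = 0"
    and integrable_transport_v: "integrable lborel (\<lambda>(x, \<xi>). partial_deriv b \<Phi> x * flux_v D \<Phi> b s x \<xi>)"
    and integral_transport_v: "(LINT (x, \<xi>)|lborel. partial_deriv b \<Phi> x * flux_v D \<Phi> b s x \<xi>) = 0"
proof -
  note [measurable] = measurable_flux[OF \<Phi> b s, of D] lipschitz_bounded_partial_deriv(3)[OF \<Phi> b]
  have e: "2 * DIM('a) + 1 + 1 = 2 * DIM('a) + 2" by simp
  have "decays S (2 * DIM('a) + 1) (\<lambda>s x \<xi>. (\<xi> \<bullet> b) * flux_x D \<Phi> b s x \<xi>)"
    by (rule decays_mult[OF _ abs_inner_Basis_le_weight[OF b]]) (simp only: e decays_flux(1)[OF \<Phi> b])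
  then show 1: "integrable lborel (\<lambda>(x, \<xi>). (\<xi> \<bullet> b) * flux_x D \<Phi> b s x \<xi>)"
    by (rule decays_integrable[OF _ _ s]) (simp, measurable)
  show "(LINT (x, \<xi>)|lborel. (\<xi> \<bullet> b) * flux_x D \<Phi> b s x \<xi>) = 0"
    using lborel_integral_snd[OF 1] integral_flux_x[OF \<Phi> b s] by simp
  have "decays S (2 * DIM('a) + 2) (\<lambda>s x \<xi>. partial_deriv b \<Phi> x * flux_v D \<Phi> b s x \<xi>)"
    by (rule decays_mult[where j=0 and M=L]) (use lipschitz_bounded_partial_deriv(2)[OF \<Phi> b] decays_flux(2)[OF \<Phi> b] in auto)
  then show 2: "integrable lborel (\<lambda>(x, \<xi>). partial_deriv b \<Phi> x * flux_v D \<Phi> b s x \<xi>)"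
    by (rule decays_integrable[OF _ _ s]) (simp, measurable)
  show "(LINT (x, \<xi>)|lborel. partial_deriv b \<Phi> x * flux_v D \<Phi> b s x \<xi>) = 0"
    using lborel_integral_fst[OF 2] integral_flux_v[OF \<Phi> b s] by simp
qed

text \<open>Local conservation of mass: at fixed \<open>x\<close> both collision terms have
  \<xi>-integral \<rho>. Integrability is asked of \<open>k\<close> times \<rho> because
  \<open>k\<close> will contain ln \<rho>, which is unbounded where \<rho> is small.\<close>

lemma collision_orthogonal_local:
  assumes s: "s \<in> S" and D: "0 < D"
    and k: "k \<in> borel_measurable borel" "integrable lborel (\<lambda>x. k x * rho f s x)"
  shows "integrable lborel (\<lambda>(x, \<xi>). k x * (rho f s x * maxwellian D \<xi> - f s x \<xi>))"
    and "(LINT (x, \<xi>)|lborel. k x * (rho f s x * maxwellian D \<xi> - f s x \<xi>)) = 0"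
proof -
  have mf: "(\<lambda>p. f s (fst p) (snd p)) \<in> borel_measurable (borel \<Otimes>\<^sub>M borel)"
    using measurable_density(1)[OF s] by (simp add: borel_prod)
  have 1: "integrable lborel (\<lambda>(x, \<xi>::'a). (k x * rho f s x) * maxwellian D \<xi>)"
    by (rule integrable_lborel_mult[OF k(2) integrable_maxwellian[OF D]])
  have 2: "integrable lborel (\<lambda>(x, \<xi>). k x * f s x \<xi>)"
  proof (rule integrable_lborel_pairI)
    show "(\<lambda>(x, \<xi>). k x * f s x \<xi>) \<in> borel_measurable (lborel \<Otimes>\<^sub>M lborel)"
      using mf k(1) unfolding case_prod_unfold by measurable
    show "integrable lborel (\<lambda>\<xi>. k x * f s x \<xi>)" for x using integrable_density(1)[OF s] by simp
    have "(LINT \<xi>|lborel. \<bar>k x * f s x \<xi>\<bar>) = \<bar>k x * rho f s x\<bar>" for x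
      by (simp add: abs_mult nonneg[OF s] rho_nonneg[OF s] rho_def[symmetric])
    then show "integrable lborel (\<lambda>x. LINT \<xi>|lborel. \<bar>k x * f s x \<xi>\<bar>)" using k(2) by simp
  qed
  have eq: "(\<lambda>(x, \<xi>). k x * (rho f s x * maxwellian D \<xi> - f s x \<xi>))
    = (\<lambda>p. (case p of (x, \<xi>) \<Rightarrow> (k x * rho f s x) * maxwellian D \<xi>) - (case p of (x, \<xi>) \<Rightarrow> k x * f s x \<xi>))"
    by (auto simp: fun_eq_iff algebra_simps)
  show "integrable lborel (\<lambda>(x, \<xi>). k x * (rho f s x * maxwellian D \<xi> - f s x \<xi>))"
    unfolding eq using 1 2 by (rule Bochner_Integration.integrable_diff)
  have "(LINT (x, \<xi>::'a)|lborel. (k x * rho f s x) * maxwellian D \<xi>) = (LINT x|lborel. k x * rho f s x)"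
    using lborel_integral_fst[OF 1] by (simp add: integral_maxwellian[OF D])
  moreover have "(LINT (x, \<xi>)|lborel. k x * f s x \<xi>) = (LINT x|lborel. k x * rho f s x)"
    using lborel_integral_fst[OF 2] by (simp add: rho_def)
  ultimately show "(LINT (x, \<xi>)|lborel. k x * (rho f s x * maxwellian D \<xi> - f s x \<xi>)) = 0"
    unfolding eq Bochner_Integration.integral_diff[OF 1 2] by simp
qed

section \<open>Testing the equation with the multiplier at a fixed time\<close>

context
  fixes t D \<epsilon> B L \<Phi>
  assumes t: "t \<in> S" and D: "0 < D" and \<epsilon>: "0 < \<epsilon>" and \<Phi>: "lipschitz_bounded B L \<Phi>"
    and kinetic_eq: "\<And>x \<xi>. \<epsilon>\<^sup>2 * ft t x \<xi> + \<epsilon> * (\<Sum>b\<in>Basis. (\<xi> \<bullet> b) * fx b t x \<xi>)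
      - \<epsilon> * (\<Sum>b\<in>Basis. partial_deriv b \<Phi> x * fv b t x \<xi>) = rho f t x * maxwellian D \<xi> - f t x \<xi>"
begin

text \<open>At a zero of \<open>f\<close> all its first derivatives vanish by \<open>zero\<close>,
  so the equation reduces to \<rho> M = 0 there, and M is positive.\<close>

lemma vacuum_iff: "f t x \<xi> = 0 \<longleftrightarrow> rho f t x = 0"
proof
  assume "f t x \<xi> = 0"
  with kinetic_eq[of x \<xi>] zero[OF t] have "rho f t x * maxwellian D \<xi> = 0" by simp
  then show "rho f t x = 0" using maxwellian_pos[OF D, of \<xi>] by simp
qed (rule rho_eq_0[OF t])

text \<open>Monotonicity of the logarithm on positive numbers. The convention ln 0 = 0 breaks
  monotonicity at 0, but by \<open>vacuum_iff\<close> the two arguments can only vanish together,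
  and then the product is 0.\<close>

lemma ln_mult_diff_nonneg: "0 \<le> (f t x \<xi> - rho f t x * maxwellian D \<xi>) * (ln (f t x \<xi>) - ln (rho f t x * maxwellian D \<xi>))"
proof (cases "rho f t x = 0")
  case True
  then show ?thesis using vacuum_iff[of x \<xi>] by simp
next
  case False
  then have pos: "0 < rho f t x * maxwellian D \<xi>" "0 < f t x \<xi>"
    using rho_nonneg[OF t, of x] nonneg[OF t, of x \<xi>] vacuum_iff[of x \<xi>] maxwellian_pos[OF D, of \<xi>]
    by (auto simp: less_le)
  show ?thesis
  proof (cases "f t x \<xi> \<le> rho f t x * maxwellian D \<xi>")
    case True
    then show ?thesis using pos ln_mono[OF True pos(2)] by (intro mult_nonpos_nonpos) auto
  next
    case False
    then show ?thesis using pos ln_mono[OF _ pos(1), of "f t x \<xi>"] by (intro mult_nonneg_nonneg) auto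
  qed
qed

lemma
  shows integrable_multiplier_rate: "integrable lborel (\<lambda>(x, \<xi>). multiplier D \<Phi> t x \<xi> * ft t x \<xi>)"
    and integrable_relative_entropy_production:
      "integrable lborel (\<lambda>(x, \<xi>). (f t x \<xi> - rho f t x * maxwellian D \<xi>) * (ln (f t x \<xi>) - ln (rho f t x * maxwellian D \<xi>)))"
    and integral_multiplier_rate: "(LINT (x, \<xi>)|lborel. multiplier D \<Phi> t x \<xi> * ft t x \<xi>) = - (2 * D / \<epsilon>\<^sup>2) *
      (LINT (x, \<xi>)|lborel. (f t x \<xi> - rho f t x * maxwellian D \<xi>) * (ln (f t x \<xi>) - ln (rho f t x * maxwellian D \<xi>)))"
proof -
  note [measurable] = measurable_multiplier[OF \<Phi> t] measurable_density(1,2)[OF t] lipschitz_bounded_measurable[OF \<Phi>]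
    borel_measurable_rho[OF t]
  let ?R = "\<lambda>x \<xi>. rho f t x * maxwellian D \<xi> - f t x \<xi>"
  let ?T = "\<lambda>b x \<xi>. (\<xi> \<bullet> b) * flux_x D \<Phi> b t x \<xi>" and ?V = "\<lambda>b x \<xi>. partial_deriv b \<Phi> x * flux_v D \<Phi> b t x \<xi>"
  let ?P = "\<lambda>x \<xi>. (f t x \<xi> - rho f t x * maxwellian D \<xi>) * (ln (f t x \<xi>) - ln (rho f t x * maxwellian D \<xi>))"
  let ?m = "\<lambda>x \<xi>. multiplier D \<Phi> t x \<xi> * ft t x \<xi>"
  show im: "integrable lborel (\<lambda>(x, \<xi>). ?m x \<xi>)"
    by (rule decays_integrable[OF decays_multiplier[OF \<Phi> dec(2) dec_ln(2)] _ t]) (simp, measurable)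
  \<comment> \<open>In each coordinate the extra terms of both fluxes become 2 (\<xi> \<bullet> b)
    times the partial derivative of \<Phi> times \<open>f\<close> and cancel. What remains is the
    multiplier times the left-hand side of the equation.\<close>
  have pw: "multiplier D \<Phi> t x \<xi> * ?R x \<xi> = \<epsilon>\<^sup>2 * ?m x \<xi> + \<epsilon> * (\<Sum>b\<in>Basis. ?T b x \<xi> - ?V b x \<xi>)" for x \<xi>
  proof -
    have "(\<Sum>b\<in>Basis. ?T b x \<xi> - ?V b x \<xi>) = (\<Sum>b\<in>Basis. multiplier D \<Phi> t x \<xi> * ((\<xi> \<bullet> b) * fx b t x \<xi>)
        - multiplier D \<Phi> t x \<xi> * (partial_deriv b \<Phi> x * fv b t x \<xi>))"
      by (rule sum.cong) (simp_all add: flux_x_def flux_v_def algebra_simps)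
    also have "\<dots> = multiplier D \<Phi> t x \<xi> * (\<Sum>b\<in>Basis. (\<xi> \<bullet> b) * fx b t x \<xi>)
        - multiplier D \<Phi> t x \<xi> * (\<Sum>b\<in>Basis. partial_deriv b \<Phi> x * fv b t x \<xi>)"
      by (simp only: sum_subtractf sum_distrib_left)
    finally have e: "(\<Sum>b\<in>Basis. ?T b x \<xi> - ?V b x \<xi>) = \<dots>" .
    show ?thesis unfolding kinetic_eq[symmetric] e by (simp add: algebra_simps)
  qed
  have pw': "(\<lambda>(x, \<xi>). multiplier D \<Phi> t x \<xi> * ?R x \<xi>) = (\<lambda>p. \<epsilon>\<^sup>2 * (case p of (x, \<xi>) \<Rightarrow> ?m x \<xi>)
      + \<epsilon> * (\<Sum>b\<in>Basis. (case p of (x, \<xi>) \<Rightarrow> ?T b x \<xi>) - (case p of (x, \<xi>) \<Rightarrow> ?V b x \<xi>)))"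
    using pw by (auto simp: fun_eq_iff)
  have it: "integrable lborel (\<lambda>p. \<epsilon> * (\<Sum>b\<in>Basis. (case p of (x, \<xi>) \<Rightarrow> ?T b x \<xi>) - (case p of (x, \<xi>) \<Rightarrow> ?V b x \<xi>)))"
    by (intro integrable_mult_right Bochner_Integration.integrable_sum Bochner_Integration.integrable_diff
      integrable_transport_x[OF \<Phi> _ t] integrable_transport_v[OF \<Phi> _ t])
  have t0: "(LINT p|lborel. \<epsilon> * (\<Sum>b\<in>Basis. (case p of (x, \<xi>) \<Rightarrow> ?T b x \<xi>) - (case p of (x, \<xi>) \<Rightarrow> ?V b x \<xi>))) = 0"
  proof -
    have "(LINT p|lborel. (case p of (x, \<xi>) \<Rightarrow> ?T b x \<xi>) - (case p of (x, \<xi>) \<Rightarrow> ?V b x \<xi>)) = 0" if b: "b \<in> Basis" for b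
      unfolding Bochner_Integration.integral_diff[OF integrable_transport_x[OF \<Phi> b t] integrable_transport_v[OF \<Phi> b t]]
      by (simp only: integral_transport_x[OF \<Phi> b t] integral_transport_v[OF \<Phi> b t])
    moreover have "integrable lborel (\<lambda>p. (case p of (x, \<xi>) \<Rightarrow> ?T b x \<xi>) - (case p of (x, \<xi>) \<Rightarrow> ?V b x \<xi>))"
      if b: "b \<in> Basis" for b
      by (intro Bochner_Integration.integrable_diff integrable_transport_x[OF \<Phi> b t] integrable_transport_v[OF \<Phi> b t])
    ultimately have "(LINT p|lborel. (\<Sum>b\<in>Basis. (case p of (x, \<xi>) \<Rightarrow> ?T b x \<xi>) - (case p of (x, \<xi>) \<Rightarrow> ?V b x \<xi>))) = 0"
      by (subst Bochner_Integration.integral_sum) (simp_all only: sum.neutral_const cong: sum.cong)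
    then show ?thesis by simp
  qed
  have iR: "integrable lborel (\<lambda>(x, \<xi>). multiplier D \<Phi> t x \<xi> * ?R x \<xi>)"
    unfolding pw' by (rule Bochner_Integration.integrable_add[OF _ it]) (rule integrable_mult_right, rule im)
  have R: "(LINT (x, \<xi>)|lborel. multiplier D \<Phi> t x \<xi> * ?R x \<xi>) = \<epsilon>\<^sup>2 * (LINT (x, \<xi>)|lborel. ?m x \<xi>)"
    unfolding pw' Bochner_Integration.integral_add[OF integrable_mult_right[OF im] it] t0 by simp
  \<comment> \<open>\<open>k\<close> is the multiplier with ln f replaced by ln (\<rho> M). The
    Gaussian exponent contributes -|\<xi>|^2 to 2 D ln M, which cancels the kinetic term, so that
    only a function of \<open>x\<close> is left.\<close>
  define k where "k x = 2 * D + 2 * \<Phi> x + 2 * D * ln (rho f t x) + 2 * D * ln ((2 * pi * D) powr (- (real DIM('a) / 2)))" for x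
  have mk: "k \<in> borel_measurable borel" unfolding k_def[abs_def] by measurable
  have rho_i: "integrable lborel (rho f t)" using L1_Linf_rho[OF t] by (simp add: L1_Linf_def)
  have ik: "integrable lborel (\<lambda>x. k x * rho f t x)"
  proof -
    have B: "\<bar>\<Phi> x\<bar> \<le> B" for x using \<Phi> by (auto simp: lipschitz_bounded_def)
    have "integrable lborel (\<lambda>x. rho f t x * \<Phi> x)"
      by (rule integrable_mult_bounded[OF rho_i lipschitz_bounded_measurable[OF \<Phi>] B])
    then have "integrable lborel (\<lambda>x. (2 * D + 2 * D * ln ((2 * pi * D) powr (- (real DIM('a) / 2)))) * rho f t x
        + 2 * (rho f t x * \<Phi> x) + (2 * D) * (rho f t x * ln (rho f t x)))"
      using rho_i integrable_rho_ln_rho[OF t] by (intro Bochner_Integration.integrable_add integrable_mult_right)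
    then show ?thesis by (simp add: k_def algebra_simps)
  qed
  \<comment> \<open>\<open>?R\<close> is \<rho> M - f, opposite in sign to the first factor of
    \<open>?P\<close>; this is why the multiplier enters with a minus sign. In vacuum both sides are
    0 because \<open>f\<close> and \<rho> vanish together.\<close>
  have key: "(2 * D) * ?P x \<xi> = k x * ?R x \<xi> - multiplier D \<Phi> t x \<xi> * ?R x \<xi>" for x \<xi>
  proof (cases "rho f t x = 0")
    case True
    then show ?thesis using vacuum_iff[of x \<xi>] by simp
  next
    case False
    have l1: "ln (rho f t x * maxwellian D \<xi>) = ln (rho f t x) + ln (maxwellian D \<xi>)"
      using False rho_nonneg[OF t, of x] maxwellian_pos[OF D, of \<xi>] by (intro ln_mult_pos) auto
    have l2: "ln (maxwellian D \<xi>) = ln ((2 * pi * D) powr (- (real DIM('a) / 2))) - (norm \<xi>)\<^sup>2 / (2 * D)"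
      unfolding maxwellian_def using D by (subst ln_mult_pos) auto
    have "(2 * D) * (ln (f t x \<xi>) - ln (rho f t x * maxwellian D \<xi>)) = multiplier D \<Phi> t x \<xi> - k x"
      unfolding l1 l2 multiplier_def k_def using D by (simp add: field_simps)
    then have "(f t x \<xi> - rho f t x * maxwellian D \<xi>) * ((2 * D) * (ln (f t x \<xi>) - ln (rho f t x * maxwellian D \<xi>)))
      = (f t x \<xi> - rho f t x * maxwellian D \<xi>) * (multiplier D \<Phi> t x \<xi> - k x)" by simp
    then show ?thesis by (simp add: algebra_simps)
  qed
  note k = collision_orthogonal_local[OF t D mk ik]
  have P: "(\<lambda>(x, \<xi>). ?P x \<xi>) = (\<lambda>p. (1 / (2 * D)) * ((case p of (x, \<xi>) \<Rightarrow> k x * ?R x \<xi>)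
      - (case p of (x, \<xi>) \<Rightarrow> multiplier D \<Phi> t x \<xi> * ?R x \<xi>)))"
    using key D by (auto simp: fun_eq_iff field_simps)
  show "integrable lborel (\<lambda>(x, \<xi>). ?P x \<xi>)"
    unfolding P using k(1) iR by (intro integrable_mult_right Bochner_Integration.integrable_diff)
  have "(LINT (x, \<xi>)|lborel. ?P x \<xi>) = (1 / (2 * D)) * (0 - \<epsilon>\<^sup>2 * (LINT (x, \<xi>)|lborel. ?m x \<xi>))"
    unfolding P integral_mult_right_zero Bochner_Integration.integral_diff[OF k(1) iR] k(2) R ..
  then show "(LINT (x, \<xi>)|lborel. ?m x \<xi>) = - (2 * D / \<epsilon>\<^sup>2) * (LINT (x, \<xi>)|lborel. ?P x \<xi>)"
    using D \<epsilon> by (simp add: field_simps)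
qed

end

end

section \<open>Regular densities\<close>

lemma has_real_derivative_along:
  assumes "g differentiable at (p + s *\<^sub>R i)"
  shows "((\<lambda>s. g (p + s *\<^sub>R i)) has_real_derivative partial_deriv i g (p + s *\<^sub>R i)) (at s)"
proof -
  have F: "(g has_derivative frechet_derivative g (at (p + s *\<^sub>R i))) (at (p + s *\<^sub>R i))"
    using assms by (simp flip: frechet_derivative_works)
  have "((\<lambda>s. g (p + s *\<^sub>R i)) has_derivative (\<lambda>u. frechet_derivative g (at (p + s *\<^sub>R i)) (u *\<^sub>R i))) (at s)"
    by (rule has_derivative_compose[where f="\<lambda>s. p + s *\<^sub>R i" and f'="\<lambda>u. u *\<^sub>R i" and g=g])
      (use F in \<open>auto intro!: derivative_eq_intros\<close>)
  moreover have "(\<lambda>u. frechet_derivative g (at (p + s *\<^sub>R i)) (u *\<^sub>R i)) = (*) (partial_deriv i g (p + s *\<^sub>R i))"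
    using linear_scale[OF has_derivative_linear[OF F]] by (auto simp: fun_eq_iff partial_deriv_def)
  ultimately show ?thesis by (simp add: has_field_derivative_def)
qed

text \<open>The equation is stated with gradients of slices, the regularity with partial derivatives
  of the function of all variables; total differentiability and the chain rule connect the
  two.\<close>

lemma partial_deriv_slices:
  fixes g :: "real \<times> 'a::euclidean_space \<times> 'a \<Rightarrow> real"
  assumes "g differentiable at (t, x, \<xi>)"
  shows "(\<lambda>y. g (t, y, \<xi>)) differentiable at x"
    and "partial_deriv b (\<lambda>y. g (t, y, \<xi>)) x = partial_deriv (0, b, 0) g (t, x, \<xi>)"
    and "partial_deriv b (\<lambda>\<eta>. g (t, x, \<eta>)) \<xi> = partial_deriv (0, 0, b) g (t, x, \<xi>)"
proof -
  have F: "(g has_derivative frechet_derivative g (at (t, x, \<xi>))) (at (t, x, \<xi>))"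
    using assms by (simp flip: frechet_derivative_works)
  have x: "((\<lambda>y. g (t, y, \<xi>)) has_derivative (\<lambda>h. frechet_derivative g (at (t, x, \<xi>)) (0, h, 0))) (at x)"
    by (rule has_derivative_compose[where f="\<lambda>y. (t, y, \<xi>)" and f'="\<lambda>h. (0, h, 0)" and g=g])
      (use F in \<open>auto intro!: derivative_eq_intros\<close>)
  have v: "((\<lambda>\<eta>. g (t, x, \<eta>)) has_derivative (\<lambda>h. frechet_derivative g (at (t, x, \<xi>)) (0, 0, h))) (at \<xi>)"
    by (rule has_derivative_compose[where f="\<lambda>\<eta>. (t, x, \<eta>)" and f'="\<lambda>h. (0, 0, h)" and g=g])
      (use F in \<open>auto intro!: derivative_eq_intros\<close>)
  show "(\<lambda>y. g (t, y, \<xi>)) differentiable at x" using x unfolding differentiable_def by blast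
  show "partial_deriv b (\<lambda>y. g (t, y, \<xi>)) x = partial_deriv (0, b, 0) g (t, x, \<xi>)"
    using frechet_derivative_at[OF x] unfolding partial_deriv_def by metis
  show "partial_deriv b (\<lambda>\<eta>. g (t, x, \<eta>)) \<xi> = partial_deriv (0, 0, b) g (t, x, \<xi>)"
    using frechet_derivative_at[OF v] unfolding partial_deriv_def by metis
qed

lemma inner_grad: "v \<bullet> grad g p = (\<Sum>b\<in>Basis. (v \<bullet> b) * partial_deriv b g p)"
  unfolding grad_def inner_sum_right by (simp add: mult.commute)

lemma grad_inner_Basis: "b \<in> Basis \<Longrightarrow> grad g p \<bullet> b = partial_deriv b g p"
  unfolding grad_def by (rule inner_sum_left_Basis)

lemma Basis_phase_space:
  "(1::real, 0::'a::euclidean_space, 0::'a) \<in> Basis"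
  "b \<in> Basis \<Longrightarrow> (0::real, b::'a::euclidean_space, 0::'a) \<in> Basis"
  "b \<in> Basis \<Longrightarrow> (0::real, 0::'a::euclidean_space, b::'a) \<in> Basis"
  by (auto simp: Basis_prod_def zero_prod_def image_iff)

text \<open>Time, space and velocity directions are basis vectors of one product space, so a single
  one-variable argument along \<open>p + u *\<^sub>R i\<close> yields the square-root bound and the
  differentiability of f ln f in all of them.\<close>

lemma regular_density_transport:
  fixes f :: "real \<Rightarrow> 'a::euclidean_space \<Rightarrow> 'a \<Rightarrow> real"
  assumes reg: "regular_density T f" and nn: "\<And>s x \<xi>. s \<in> {0<..<T} \<Longrightarrow> 0 \<le> f s x \<xi>" and t: "t \<in> {0<..<T}"
  defines "g \<equiv> \<lambda>(t, x, \<xi>). f t x \<xi>"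
  obtains S where "t \<in> S" "S \<subseteq> {0<..<T}" 
    "transport f (\<lambda>s x \<xi>. partial_deriv (1, 0, 0) g (s, x, \<xi>)) (\<lambda>b s x \<xi>. partial_deriv (0, b, 0) g (s, x, \<xi>))
      (\<lambda>b s x \<xi>. partial_deriv (0, 0, b) g (s, x, \<xi>)) S"
    and "\<And>p. p \<in> {0<..<T} \<times> UNIV \<Longrightarrow> g differentiable at p"
proof -
  let ?N = "2 * DIM('a) + 4"
  have g: "g (s, x, \<xi>) = f s x \<xi>" for s x \<xi> by (simp add: g_def)
  have C2: "Ck_on 2 g ({0<..<T} \<times> UNIV)" using reg unfolding regular_density_def g_def Let_def by blast
  have d1: "g differentiable at p" if "p \<in> {0<..<T} \<times> UNIV" for p
    using C2 that by (cases p) (auto simp: numeral_2_eq_2)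
  have d2: "partial_deriv i g differentiable at p" if "p \<in> {0<..<T} \<times> UNIV" "i \<in> Basis" for p i
    using C2 that by (cases p) (auto simp: numeral_2_eq_2)
  \<comment> \<open>A quarter of the distance to either end of the time interval: points of
    \<open>S\<close> lie within \<open>r\<close> of \<open>t\<close>, the Taylor argument moves by
    another \<open>r\<close>, possibly in time, and 2r still stays in the compact interval on which
    \<open>C\<close> is valid.\<close>
  define r where "r = min (t / 4) ((T - t) / 4)"
  define S where "S = {t - r<..<t + r}"
  have r: "0 < r" "4 * r \<le> t" "4 * r \<le> T - t" using t by (auto simp: r_def min_def)
  have ab: "0 < t / 2 \<and> (t + T) / 2 < T" using t by auto
  have "\<exists>C. \<forall>s\<in>{t / 2..(t + T) / 2}. \<forall>x \<xi>.
      (1 + norm x + norm \<xi>) ^ ?N * \<bar>g (s, x, \<xi>)\<bar> \<le> C \<and>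
      (\<forall>i\<in>Basis. (1 + norm x + norm \<xi>) ^ ?N * \<bar>partial_deriv i g (s, x, \<xi>)\<bar> \<le> C) \<and>
      (\<forall>i\<in>Basis. \<forall>j\<in>Basis. \<bar>partial_deriv i (partial_deriv j g) (s, x, \<xi>)\<bar> \<le> C)"
    using reg ab unfolding regular_density_def g_def[symmetric] Let_def by blast
  then obtain C where C: "\<And>s x \<xi>. s \<in> {t / 2..(t + T) / 2} \<Longrightarrow> weight x \<xi> ^ ?N * \<bar>g (s, x, \<xi>)\<bar> \<le> C"
    "\<And>s x \<xi> i. s \<in> {t / 2..(t + T) / 2} \<Longrightarrow> i \<in> Basis \<Longrightarrow> weight x \<xi> ^ ?N * \<bar>partial_deriv i g (s, x, \<xi>)\<bar> \<le> C"
    "\<And>s x \<xi> i j. s \<in> {t / 2..(t + T) / 2} \<Longrightarrow> i \<in> Basis \<Longrightarrow> j \<in> Basis \<Longrightarrow> \<bar>partial_deriv i (partial_deriv j g) (s, x, \<xi>)\<bar> \<le> C"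
    unfolding weight_def by metis
  have S_sub: "s \<in> {t / 2..(t + T) / 2}" if "s \<in> S" for s
    using that r unfolding S_def by auto
  have ST: "S \<subseteq> {0<..<T}" using r t unfolding S_def by auto
  have tS: "t \<in> S" using r by (simp add: S_def)
  have C0: "0 \<le> C"
  proof -
    have "0 \<le> weight (0::'a) 0 ^ ?N * \<bar>g (t, 0, 0)\<bar>" by (simp add: weight_def)
    then show ?thesis using C(1)[OF S_sub[OF tS], of 0 0] by linarith
  qed
  have near: "fst (p + u *\<^sub>R i) \<in> {t / 2..(t + T) / 2}" "p + u *\<^sub>R i \<in> {0<..<T} \<times> UNIV"
    if "fst p \<in> S" "i \<in> Basis" "\<bar>u\<bar> \<le> r" for p i and u :: real
  proof -
    have "\<bar>fst i\<bar> \<le> 1" using norm_fst_le[of "fst i" "snd i"] norm_Basis[OF that(2)] by simp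
    then have "\<bar>u * fst i\<bar> \<le> r * 1" unfolding abs_mult using that(3) by (intro mult_mono) auto
    then show 1: "fst (p + u *\<^sub>R i) \<in> {t / 2..(t + T) / 2}" using that(1) r unfolding S_def by auto
    then show "p + u *\<^sub>R i \<in> {0<..<T} \<times> UNIV" using ab by (cases "p + u *\<^sub>R i") auto
  qed
  have dec1: "\<bar>g (s, x, \<xi>)\<bar> \<le> C / weight x \<xi> ^ ?N" if "s \<in> S" for s x \<xi>
    using C(1)[OF S_sub[OF that], of x \<xi>] by (simp add: pos_le_divide_eq mult.commute)
  have dec2: "\<bar>partial_deriv i g (s, x, \<xi>)\<bar> \<le> C / weight x \<xi> ^ ?N" if "s \<in> S" "i \<in> Basis" for s x \<xi> i
    using C(2)[OF S_sub[OF that(1)] that(2), of x \<xi>] by (simp add: pos_le_divide_eq mult.commute)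
  have bd: "g (s, x, \<xi>) \<le> C" if "s \<in> S" for s x \<xi>
  proof -
    have "1 \<le> weight x \<xi> ^ ?N" by (rule one_le_power) (rule weight_ge)
    then have "1 * \<bar>g (s, x, \<xi>)\<bar> \<le> weight x \<xi> ^ ?N * \<bar>g (s, x, \<xi>)\<bar>" by (rule mult_right_mono) simp
    with C(1)[OF S_sub[OF that], of x \<xi>] show ?thesis by linarith
  qed
  have gnn: "0 \<le> g p" if "p \<in> {0<..<T} \<times> UNIV" for p using nn that by (cases p) (auto simp: g)
  have along: "((\<lambda>u. g (p + u *\<^sub>R i)) has_real_derivative partial_deriv i g (p + u *\<^sub>R i)) (at u)"
    "((\<lambda>u. partial_deriv i g (p + u *\<^sub>R i)) has_real_derivative partial_deriv i (partial_deriv i g) (p + u *\<^sub>R i)) (at u)"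
    "\<bar>partial_deriv i (partial_deriv i g) (p + u *\<^sub>R i)\<bar> \<le> C" "0 \<le> g (p + u *\<^sub>R i)"
    if "fst p \<in> S" "i \<in> Basis" "\<bar>u\<bar> \<le> r" for p i u
  proof -
    note q = near[OF that]
    show "((\<lambda>u. g (p + u *\<^sub>R i)) has_real_derivative partial_deriv i g (p + u *\<^sub>R i)) (at u)"
      by (rule has_real_derivative_along[OF d1[OF q(2)]])
    show "((\<lambda>u. partial_deriv i g (p + u *\<^sub>R i)) has_real_derivative partial_deriv i (partial_deriv i g) (p + u *\<^sub>R i)) (at u)"
      by (rule has_real_derivative_along[OF d2[OF q(2) that(2)]])
    show "\<bar>partial_deriv i (partial_deriv i g) (p + u *\<^sub>R i)\<bar> \<le> C"
      using C(3)[OF q(1) that(2) that(2), of "fst (snd (p + u *\<^sub>R i))" "snd (snd (p + u *\<^sub>R i))"]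
      by (simp only: prod.collapse)
    show "0 \<le> g (p + u *\<^sub>R i)" by (rule gnn[OF q(2)])
  qed
  \<comment> \<open>The constant of \<open>abs_deriv_le_sqrt\<close> when \<open>C\<close> bounds
    both the function and its second derivatives. It is the same at every point of the window, so
    the resulting decay is uniform.\<close>
  define K where "K = sqrt (C + 1) / r + C * r / sqrt (C + 1)"
  have sq: "\<bar>partial_deriv i g (s, x, \<xi>)\<bar> \<le> K * sqrt (g (s, x, \<xi>))" if s: "s \<in> S" and i: "i \<in> Basis" for s x \<xi> i
  proof -
    note a = along[of "(s, x, \<xi>)" i, OF _ i]
    have "\<bar>partial_deriv i g ((s, x, \<xi>) + 0 *\<^sub>R i)\<bar> \<le> (sqrt (C + 1) / r + C * r / sqrt (C + 1)) * sqrt (g ((s, x, \<xi>) + 0 *\<^sub>R i))"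
      by (rule abs_deriv_le_sqrt[OF r(1), where h="\<lambda>u. g ((s, x, \<xi>) + u *\<^sub>R i)"
          and h'="\<lambda>u. partial_deriv i g ((s, x, \<xi>) + u *\<^sub>R i)"
          and h''="\<lambda>u. partial_deriv i (partial_deriv i g) ((s, x, \<xi>) + u *\<^sub>R i)"])
        (use a s bd[OF s] in auto)
    then show ?thesis by (simp add: K_def)
  qed
  have ln_der: "((\<lambda>u. g ((s, x, \<xi>) + u *\<^sub>R i) * ln (g ((s, x, \<xi>) + u *\<^sub>R i))) has_real_derivative
      (ln (g (s, x, \<xi>)) + 1) * partial_deriv i g (s, x, \<xi>)) (at 0)" if s: "s \<in> S" and i: "i \<in> Basis" for s x \<xi> i
  proof -
    note a = along[of "(s, x, \<xi>)" i, OF _ i]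
    have "((\<lambda>u. g ((s, x, \<xi>) + u *\<^sub>R i) * ln (g ((s, x, \<xi>) + u *\<^sub>R i))) has_real_derivative
      (ln (g ((s, x, \<xi>) + 0 *\<^sub>R i)) + 1) * partial_deriv i g ((s, x, \<xi>) + 0 *\<^sub>R i)) (at 0)"
      by (rule has_real_derivative_mult_ln[OF r(1), where h="\<lambda>u. g ((s, x, \<xi>) + u *\<^sub>R i)"
          and h'="\<lambda>u. partial_deriv i g ((s, x, \<xi>) + u *\<^sub>R i)"
          and h''="\<lambda>u. partial_deriv i (partial_deriv i g) ((s, x, \<xi>) + u *\<^sub>R i)"])
        (use a s in auto)
    then show ?thesis by simp
  qed
  have K: "0 \<le> K" using r C0 by (simp add: K_def)
  \<comment> \<open>The constant K + sqrt C suits the derivatives, through K, and \<open>f\<close>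
    itself, through f \<le> sqrt C sqrt f, so one estimate covers all four clauses
    \<open>dec_ln\<close>.\<close>
  have ln_dec: "decays S (2 * DIM('a) + 3) (\<lambda>s x \<xi>. q s x \<xi> * ln (f s x \<xi>))"
    if q: "\<And>s x \<xi>. s \<in> S \<Longrightarrow> \<bar>q s x \<xi>\<bar> \<le> C / weight x \<xi> ^ ?N" "\<And>s x \<xi>. s \<in> S \<Longrightarrow> \<bar>q s x \<xi>\<bar> \<le> (K + sqrt C) * sqrt (g (s, x, \<xi>))" for q
  proof (rule decaysI)
    fix s x \<xi> assume s: "s \<in> S"
    have "\<bar>q s x \<xi> * ln (g (s, x, \<xi>))\<bar> \<le> (C * C + 4 * (K + sqrt C) + 4 * real (?N - 1) * C) / weight x \<xi> ^ (?N - 1)"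
      by (rule abs_mult_ln_decay) (use C0 K q[OF s] bd[OF s] gnn ST s weight_ge in auto)
    moreover have "?N - 1 = 2 * DIM('a) + 3" by simp
    ultimately show "\<bar>q s x \<xi> * ln (f s x \<xi>)\<bar> \<le> (C * C + 4 * (K + sqrt C) + 4 * real (?N - 1) * C) / weight x \<xi> ^ (2 * DIM('a) + 3)"
      by (simp only: g)
  qed
  have qd: "\<bar>partial_deriv i g (s, x, \<xi>)\<bar> \<le> (K + sqrt C) * sqrt (g (s, x, \<xi>))" if "s \<in> S" "i \<in> Basis" for s x \<xi> i
  proof -
    have "K * sqrt (g (s, x, \<xi>)) \<le> (K + sqrt C) * sqrt (g (s, x, \<xi>))"
      using C0 gnn[of "(s, x, \<xi>)"] ST that(1) by (intro mult_right_mono) auto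
    then show ?thesis using sq[OF that, of x \<xi>] by linarith
  qed
  have qf: "\<bar>g (s, x, \<xi>)\<bar> \<le> (K + sqrt C) * sqrt (g (s, x, \<xi>))" if s: "s \<in> S" for s x \<xi>
  proof -
    have nn: "0 \<le> g (s, x, \<xi>)" using gnn ST s by auto
    then have "\<bar>g (s, x, \<xi>)\<bar> = sqrt (g (s, x, \<xi>)) * sqrt (g (s, x, \<xi>))" by simp
    also have "\<dots> \<le> (K + sqrt C) * sqrt (g (s, x, \<xi>))"
      using nn K bd[OF s, of x \<xi>] by (intro mult_right_mono add_increasing real_sqrt_le_mono) auto
    finally show ?thesis .
  qed
  have cont_slice: "continuous_on UNIV (\<lambda>p. h (s, fst p, snd p))"
    if "\<And>p. p \<in> {0<..<T} \<times> UNIV \<Longrightarrow> h differentiable at p" "s \<in> S" for h :: "real \<times> 'a \<times> 'a \<Rightarrow> real" and s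
  proof -
    have "continuous_on ({0<..<T} \<times> UNIV) h"
      using that(1) by (intro continuous_at_imp_continuous_on) (auto intro: differentiable_imp_continuous_within)
    moreover have "continuous_on UNIV (\<lambda>p::'a \<times> 'a. (s, fst p, snd p))" by (intro continuous_intros)
    ultimately show ?thesis by (rule continuous_on_compose2) (use ST that(2) in auto)
  qed
  note B = Basis_phase_space
  have shift: "((\<lambda>s. h (s, x, \<xi>)) has_real_derivative D) (at s)"
    if "((\<lambda>u. h ((s, x, \<xi>) + u *\<^sub>R (1, 0, 0))) has_real_derivative D) (at 0)" for h :: "real \<times> 'a \<times> 'a \<Rightarrow> real" and s x \<xi> D
    using that DERIV_shift[of "\<lambda>s. h (s, x, \<xi>)" D 0 s] by (simp add: add.commute)
  have at0: "((\<lambda>u. g ((s, x, \<xi>) + u *\<^sub>R i)) has_real_derivative partial_deriv i g (s, x, \<xi>)) (at 0)"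
    if "s \<in> S" "i \<in> Basis" for s x \<xi> i
    using along(1)[of "(s, x, \<xi>)" i 0] that r by simp
  have "transport f (\<lambda>s x \<xi>. partial_deriv (1, 0, 0) g (s, x, \<xi>)) (\<lambda>b s x \<xi>. partial_deriv (0, b, 0) g (s, x, \<xi>))
      (\<lambda>b s x \<xi>. partial_deriv (0, 0, b) g (s, x, \<xi>)) S"
  proof
    show "open S" "convex S" by (simp_all add: S_def)
    fix s x \<xi> assume s: "s \<in> S"
    then have sT: "s \<in> {0<..<T}" using ST by auto
    show "0 \<le> f s x \<xi>" by (rule nn[OF sT])
    show "continuous_on UNIV (\<lambda>p. f s (fst p) (snd p))" using cont_slice[OF d1 s] unfolding g .
    show "continuous_on UNIV (\<lambda>p. partial_deriv (1, 0, 0) g (s, fst p, snd p))" by (rule cont_slice[OF d2[OF _ B(1)] s])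
    show "(\<lambda>x. f s x \<xi>) differentiable at x" using partial_deriv_slices(1)[OF d1, of s x \<xi>] sT by (simp add: g)
    show "((\<lambda>s. f s x \<xi>) has_real_derivative partial_deriv (1, 0, 0) g (s, x, \<xi>)) (at s)"
      using shift[OF at0[OF s B(1)]] by (simp add: g)
    show "((\<lambda>s. f s x \<xi> * ln (f s x \<xi>)) has_real_derivative (ln (f s x \<xi>) + 1) * partial_deriv (1, 0, 0) g (s, x, \<xi>)) (at s)"
      using shift[of "\<lambda>p. g p * ln (g p)", OF ln_der[OF s B(1)]] by (simp add: g)
    show "partial_deriv (1, 0, 0) g (s, x, \<xi>) = 0" if "f s x \<xi> = 0" using sq[OF s B(1), of x \<xi>] that by (simp add: g)
    fix b :: 'a assume b: "b \<in> Basis"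
    show "continuous_on UNIV (\<lambda>p. partial_deriv (0, b, 0) g (s, fst p, snd p))"
      "continuous_on UNIV (\<lambda>p. partial_deriv (0, 0, b) g (s, fst p, snd p))"
      by (rule cont_slice[OF d2[OF _ B(2)[OF b]] s], assumption) (rule cont_slice[OF d2[OF _ B(3)[OF b]] s])
    show "((\<lambda>u. f s (x + u *\<^sub>R b) \<xi>) has_real_derivative partial_deriv (0, b, 0) g (s, x, \<xi>)) (at 0)"
      "((\<lambda>u. f s x (\<xi> + u *\<^sub>R b)) has_real_derivative partial_deriv (0, 0, b) g (s, x, \<xi>)) (at 0)"
      using at0[OF s B(2)[OF b], of x \<xi>] at0[OF s B(3)[OF b], of x \<xi>] by (simp_all add: g)
    show "((\<lambda>u. f s (x + u *\<^sub>R b) \<xi> * ln (f s (x + u *\<^sub>R b) \<xi>)) has_real_derivative (ln (f s x \<xi>) + 1) * partial_deriv (0, b, 0) g (s, x, \<xi>)) (at 0)"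
      "((\<lambda>u. f s x (\<xi> + u *\<^sub>R b) * ln (f s x (\<xi> + u *\<^sub>R b))) has_real_derivative (ln (f s x \<xi>) + 1) * partial_deriv (0, 0, b) g (s, x, \<xi>)) (at 0)"
      using ln_der[OF s B(2)[OF b], of x \<xi>] ln_der[OF s B(3)[OF b], of x \<xi>] by (simp_all add: g)
    show "partial_deriv (0, b, 0) g (s, x, \<xi>) = 0" "partial_deriv (0, 0, b) g (s, x, \<xi>) = 0" if "f s x \<xi> = 0"
      using sq[OF s B(2)[OF b], of x \<xi>] sq[OF s B(3)[OF b], of x \<xi>] that by (simp_all add: g)
  next
    show "decays S ?N f" using dec1 by (intro decaysI) (simp add: g)
    show "decays S ?N (\<lambda>s x \<xi>. partial_deriv (1, 0, 0) g (s, x, \<xi>))" by (rule decaysI) (rule dec2[OF _ B(1)])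
    show "decays S (2 * DIM('a) + 3) (\<lambda>s x \<xi>. f s x \<xi> * ln (f s x \<xi>))" by (rule ln_dec) (use dec1 qf in \<open>simp_all add: g\<close>)
    show "decays S (2 * DIM('a) + 3) (\<lambda>s x \<xi>. partial_deriv (1, 0, 0) g (s, x, \<xi>) * ln (f s x \<xi>))"
      by (rule ln_dec) (rule dec2[OF _ B(1)] qd[OF _ B(1)], assumption)+
    fix b :: 'a assume b: "b \<in> Basis"
    show "decays S ?N (\<lambda>s x \<xi>. partial_deriv (0, b, 0) g (s, x, \<xi>))" by (rule decaysI) (rule dec2[OF _ B(2)[OF b]])
    show "decays S ?N (\<lambda>s x \<xi>. partial_deriv (0, 0, b) g (s, x, \<xi>))" by (rule decaysI) (rule dec2[OF _ B(3)[OF b]])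
    show "decays S (2 * DIM('a) + 3) (\<lambda>s x \<xi>. partial_deriv (0, b, 0) g (s, x, \<xi>) * ln (f s x \<xi>))"
      by (rule ln_dec) (rule dec2[OF _ B(2)[OF b]] qd[OF _ B(2)[OF b]], assumption)+
    show "decays S (2 * DIM('a) + 3) (\<lambda>s x \<xi>. partial_deriv (0, 0, b) g (s, x, \<xi>) * ln (f s x \<xi>))"
      by (rule ln_dec) (rule dec2[OF _ B(3)[OF b]] qd[OF _ B(3)[OF b]], assumption)+
  qed
  from that[OF tS ST this d1] show ?thesis .
qed

section \<open>Assembling the energy balance at a given time\<close>

theorem theorem4:
  fixes f :: "real \<Rightarrow> 'a::euclidean_space \<Rightarrow> 'a \<Rightarrow> real"
    and \<omega>S \<omega>L :: "'a \<Rightarrow> real"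
    and T D \<delta> \<epsilon> \<alpha> :: real
  assumes "0 < T" and "0 < D" and "0 < \<delta>" and "0 < \<epsilon>" and "0 < \<alpha>"
    and "short_range_kernel \<omega>S" and "\<forall>y. \<omega>S (- y) = \<omega>S y"
    and "long_range_kernel \<delta> \<omega>L"
    and "VCH_solution T D \<epsilon> \<alpha> \<omega>S \<omega>L f"
    and "regular_density T f"
  shows "\<forall>t\<in>{0<..<T}.
      integrable lborel (\<lambda>(x, \<xi>). kinetic_density D f t x \<xi>) \<and>
      integrable lborel (\<lambda>(x, y). interaction_density \<alpha> \<omega>S \<omega>L f t x y) \<and>
      integrable lborel (\<lambda>(x, \<xi>). dissipation D \<epsilon> f t x \<xi>) \<and>
      (free_energy D \<alpha> \<omega>S \<omega>L f has_real_derivative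
         - (2 * D / \<epsilon>\<^sup>2) *
           (LINT (x, \<xi>)|lborel. (f t x \<xi> - rho f t x * maxwellian D \<xi>)
              * (ln (f t x \<xi>) - ln (rho f t x * maxwellian D \<xi>)))) (at t) \<and>
      - (2 * D / \<epsilon>\<^sup>2) *
           (LINT (x, \<xi>)|lborel. (f t x \<xi> - rho f t x * maxwellian D \<xi>)
              * (ln (f t x \<xi>) - ln (rho f t x * maxwellian D \<xi>)))
        = - 2 * D * (LINT (x, \<xi>)|lborel. dissipation D \<epsilon> f t x \<xi>) \<and>
      (\<forall>x \<xi>. 0 \<le> dissipation D \<epsilon> f t x \<xi>)"
proof
  fix t assume t: "t \<in> {0<..<T}"
  note D = assms(2) and eps = assms(4) and \<alpha> = assms(5) and S_even = assms(7)
  define g where "g = (\<lambda>(t, x, \<xi>). f t x \<xi>)"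
  have g: "g (s, x, \<xi>) = f s x \<xi>" for s x \<xi> by (simp add: g_def)
  have nn: "0 \<le> f s x \<xi>" if "s \<in> {0<..<T}" for s x \<xi>
    using assms(9) that unfolding VCH_solution_def by force
  obtain S where tS: "t \<in> S" and ST: "S \<subseteq> {0<..<T}"
    and tr: "transport f (\<lambda>s x \<xi>. partial_deriv (1, 0, 0) g (s, x, \<xi>)) (\<lambda>b s x \<xi>. partial_deriv (0, b, 0) g (s, x, \<xi>))
      (\<lambda>b s x \<xi>. partial_deriv (0, 0, b) g (s, x, \<xi>)) S"
    and diff: "\<And>p. p \<in> {0<..<T} \<times> UNIV \<Longrightarrow> g differentiable at p"
    using regular_density_transport[OF assms(10) nn t] unfolding g_def by metis
  interpret transport f "\<lambda>s x \<xi>. partial_deriv (1, 0, 0) g (s, x, \<xi>)" "\<lambda>b s x \<xi>. partial_deriv (0, b, 0) g (s, x, \<xi>)"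
      "\<lambda>b s x \<xi>. partial_deriv (0, 0, b) g (s, x, \<xi>)" S by (rule tr)
  have iS: "integrable lborel \<omega>S" using assms(6) by (auto simp: short_range_kernel_def has_bochner_integral_iff)
  have hL: "has_bochner_integral lborel \<omega>L 1" and L_even: "\<omega>L (- y) = \<omega>L y" for y
    using assms(8) by (auto simp: long_range_kernel_def)
  interpret interaction \<omega>S "rescale \<alpha> \<omega>L" "1 / \<alpha>\<^sup>2"
    by standard (use iS S_even L_even integrable_rescale[OF \<alpha> hL] integral_rescale[OF \<alpha> hL] in \<open>auto simp: rescale_def[of _ _ "- _"] rescale_def[symmetric]\<close>)
  let ?\<Phi> = "potential (rho f t)"
  obtain B L where \<Phi>: "lipschitz_bounded B L ?\<Phi>"
    using lipschitz_bounded_rho[OF tS] lipschitz_bounded_potential by blast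
  \<comment> \<open>The force is defined with the kernel first in each convolution,
    \<open>potential\<close> with the density first. The exchange goes from the innermost
    convolution outwards, as each one requires measurability of the function inside.\<close>
  have \<Phi>_eq: "(\<lambda>y. Phi_S \<alpha> \<omega>S (rho f t) y + Phi_L \<alpha> \<omega>S \<omega>L (rho f t) y) = ?\<Phi>"
  proof -
    note r = L1_Linf_rho[OF tS]
    have c1: "conv \<omega>S (rho f t) = conv (rho f t) \<omega>S"
      by (rule conv_commute[OF \<omega> L1_Linf_measurable[OF r]])
    have c2: "conv \<omega>S (conv (rho f t) \<omega>S) = conv (conv (rho f t) \<omega>S) \<omega>S"
      by (rule conv_commute[OF \<omega> L1_Linf_measurable[OF L1_Linf_conv[OF \<omega> r]]])
    have c3: "conv (rescale \<alpha> \<omega>L) (conv (conv (rho f t) \<omega>S) \<omega>S) = conv (conv (conv (rho f t) \<omega>S) \<omega>S) (rescale \<alpha> \<omega>L)"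
      by (rule conv_commute[OF a L1_Linf_measurable[OF L1_Linf_conv[OF \<omega> L1_Linf_conv[OF \<omega> r]]]])
    show ?thesis
      unfolding fun_eq_iff Phi_S_def Phi_L_def potential_def c1 c2 c3 by (simp add: right_diff_distrib)
  qed
  have eq: "\<epsilon>\<^sup>2 * partial_deriv (1, 0, 0) g (t, x, \<xi>) + \<epsilon> * (\<Sum>b\<in>Basis. (\<xi> \<bullet> b) * partial_deriv (0, b, 0) g (t, x, \<xi>))
      - \<epsilon> * (\<Sum>b\<in>Basis. partial_deriv b ?\<Phi> x * partial_deriv (0, 0, b) g (t, x, \<xi>)) = rho f t x * maxwellian D \<xi> - f t x \<xi>" for x \<xi>
  proof -
    have dg: "g differentiable at (t, x, \<xi>)" by (rule diff) (use t in auto)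
    have "deriv (\<lambda>s. f s x \<xi>) t = partial_deriv (1, 0, 0) g (t, x, \<xi>)"
      by (rule DERIV_imp_deriv[OF der(1)[OF tS]])
    moreover have "\<xi> \<bullet> grad (\<lambda>y. f t y \<xi>) x = (\<Sum>b\<in>Basis. (\<xi> \<bullet> b) * partial_deriv (0, b, 0) g (t, x, \<xi>))"
      unfolding inner_grad using partial_deriv_slices(2)[OF dg] by (simp add: g)
    moreover have "force \<alpha> \<omega>S \<omega>L (rho f t) x \<bullet> grad (f t x) \<xi> = - (\<Sum>b\<in>Basis. partial_deriv b ?\<Phi> x * partial_deriv (0, 0, b) g (t, x, \<xi>))"
      unfolding inner_grad force_def \<Phi>_eq using partial_deriv_slices(3)[OF dg]
      by (simp add: g grad_inner_Basis sum_negf)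
    moreover have "\<epsilon>\<^sup>2 * deriv (\<lambda>s. f s x \<xi>) t + \<epsilon> * (\<xi> \<bullet> grad (\<lambda>y. f t y \<xi>) x)
        + \<epsilon> * (force \<alpha> \<omega>S \<omega>L (rho f t) x \<bullet> grad (f t x) \<xi>) = rho f t x * maxwellian D \<xi> - f t x \<xi>"
      using assms(9) t unfolding VCH_solution_def by blast
    ultimately show ?thesis by simp
  qed
  let ?P = "\<lambda>x \<xi>. (f t x \<xi> - rho f t x * maxwellian D \<xi>) * (ln (f t x \<xi>) - ln (rho f t x * maxwellian D \<xi>))"
  note balance = integrable_multiplier_rate[OF tS D eps \<Phi> eq] integrable_relative_entropy_production[OF tS D eps \<Phi> eq]
    integral_multiplier_rate[OF tS D eps \<Phi> eq]
  have diss: "dissipation D \<epsilon> f t x \<xi> = 1 / \<epsilon>\<^sup>2 * ?P x \<xi>" for x \<xi> by (simp add: dissipation_def)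
  have diss': "(\<lambda>(x, \<xi>). dissipation D \<epsilon> f t x \<xi>) = (\<lambda>p. 1 / \<epsilon>\<^sup>2 * (case p of (x, \<xi>) \<Rightarrow> ?P x \<xi>))"
    by (auto simp: fun_eq_iff diss)
  obtain A where A: "A \<ge> 0"
    "\<And>s x. s \<in> S \<Longrightarrow> \<bar>rho f s x\<bar> \<le> A / (1 + norm x) ^ (DIM('a) + 3)"
    "\<And>s t x. s \<in> S \<Longrightarrow> t \<in> S \<Longrightarrow> \<bar>rho f s x - rho f t x\<bar> \<le> A / (1 + norm x) ^ (DIM('a) + 3) * \<bar>s - t\<bar>"
    "\<And>t x. t \<in> S \<Longrightarrow> ((\<lambda>s. rho f s x) has_real_derivative (LINT \<xi>|lborel. partial_deriv (1, 0, 0) g (t, x, \<xi>))) (at t)"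
    by (rule rho_bounds) (rule that)
  have "((\<lambda>s. LINT x|lborel. potential (rho f s) x * rho f s x) has_real_derivative
      2 * (LINT x|lborel. ?\<Phi> x * (LINT \<xi>|lborel. partial_deriv (1, 0, 0) g (t, x, \<xi>)))) (at t)"
  proof (rule has_real_derivative_interaction_energy[OF S(1) tS])
    have "integrable lborel (\<lambda>x::'a. A * (1 / (1 + norm x) ^ (DIM('a) + 3)))"
      by (intro integrable_mult_right integrable_inverse_power_one_plus_norm) simp
    then show "integrable lborel (\<lambda>x::'a. A / (1 + norm x) ^ (DIM('a) + 3))" by simp
    show "A / (1 + norm x) ^ (DIM('a) + 3) \<le> A" for x :: 'a by (rule divide_one_plus_norm_power_le[OF A(1)])
    then show "\<bar>rho f s x\<bar> \<le> A" if "s \<in> S" for s x using A(2)[OF that, of x] order_trans by blast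
  qed (use L1_Linf_rho A(3,4) tS in auto)
  note derI = this
  let ?ft = "\<lambda>x \<xi>. partial_deriv (1, 0, 0) g (t, x, \<xi>)"
  let ?K = "\<lambda>x \<xi>. (2 * D * (ln (f t x \<xi>) + 1) + (norm \<xi>)\<^sup>2) * ?ft x \<xi>"
  have iK: "integrable lborel (\<lambda>(x, \<xi>). ?K x \<xi>)" by (rule integrable_kinetic_rate[OF tS])
  \<comment> \<open>The multiplier minus the kinetic rate is 2 \<Phi>, so this product is integrable
    as a difference of integrable functions. Fubini then identifies its integral with the rate of
    the interaction energy in \<open>derI\<close>.\<close>
  have split: "(\<lambda>(x, \<xi>). 2 * ?\<Phi> x * ?ft x \<xi>) = (\<lambda>p. (case p of (x, \<xi>) \<Rightarrow> multiplier D ?\<Phi> t x \<xi> * ?ft x \<xi>) - (case p of (x, \<xi>) \<Rightarrow> ?K x \<xi>))"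
    by (auto simp: fun_eq_iff multiplier_def algebra_simps)
  have i\<Phi>: "integrable lborel (\<lambda>(x, \<xi>). 2 * ?\<Phi> x * ?ft x \<xi>)"
    unfolding split by (rule Bochner_Integration.integrable_diff[OF balance(1) iK])
  have "(LINT (x, \<xi>)|lborel. multiplier D ?\<Phi> t x \<xi> * ?ft x \<xi>) - (LINT (x, \<xi>)|lborel. ?K x \<xi>)
      = (LINT (x, \<xi>)|lborel. 2 * ?\<Phi> x * ?ft x \<xi>)"
    unfolding split by (rule Bochner_Integration.integral_diff[OF balance(1) iK, symmetric])
  also have "\<dots> = 2 * (LINT x|lborel. ?\<Phi> x * (LINT \<xi>|lborel. ?ft x \<xi>))"
    using lborel_integral_fst[OF i\<Phi>] by (simp add: mult.assoc)
  finally have rate: "(LINT (x, \<xi>)|lborel. ?K x \<xi>) + 2 * (LINT x|lborel. ?\<Phi> x * (LINT \<xi>|lborel. ?ft x \<xi>))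
      = - (2 * D / \<epsilon>\<^sup>2) * (LINT (x, \<xi>)|lborel. ?P x \<xi>)"
    using balance(3) by simp
  have "((\<lambda>s. (LINT (x, \<xi>)|lborel. kinetic_density D f s x \<xi>) + (LINT x|lborel. potential (rho f s) x * rho f s x))
      has_real_derivative - (2 * D / \<epsilon>\<^sup>2) * (LINT (x, \<xi>)|lborel. ?P x \<xi>)) (at t)"
    unfolding rate[symmetric] by (rule DERIV_add[OF has_real_derivative_kinetic_energy[OF tS] derI])
  \<comment> \<open>Rewriting the free energy through the potential is justified for times in
    \<open>S\<close>, where \<rho> is known to be bounded and integrable; agreement on this open
    window suffices for the derivative at \<open>t\<close>.\<close>
  then have fe: "(free_energy D \<alpha> \<omega>S \<omega>L f has_real_derivative - (2 * D / \<epsilon>\<^sup>2) * (LINT (x, \<xi>)|lborel. ?P x \<xi>)) (at t)"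
  proof (rule has_field_derivative_transform_within_open[OF _ S(1) tS])
    fix s assume s: "s \<in> S"
    show "(LINT (x, \<xi>)|lborel. kinetic_density D f s x \<xi>) + (LINT x|lborel. potential (rho f s) x * rho f s x) = free_energy D \<alpha> \<omega>S \<omega>L f s"
      using integral_interaction[OF L1_Linf_rho[OF s]] by (simp add: free_energy_def interaction_density_def mult.commute)
  qed
  have ii: "integrable lborel (\<lambda>(x, y). interaction_density \<alpha> \<omega>S \<omega>L f t x y)"
    unfolding interaction_density_def by (rule integrable_interaction[OF L1_Linf_rho[OF tS]])
  have id: "integrable lborel (\<lambda>(x, \<xi>). dissipation D \<epsilon> f t x \<xi>)"
    unfolding diss' by (rule integrable_mult_right) (rule balance(2))
  have ed: "- (2 * D / \<epsilon>\<^sup>2) * (LINT (x, \<xi>)|lborel. ?P x \<xi>) = - 2 * D * (LINT (x, \<xi>)|lborel. dissipation D \<epsilon> f t x \<xi>)"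
    unfolding diss' integral_mult_right_zero by simp
  have nonneg: "0 \<le> dissipation D \<epsilon> f t x \<xi>" for x \<xi>
    unfolding diss by (rule mult_nonneg_nonneg[OF _ ln_mult_diff_nonneg[OF tS D eps \<Phi> eq]]) simp
  show "integrable lborel (\<lambda>(x, \<xi>). kinetic_density D f t x \<xi>) \<and>
      integrable lborel (\<lambda>(x, y). interaction_density \<alpha> \<omega>S \<omega>L f t x y) \<and>
      integrable lborel (\<lambda>(x, \<xi>). dissipation D \<epsilon> f t x \<xi>) \<and>
      (free_energy D \<alpha> \<omega>S \<omega>L f has_real_derivative - (2 * D / \<epsilon>\<^sup>2) * (LINT (x, \<xi>)|lborel. ?P x \<xi>)) (at t) \<and>
      - (2 * D / \<epsilon>\<^sup>2) * (LINT (x, \<xi>)|lborel. ?P x \<xi>) = - 2 * D * (LINT (x, \<xi>)|lborel. dissipation D \<epsilon> f t x \<xi>) \<and>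
      (\<forall>x \<xi>. 0 \<le> dissipation D \<epsilon> f t x \<xi>)"
    using integrable_kinetic_density[OF tS] ii id fe ed nonneg by blast
qed

end
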